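(* Let $n\ge 2$ be an integer and $s\in(0,1)$. Let $u$ be $(-\Delta)^s$-harmonic in $\mathbb{R}^n\setminus\{0\}$. Suppose that $u$ is bounded from above or from below in some neighborhood of $0$, and that $u$ is bounded from above or from below in some neighborhood of infinity (i.e. on $\mathbb{R}^n\setminus B_R$ for some $R>0$). Then there exist constants $a,b\in\mathbb{R}$ such that $$u(x)=a|x|^{2s-n}+b \quad\text{for } x\in\mathbb{R}^n\setminus\{0\}.$$
   Context: Notation: $B_r(x_0)$ is the open ball of radius $r$ centered at $x_0$, $B_r=B_r(0)$. For an open set $\Omega\subset\mathbb{R}^n$, $W^{s,2}(\Omega)$ is the space of measurable $u$ with $\int_\Omega|u|^2\,dx+\int_\Omega\int_\Omega\frac{|u(x)-u(y)|^2}{|x-y|^{n+2s}}\,dy\,dx<\infty$, and $W^{s,2}_{\mathrm{loc}}(\Omega)$ is the set of $u$ with $u\in W^{s,2}(G)$ for every open $G\Subset\Omega$. The tail space is $L^1_{2s}(\mathbb{R}^n)=\{u \text{ measurable}:\int_{\mathbb{R}^n}\frac{|u(y)|}{(1+|y|)^{n+2s}}dy<\infty\}$. Let $k(x,y)=\frac{2^{2s-1}\Gamma(\frac n2+s)}{\pi^{n/2}|\Gamma(-s)|}|x-y|^{-n-2s}$ (the kernel of the fractional Laplacian $(-\Delta)^s$), and $\mathcal{E}(u,v)=\int_{\mathbb{R}^n}\int_{\mathbb{R}^n}(u(x)-u(y))(v(x)-v(y))k(x,y)\,dy\,dx$. A function $u$ is a weak solution of $(-\Delta)^s u=0$ in an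 open set $\Omega$ if $u\in W^{s,2}_{\mathrm{loc}}(\Omega)\cap L^1_{2s}(\mathbb{R}^n)$ and $\mathcal{E}(u,\varphi)=0$ for all $\varphi\in C^\infty_c(\Omega)$; $u$ is $(-\Delta)^s$-harmonic in $\Omega$ if it is such a weak solution and moreover $u\in C(\Omega)$. *)

theory Defs
  imports "HOL-Analysis.Analysis"
begin

fun Ck :: "nat \<Rightarrow> ('a::euclidean_space \<Rightarrow> real) \<Rightarrow> bool" where
  "Ck 0 f = continuous_on UNIV f"
| "Ck (Suc k) f = (\<exists>f'. (\<forall>x. (f has_derivative f' x) (at x)) \<and> (\<forall>v. Ck k (\<lambda>x. f' x v)))"

definition smooth_fun :: "('a::euclidean_space \<Rightarrow> real) \<Rightarrow> bool" where
  "smooth_fun f \<longleftrightarrow> (\<forall>k. Ck k f)"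

definition test_fun :: "'a::euclidean_space set \<Rightarrow> ('a \<Rightarrow> real) \<Rightarrow> bool" where
  "test_fun \<Omega> \<phi> \<longleftrightarrow> smooth_fun \<phi> \<and> compact (closure {x. \<phi> x \<noteq> 0})
      \<and> closure {x. \<phi> x \<noteq> 0} \<subseteq> \<Omega>"

definition Wsp :: "real \<Rightarrow> 'a::euclidean_space set \<Rightarrow> ('a \<Rightarrow> real) \<Rightarrow> bool" where
  "Wsp s \<Omega> u \<longleftrightarrow>
     (\<lambda>x. indicator \<Omega> x * u x) \<in> borel_measurable lebesgue
   \<and> (\<integral>\<^sup>+ x. indicator \<Omega> x * ennreal ((u x)\<^sup>2) \<partial>lebesgue) < \<infinity>
   \<and> (\<integral>\<^sup>+ x. \<integral>\<^sup>+ y. indicator \<Omega> x * indicator \<Omega> y *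
          ennreal ((u x - u y)\<^sup>2 / norm (x - y) powr (real DIM('a) + 2 * s)) \<partial>lebesgue \<partial>lebesgue) < \<infinity>"

definition Wsp_loc :: "real \<Rightarrow> 'a::euclidean_space set \<Rightarrow> ('a \<Rightarrow> real) \<Rightarrow> bool" where
  "Wsp_loc s \<Omega> u \<longleftrightarrow> (\<forall>G. open G \<and> compact (closure G) \<and> closure G \<subseteq> \<Omega> \<longrightarrow> Wsp s G u)"

definition tail_space :: "real \<Rightarrow> ('a::euclidean_space \<Rightarrow> real) \<Rightarrow> bool" where
  "tail_space s u \<longleftrightarrow> u \<in> borel_measurable lebesgue
     \<and> (\<integral>\<^sup>+ y. ennreal (\<bar>u y\<bar> / (1 + norm y) powr (real DIM('a) + 2 * s)) \<partial>lebesgue) < \<infinity>"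

definition frac_kernel :: "real \<Rightarrow> 'a::euclidean_space \<Rightarrow> 'a \<Rightarrow> real" where
  "frac_kernel s x y =
     (2 powr (2 * s - 1) * Gamma (real DIM('a) / 2 + s) / (pi powr (real DIM('a) / 2) * \<bar>Gamma (- s)\<bar>))
     * norm (x - y) powr (- real DIM('a) - 2 * s)"

definition frac_energy :: "real \<Rightarrow> ('a::euclidean_space \<Rightarrow> real) \<Rightarrow> ('a \<Rightarrow> real) \<Rightarrow> real" where
  "frac_energy s u v = (\<integral>x. (\<integral>y. (u x - u y) * (v x - v y) * frac_kernel s x y \<partial>lebesgue) \<partial>lebesgue)"

definition weak_sol :: "real \<Rightarrow> 'a::euclidean_space set \<Rightarrow> ('a \<Rightarrow> real) \<Rightarrow> bool" where
  "weak_sol s \<Omega> u \<longleftrightarrow> Wsp_loc s \<Omega> u \<and> tail_space s u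
     \<and> (\<forall>\<phi>. test_fun \<Omega> \<phi> \<longrightarrow> frac_energy s u \<phi> = 0)"

definition frac_harmonic :: "real \<Rightarrow> 'a::euclidean_space set \<Rightarrow> ('a \<Rightarrow> real) \<Rightarrow> bool" where
  "frac_harmonic s \<Omega> u \<longleftrightarrow> weak_sol s \<Omega> u \<and> continuous_on \<Omega> u"

end

theory Submission
  imports Defs
begin

text \<open>
  Write \<open>p = n + 2s\<close> and let \<open>L \<phi> (x)\<close> be the integral of
  \<open>\<phi>(x+h) + \<phi>(x-h) - 2\<phi>(x)\<close> against \<open>|h| powr -p\<close>.
  Symmetrising the energy gives \<open>\<integral> u L\<phi> = 0\<close> for test functions supported off the
  origin. By cutting off with uniform second-order bounds this extends to all rapidly decaying smooth
  functions that vanish to second order at \<open>0\<close>; hence on a Gaussian \<open>G\<^sub>t(\<cdot> - z)\<close>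
  the functional depends only on value and gradient of the Gaussian at \<open>0\<close>. Subordination,
  \<open>|h| powr -p = c \<integral> \<tau> powr (-1-s) G\<^sub>\<tau>(h) d\<tau>\<close>, turns this into an
  equation for the heat extension \<open>U t z = \<integral> u G\<^sub>t(\<cdot> - z)\<close>: its Marchaud derivative
  of order \<open>s\<close> in \<open>t\<close> is an explicit combination of inverse-gamma densities,
  for which an Abel integral provides an explicit particular solution.
  Second differences in \<open>z\<close> of \<open>U\<close> minus this solution vanish as \<open>t\<close> tends to
  infinity, so by the maximum principle for the Marchaud derivative they are zero. As \<open>t\<close> tends
  to \<open>0\<close>, \<open>u\<close> minus a monopole \<open>a|z| powr (2s-n)\<close> and a dipole
  \<open>(\<gamma>\<bullet>z)|z| powr (2s-n-2)\<close> satisfies the midpoint equation off the origin.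
  The one-sided bound at infinity makes it constant, and the one-sided bound at \<open>0\<close> kills the dipole.
\<close>

section \<open>Radial integrability and polynomial weights\<close>

text \<open>The only global information on \<open>u\<close> is integrability against the weight
  \<open>(1 + |x|) powr -p\<close>, so limits of integrals of \<open>u\<close> are taken by
  dominated convergence against that weight, and the one-sided bounds wait until the end. Two
  obstacles shape the argument. A cut-off at scale \<open>e\<close> around the origin costs
  \<open>1/e\<close> per derivative; vanishing to second order pays for the two derivatives that the
  operator consumes, which is why just the value and the gradient at \<open>0\<close> survive. At
  large times the heat kernel is too big for the weight; each difference in \<open>z\<close> gains a
  factor of order \<open>t powr (-1/2)\<close>, and two of them suffice for every
  \<open>s < 1\<close>. Trading the operator in space for a Marchaud derivative in time reduces
  uniqueness to a maximum principle on a half-line, without Fourier analysis or regularity theory.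
  Dimension at least 2 makes the Abel integrals converge at infinity, since
  \<open>n/2 \<ge> 1 > s\<close>, and lets two points on a line through the origin be compared
  through a third point off that line.\<close>

lemma distr_norm_lborel:
  "distr (lborel :: 'a::euclidean_space measure) borel norm =
     density lborel (\<lambda>r. ennreal (indicator {0<..} r * (real DIM('a) * unit_ball_vol DIM('a) * r ^ (DIM('a) - 1))))"
    (is "?M = ?N")
proof -
  let ?\<omega> = "unit_ball_vol DIM('a)"
  \<comment> \<open>On the half-line up to \<open>a\<close> both measures give the volume of the
    ball of radius \<open>a\<close>. Half-lines generate the Borel sets and are stable under
    intersection, so this takes the place of an integration over spheres.\<close>
  have eq: "emeasure ?M {..a} = emeasure ?N {..a}" for a :: real
  proof -
    have M: "emeasure ?M {..a} = emeasure lborel (norm -` {..a} :: 'a set)"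
      by (subst emeasure_distr) auto
    have N: "emeasure ?N {..a} = (\<integral>\<^sup>+ r. ennreal (indicator {0<..} r * (real DIM('a) * ?\<omega> * r ^ (DIM('a) - 1))) * indicator {..a} r \<partial>lborel)"
      by (subst emeasure_density) auto
    show ?thesis
    proof (cases "a \<ge> 0")
      case False
      then have e1: "(norm -` {..a} :: 'a set) = {}"
        by (auto simp: vimage_def) (meson norm_ge_zero order_trans)
      have "emeasure ?N {..a} = (\<integral>\<^sup>+ (r::real). 0 \<partial>lborel)"
        unfolding N by (intro nn_integral_cong) (use False in \<open>simp add: indicator_def\<close>)
      then show ?thesis unfolding M e1 by simp
    next
      case True
      have e1: "(norm -` {..a} :: 'a set) = cball 0 a" by auto
      have "emeasure ?N {..a} = (\<integral>\<^sup>+ r. ennreal (real DIM('a) * ?\<omega> * r ^ (DIM('a) - 1)) * indicator {0..a} r \<partial>lborel)"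
        unfolding N
      proof (intro nn_integral_cong_AE)
        have "AE r in lborel. r \<noteq> (0::real)" by (rule AE_lborel_singleton)
        then show "AE r in lborel. ennreal (indicator {0<..} r * (real DIM('a) * ?\<omega> * r ^ (DIM('a) - 1))) * indicator {..a} r
           = ennreal (real DIM('a) * ?\<omega> * r ^ (DIM('a) - 1)) * indicator {0..a} r"
          by eventually_elim (auto simp: indicator_def)
      qed
      also have "\<dots> = ennreal (?\<omega> * a ^ DIM('a) - ?\<omega> * 0 ^ DIM('a))"
      proof (rule nn_integral_FTC_Icc)
        fix x :: real assume "x \<in> {0..a}"
        show "DERIV (\<lambda>r. ?\<omega> * r ^ DIM('a)) x :> real DIM('a) * ?\<omega> * x ^ (DIM('a) - 1)"
          by (auto intro!: derivative_eq_intros)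
      qed (use True in auto)
      also have "\<dots> = emeasure ?M {..a}"
        unfolding M e1 using True by (simp add: emeasure_cball)
      finally show ?thesis by simp
    qed
  qed
  show ?thesis
  proof (rule measure_eqI_generator_eq[where E="range (\<lambda>a::real. {..a})" and \<Omega>=UNIV and A="\<lambda>i. {..real i}"])
    show "Int_stable (range (\<lambda>a::real. {..a}))"
      by (auto simp: Int_stable_def)
    show "sets ?M = sigma_sets UNIV (range (\<lambda>a::real. {..a}))"
      by (simp add: borel_eq_atMost)
    show "sets ?N = sigma_sets UNIV (range (\<lambda>a::real. {..a}))"
      by (simp add: borel_eq_atMost)
    show "(\<Union>i. {..real i}) = UNIV"
      by (auto intro: real_arch_simple)
    fix i
    have "(norm -` {..real i} :: 'a set) = cball 0 (real i)" by auto
    then show "emeasure ?M {..real i} \<noteq> \<infinity>"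
      by (subst emeasure_distr) (auto simp: emeasure_cball)
  qed (use eq in auto)
qed

lemma nn_integral_radial:
  assumes [measurable]: "F \<in> borel_measurable borel"
  shows "(\<integral>\<^sup>+ (x::'a::euclidean_space). F (norm x) \<partial>lborel) =
     (\<integral>\<^sup>+ r. ennreal (indicator {0<..} r * (real DIM('a) * unit_ball_vol DIM('a) * r ^ (DIM('a) - 1))) * F r \<partial>lborel)"
proof -
  have "(\<integral>\<^sup>+ (x::'a). F (norm x) \<partial>lborel) = (\<integral>\<^sup>+ r. F r \<partial>distr (lborel :: 'a measure) borel norm)"
    by (subst nn_integral_distr) auto
  then show ?thesis unfolding distr_norm_lborel by (subst (asm) nn_integral_density) auto
qed

lemma nn_integral_powr_Ioi:
  assumes "a > 0" "b > 1"
  shows "(\<integral>\<^sup>+ (r::real). ennreal (indicator {a<..} r * r powr -b) \<partial>lborel) = ennreal (a powr (1 - b) / (b - 1))"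
proof -
  have "(\<integral>\<^sup>+ (r::real). ennreal (indicator {a..} r * r powr -b) * indicator {a..} r \<partial>lborel) = ennreal (0 - (- (a powr (1 - b) / (b - 1))))"
  proof (rule nn_integral_FTC_atLeast[where F="\<lambda>r. - (r powr (1-b) / (b-1))"])
    fix x assume "a \<le> x"
    then have "x > 0" using assms by simp
    have "DERIV (\<lambda>r. - (r powr (1-b) / (b-1))) x :> - ((1 - b) * x powr (1 - b - 1) / (b - 1))"
      using \<open>x > 0\<close> by (intro DERIV_minus DERIV_cdivide has_real_derivative_powr)
    moreover have "- ((1 - b) * x powr (1 - b - 1) / (b - 1)) = indicator {a..} x * x powr -b"
      using assms \<open>a \<le> x\<close> by (simp add: divide_simps) (simp add: algebra_simps)
    ultimately show "DERIV (\<lambda>r. - (r powr (1-b) / (b-1))) x :> indicator {a..} x * x powr -b" by simp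
  next
    have "((\<lambda>r::real. r powr (1-b)) \<longlongrightarrow> 0) at_top"
      using assms by (intro tendsto_neg_powr filterlim_ident) auto
    from tendsto_minus[OF tendsto_divide[OF this tendsto_const, of "b-1"]]
    show "((\<lambda>r. - (r powr (1-b) / (b-1))) \<longlongrightarrow> 0) at_top" using assms by simp
  qed auto
  moreover have "(\<integral>\<^sup>+ (r::real). ennreal (indicator {a..} r * r powr -b) * indicator {a..} r \<partial>lborel) =
     (\<integral>\<^sup>+ (r::real). ennreal (indicator {a<..} r * r powr -b) \<partial>lborel)"
  proof (intro nn_integral_cong_AE)
    have "AE r in lborel. r \<noteq> a" by (rule AE_lborel_singleton)
    then show "AE r in lborel. ennreal (indicator {a..} r * r powr -b) * indicator {a..} r = ennreal (indicator {a<..} r * r powr -b)"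
      by eventually_elim (auto simp: indicator_def)
  qed
  ultimately show ?thesis by simp
qed

lemma integrable_powr_Ici:
  assumes "a > 0" "b > 1"
  shows "integrable lborel (\<lambda>r::real. indicator {a..} r * r powr -b)"
proof (rule integrableI_bounded)
  have "(\<integral>\<^sup>+ (r::real). ennreal (norm (indicator {a..} r * r powr -b)) \<partial>lborel) =
     (\<integral>\<^sup>+ (r::real). ennreal (indicator {a<..} r * r powr -b) \<partial>lborel)"
  proof (intro nn_integral_cong_AE)
    have "AE r in lborel. r \<noteq> a" by (rule AE_lborel_singleton)
    then show "AE r in lborel. ennreal (norm (indicator {a..} r * r powr -b)) = ennreal (indicator {a<..} r * r powr -b)"
      by eventually_elim (auto simp: indicator_def)
  qed
  then show "(\<integral>\<^sup>+ (r::real). ennreal (norm (indicator {a..} r * r powr -b)) \<partial>lborel) < \<infinity>"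
    using nn_integral_powr_Ioi[OF assms] by (simp only: ennreal_less_top infinity_ennreal_def)
qed auto

lemma integrable_powr_Ioc:
  assumes "a \<ge> 0" "b > -1"
  shows "integrable lborel (\<lambda>r::real. indicator {0<..a} r * r powr b)"
proof (rule integrableI_bounded)
  have "((\<lambda>x. x powr b) has_integral (a powr (b + 1) / (b + 1))) {0..a}"
    using has_integral_powr_from_0[OF assms(2,1)] by simp
  then have "((\<lambda>x. if x \<in> {0..a} then x powr b else 0) has_integral (a powr (b + 1) / (b + 1))) UNIV"
    by (simp only: has_integral_restrict_UNIV)
  then have "(\<integral>\<^sup>+ x. ennreal (if x \<in> {0..a} then x powr b else 0) \<partial>lborel) = ennreal (a powr (b + 1) / (b + 1))"
    by (intro nn_integral_has_integral_lborel) auto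
  moreover have "(\<integral>\<^sup>+ x. ennreal (if x \<in> {0..a} then x powr b else 0) \<partial>lborel) = (\<integral>\<^sup>+ r. ennreal (norm (indicator {0<..a} r * r powr b)) \<partial>lborel)"
    by (intro nn_integral_cong) (auto simp: indicator_def)
  ultimately show "(\<integral>\<^sup>+ r. ennreal (norm (indicator {0<..a} r * r powr b)) \<partial>lborel) < \<infinity>"
    by (metis ennreal_less_top infinity_ennreal_def)
qed auto

lemma integrable_radial:
  fixes F :: "real \<Rightarrow> real"
  assumes [measurable]: "F \<in> borel_measurable borel"
    and int: "integrable lborel (\<lambda>r. indicator {0<..} r * (r ^ (DIM('a) - 1) * F r))"
  shows "integrable lborel (\<lambda>x::'a::euclidean_space. F (norm x))"
proof (rule integrableI_bounded)
  let ?c = "real DIM('a) * unit_ball_vol DIM('a)"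
  have "(\<integral>\<^sup>+ (x::'a). ennreal (norm (F (norm x))) \<partial>lborel) =
    (\<integral>\<^sup>+ r. ennreal (indicator {0<..} r * (?c * r ^ (DIM('a) - 1))) * ennreal (norm (F r)) \<partial>lborel)"
    by (rule nn_integral_radial) auto
  also have "\<dots> = (\<integral>\<^sup>+ r. ennreal (norm (?c * (indicator {0<..} r * (r ^ (DIM('a) - 1) * F r)))) \<partial>lborel)"
    by (intro nn_integral_cong) (auto simp: indicator_def abs_mult ennreal_mult' [symmetric] mult_ac)
  also have "\<dots> < \<infinity>"
    using integrable_mult_right[OF int, of ?c] unfolding integrable_iff_bounded by blast
  finally show "(\<integral>\<^sup>+ (x::'a). ennreal (norm (F (norm x))) \<partial>lborel) < \<infinity>" .
qed auto

lemma lborel_integral_translate: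
  fixes f :: "'a::euclidean_space \<Rightarrow> real"
  assumes "f \<in> borel_measurable borel"
  shows "(\<integral>y. f (x + y) \<partial>lborel) = (\<integral>y. f y \<partial>lborel)" "(\<integral>y. f (x - y) \<partial>lborel) = (\<integral>y. f y \<partial>lborel)"
    "integrable lborel (\<lambda>y. f (x + y)) \<longleftrightarrow> integrable lborel f" "integrable lborel (\<lambda>y. f (x - y)) \<longleftrightarrow> integrable lborel f"
proof -
  note [measurable] = assms
  have e: "(lborel :: 'a measure) = distr lborel borel (\<lambda>h. x + (-1) *\<^sub>R h)"
    using lborel_affine[of "-1" x] by (simp add: density_1)
  have "(\<integral>y. f y \<partial>lborel) = (\<integral>y. f y \<partial>distr lborel borel (\<lambda>h. x + (-1) *\<^sub>R h))"
    using e by simp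
  then show "(\<integral>y. f (x - y) \<partial>lborel) = (\<integral>y. f y \<partial>lborel)"
    by (subst (asm) integral_distr) auto
  have "integrable lborel f \<longleftrightarrow> integrable (distr lborel borel (\<lambda>h. x + (-1) *\<^sub>R h)) f"
    using e by simp
  then show "integrable lborel (\<lambda>y. f (x - y)) \<longleftrightarrow> integrable lborel f"
    by (subst (asm) integrable_distr_eq) auto
  have "(\<integral>y. f y \<partial>lborel) = (\<integral>y. f y \<partial>distr lborel borel ((+) x))"
    by (simp add: lborel_distr_plus)
  then show "(\<integral>y. f (x + y) \<partial>lborel) = (\<integral>y. f y \<partial>lborel)"
    by (subst (asm) integral_distr) auto
  have "integrable lborel f \<longleftrightarrow> integrable (distr lborel borel ((+) x)) f"
    by (simp add: lborel_distr_plus)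
  then show "integrable lborel (\<lambda>y. f (x + y)) \<longleftrightarrow> integrable lborel f"
    by (subst (asm) integrable_distr_eq) auto
qed

definition wt :: "real \<Rightarrow> 'a::real_normed_vector \<Rightarrow> real" where
  "wt p x = (1 + norm x) powr -p"

lemma wt_pos [simp]: "0 < wt p x" and wt_nonneg [simp]: "0 \<le> wt p x"
  using norm_ge_zero[of x] by (auto simp: wt_def simp del: norm_ge_zero)

lemma wt_le_1: "p \<ge> 0 \<Longrightarrow> wt p x \<le> 1"
  by (simp add: wt_def powr_minus inverse_le_1_iff ge_one_powr_ge_zero)

lemma borel_measurable_wt [measurable]: "wt p \<in> borel_measurable borel"
  unfolding wt_def[abs_def] by measurable

lemma wt_le:
  assumes "p \<ge> 0" "1 + norm x \<le> c * (1 + norm y)" "c > 0"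
  shows "wt p y \<le> c powr p * wt p x"
proof -
  have "(1 + norm x) powr p \<le> (c * (1 + norm y)) powr p"
    using assms by (intro powr_mono2) auto
  also have "\<dots> = c powr p * (1 + norm y) powr p"
    by (rule powr_mult)
  finally show ?thesis
    using powr_gt_zero[of "1 + norm x" p] powr_gt_zero[of "1 + norm y" p] norm_ge_zero[of x] norm_ge_zero[of y]
    by (simp add: wt_def powr_minus divide_simps mult_ac del: norm_ge_zero powr_gt_zero)
qed

lemma wt_shift: "p \<ge> 0 \<Longrightarrow> norm h \<le> 1 \<Longrightarrow> wt p (x + h) \<le> 2 powr p * wt p x"
  by (rule wt_le) (use norm_triangle_ineq4[of "x+h" h] norm_ge_zero[of "x+h"] in \<open>auto simp del: norm_ge_zero\<close>)

text \<open>One of \<open>a\<close> and \<open>b\<close> has at least half the norm of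
  \<open>x\<close>, so its weight is at most \<open>2 powr p * wt p x\<close>; the other factor is
  kept for integration. This is the pointwise form of the estimate that the weight convolved with
  itself is dominated by the weight.\<close>

lemma wt_mult:
  assumes p: "p \<ge> 0" and "norm x \<le> norm a + norm b"
  shows "wt p a * wt p b \<le> 2 powr p * wt p x * (wt p a + wt p b)"
proof (cases "norm a \<le> norm b")
  case True
  then have "wt p b \<le> 2 powr p * wt p x"
    using assms by (intro wt_le) auto
  then have "wt p a * wt p b \<le> wt p a * (2 powr p * wt p x)"
    by (intro mult_left_mono) auto
  also have "\<dots> \<le> 2 powr p * wt p x * (wt p a + wt p b)" by (simp add: algebra_simps)
  finally show ?thesis .
next
  case False
  then have "wt p a \<le> 2 powr p * wt p x"
    using assms by (intro wt_le) auto
  then have "wt p a * wt p b \<le> (2 powr p * wt p x) * wt p b"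
    by (intro mult_right_mono) auto
  also have "\<dots> \<le> 2 powr p * wt p x * (wt p a + wt p b)" by (simp add: algebra_simps)
  finally show ?thesis .
qed

lemma integrable_wt:
  assumes "p > real DIM('a)"
  shows "integrable lborel (wt p :: 'a::euclidean_space \<Rightarrow> real)"
proof -
  let ?n = "DIM('a)"
  have "integrable lborel (\<lambda>x::'a. (1 + norm x) powr -p)"
  proof (rule integrable_radial[where F="\<lambda>r. (1 + r) powr -p"])
    have "integrable lborel (\<lambda>r::real. indicator {0<..1} r * r powr 0 + indicator {1..} r * r powr - (p - ?n + 1))"
      using assms by (intro Bochner_Integration.integrable_add integrable_powr_Ici integrable_powr_Ioc) auto
    then show "integrable lborel (\<lambda>r. indicator {0<..} r * (r ^ (?n - 1) * (1 + r) powr - p))"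
    proof (rule Bochner_Integration.integrable_bound, measurable, intro AE_I2)
      fix r :: real
      have "r ^ (?n - 1) * (1 + r) powr - p \<le> 1" if "0 < r" "r \<le> 1"
      proof -
        have "r ^ (?n - 1) \<le> 1" using that by (simp add: power_le_one)
        moreover have "(1+r) powr -p \<le> 1" using that assms by (simp add: powr_minus inverse_le_1_iff ge_one_powr_ge_zero)
        ultimately show ?thesis using that by (simp add: mult_le_one)
      qed
      moreover have "r ^ (?n - 1) * (1 + r) powr - p \<le> r powr - (p - ?n + 1)" if "1 \<le> r"
      proof -
        have "(1+r) powr -p \<le> r powr -p" using that assms by (intro powr_mono2') auto
        then have "r ^ (?n - 1) * (1 + r) powr - p \<le> r ^ (?n - 1) * r powr -p" using that by (intro mult_left_mono) auto
        also have "r ^ (?n - 1) = r powr (?n - 1)" using that by (simp add: powr_realpow[symmetric] of_nat_diff)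
        also have "r powr (?n - 1) * r powr -p = r powr - (p - ?n + 1)" by (simp add: powr_add[symmetric] of_nat_diff algebra_simps)
        finally show ?thesis using that by (simp add: powr_realpow[symmetric] of_nat_diff)
      qed
      ultimately show "norm (indicator {0<..} r * (r ^ (?n - 1) * (1 + r) powr - p)) \<le> norm (indicator {0<..1} r * r powr 0 + indicator {1..} r * r powr - (p - ?n + 1))"
        by (cases "r \<le> 1"; cases "r \<ge> 1") (auto simp: indicator_def abs_mult)
    qed
  qed auto
  then show ?thesis by (simp add: wt_def[abs_def])
qed

section \<open>Decay classes and the singular second-difference operator\<close>

locale fractional_order =
  fixes s p :: real and ty :: "'a::euclidean_space itself"
  assumes s: "0 < s" "s < 1" and p_eq: "p = real DIM('a) + 2 * s"
begin

lemma p_pos: "p > 0" and p_gt: "p > real DIM('a)"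
  using s p_eq by (auto simp: add_nonneg_pos)

lemma p_ge [simp]: "p \<ge> 0" using p_pos by simp

text \<open>The factor \<open>|h|^2\<close> stands for a second difference near \<open>0\<close>:
  radially the integrand is \<open>r powr (1 - 2 * s)\<close> there, integrable for
  \<open>s < 1\<close>, and at infinity it is \<open>r powr - (1 + 2 * s)\<close>, integrable for
  \<open>s > 0\<close>.\<close>

lemma integrable_kernel:
  "integrable lborel (\<lambda>h::'a. min 1 ((norm h)\<^sup>2) * norm h powr -p)"
proof (rule integrable_radial[where F="\<lambda>r. min 1 (r\<^sup>2) * r powr -p"])
  let ?n = "DIM('a)"
  have "integrable lborel (\<lambda>r::real. indicator {0<..1} r * r powr (1 - 2 * s) + indicator {1..} r * r powr - (2 * s + 1))"
    using s by (intro Bochner_Integration.integrable_add integrable_powr_Ici integrable_powr_Ioc) auto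
  then show "integrable lborel (\<lambda>r. indicator {0<..} r * (r ^ (?n - 1) * (min 1 (r\<^sup>2) * r powr - p)))"
  proof (rule Bochner_Integration.integrable_bound, measurable, intro AE_I2)
    fix r :: real
    have *: "r ^ (?n - 1) = r powr (real ?n - 1)" if "r > 0" using that by (simp add: powr_realpow[symmetric] of_nat_diff)
    have **: "r\<^sup>2 = r powr 2" if "r > 0" using that by (simp add: powr_numeral)
    have "r ^ (?n - 1) * (min 1 (r\<^sup>2) * r powr - p) \<le> r powr (1 - 2 * s)" if "0 < r" "r \<le> 1"
    proof -
      have "r ^ (?n - 1) * (min 1 (r\<^sup>2) * r powr - p) \<le> r powr (real ?n - 1) * (r powr 2 * r powr -p)"
        using that unfolding *[OF that(1)] **[OF that(1)] by (intro mult_left_mono mult_right_mono) auto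
      also have "\<dots> = r powr (1 - 2 * s)" by (simp add: powr_add[symmetric] p_eq)
      finally show ?thesis .
    qed
    moreover have "r ^ (?n - 1) * (min 1 (r\<^sup>2) * r powr - p) \<le> r powr - (2 * s + 1)" if "1 \<le> r"
    proof -
      have "r ^ (?n - 1) * (min 1 (r\<^sup>2) * r powr - p) \<le> r powr (real ?n - 1) * (1 * r powr -p)"
        using that by (subst *) (auto intro!: mult_left_mono mult_right_mono)
      also have "\<dots> = r powr - (2 * s + 1)" by (simp add: powr_add[symmetric] p_eq algebra_simps)
      finally show ?thesis .
    qed
    ultimately show "norm (indicator {0<..} r * (r ^ (?n - 1) * (min 1 (r\<^sup>2) * r powr - p))) \<le> norm (indicator {0<..1} r * r powr (1 - 2 * s) + indicator {1..} r * r powr - (2 * s + 1))"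
      by (cases "r \<le> 1"; cases "r \<ge> 1") (auto simp: indicator_def abs_mult)
  qed
qed auto

text \<open>Dominates \<open>\<bar>second_diff f x h\<bar> * norm h powr -p\<close> once
  \<open>A * wt p x\<close> is taken out. By translation invariance its integral in \<open>h\<close>
  is the same for every \<open>x\<close>, so the operator preserves decay at rate
  \<open>p\<close>.\<close>

definition kernel_majorant :: "'a \<Rightarrow> 'a \<Rightarrow> real" where
  "kernel_majorant x h = 2 * (min 1 ((norm h)\<^sup>2) * norm h powr -p) + 4 powr p * (wt p (x + h) + wt p (x - h) + 2 * wt p h)"

text \<open>The locale parameter \<open>ty\<close> carries only a type: it lets constants such as
  this one, whose own type does not mention \<open>'a\<close>, depend on the dimension.\<close>

definition majorant_mass :: real where
  "majorant_mass = 2 * (\<integral>h. min 1 ((norm h)\<^sup>2) * norm h powr -p \<partial>(lborel :: 'a measure)) + 4 powr p * (4 * (\<integral>h. wt p h \<partial>(lborel :: 'a measure)))"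

lemma integrable_wt_p: "integrable lborel (wt p :: 'a \<Rightarrow> real)"
  by (rule integrable_wt[OF p_gt])

lemma has_bochner_integral_kernel_majorant: "has_bochner_integral lborel (kernel_majorant x) majorant_mass"
proof -
  have 1: "has_bochner_integral lborel (\<lambda>h::'a. wt p (x + h)) (\<integral>h. wt p h \<partial>(lborel :: 'a measure))"
    and 2: "has_bochner_integral lborel (\<lambda>h::'a. wt p (x - h)) (\<integral>h. wt p h \<partial>(lborel :: 'a measure))"
    using lborel_integral_translate[of "wt p" x] integrable_wt_p by (auto simp: has_bochner_integral_iff)
  have "has_bochner_integral lborel (kernel_majorant x) (2 * (\<integral>h. min 1 ((norm h)\<^sup>2) * norm h powr -p \<partial>(lborel :: 'a measure)) +
     4 powr p * ((\<integral>h. wt p h \<partial>(lborel :: 'a measure)) + (\<integral>h. wt p h \<partial>(lborel :: 'a measure)) + 2 * (\<integral>h. wt p h \<partial>(lborel :: 'a measure))))"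
    unfolding kernel_majorant_def[abs_def]
    by (intro has_bochner_integral_add has_bochner_integral_mult_right 1 2 has_bochner_integral_integrable integrable_kernel integrable_wt_p)
  then show ?thesis by (simp add: majorant_mass_def algebra_simps)
qed

lemma kernel_majorant_nonneg: "0 \<le> kernel_majorant x h" by (simp add: kernel_majorant_def)

lemma borel_measurable_kernel_majorant [measurable]: "(\<lambda>(x, h). kernel_majorant x h) \<in> borel_measurable (borel \<Otimes>\<^sub>M borel)"
  unfolding kernel_majorant_def[abs_def] by measurable

definition second_diff :: "('a \<Rightarrow> real) \<Rightarrow> 'a \<Rightarrow> 'a \<Rightarrow> real" where
  "second_diff f x h = f (x + h) + f (x - h) - 2 * f x"

text \<open>The second-order condition is put on second differences, which are what
  \<open>flap\<close> integrates. The constant \<open>A\<close> is explicit so that a whole sequence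
  can share one bound, the form in which dominated convergence needs it.\<close>

definition admissible :: "real \<Rightarrow> ('a \<Rightarrow> real) \<Rightarrow> bool" where
  "admissible A f \<longleftrightarrow> f \<in> borel_measurable borel \<and> (\<forall>x. \<bar>f x\<bar> \<le> A * wt p x) \<and>
     (\<forall>x h. norm h \<le> 1 \<longrightarrow> \<bar>second_diff f x h\<bar> \<le> A * (norm h)\<^sup>2 * wt p x)"

text \<open>A negative multiple of the fractional Laplacian.\<close>

definition flap :: "('a \<Rightarrow> real) \<Rightarrow> 'a \<Rightarrow> real" where
  "flap f x = (\<integral>h. second_diff f x h * norm h powr -p \<partial>lborel)"

lemma admissible_nonneg: "admissible A f \<Longrightarrow> 0 \<le> A"
proof -
  assume "admissible A f"
  then have "\<bar>f 0\<bar> \<le> A * wt p (0::'a)" by (simp add: admissible_def)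
  then have "0 \<le> A * wt p (0::'a)" by (rule order_trans[OF abs_ge_zero])
  then show ?thesis using wt_pos[of p "0::'a"] by (simp add: zero_le_mult_iff)
qed

lemma admissible_measurable [measurable_dest]: "admissible A f \<Longrightarrow> f \<in> borel_measurable borel"
  by (simp add: admissible_def)

lemma second_diff_measurable [measurable (raw)]:
  assumes [measurable]: "f \<in> borel_measurable borel" "g \<in> M \<rightarrow>\<^sub>M borel" "h \<in> M \<rightarrow>\<^sub>M borel"
  shows "(\<lambda>x. second_diff f (g x) (h x)) \<in> borel_measurable M"
  unfolding second_diff_def by measurable

lemma flap_measurable [measurable]:
  assumes [measurable]: "f \<in> borel_measurable borel"
  shows "flap f \<in> borel_measurable borel"
  unfolding flap_def[abs_def] by measurable

text \<open>For \<open>norm h \<le> 1\<close> the quadratic bound absorbs the singularity. For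
  larger \<open>h\<close> the kernel is comparable to \<open>wt p h\<close>, and each product of a
  weight at \<open>x + h\<close> or \<open>x - h\<close> with \<open>wt p h\<close> yields a factor
  \<open>wt p x\<close> by \<open>wt_mult\<close>.\<close>

lemma admissible_second_diff:
  assumes f: "admissible A f"
  shows "\<bar>second_diff f x h\<bar> * norm h powr -p \<le> A * wt p x * kernel_majorant x h"
proof -
  have A: "A \<ge> 0" by (rule admissible_nonneg[OF f])
  let ?k = "norm h powr -p" and ?q = "min 1 ((norm h)\<^sup>2) * norm h powr -p"
  have q: "0 \<le> ?q" by simp
  show ?thesis
  proof (cases "norm h \<le> 1")
    case True
    then have m: "min 1 ((norm h)\<^sup>2) = (norm h)\<^sup>2" by (simp add: power_le_one)
    have "\<bar>second_diff f x h\<bar> * ?k \<le> (A * (norm h)\<^sup>2 * wt p x) * ?k"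
      using f True by (intro mult_right_mono) (auto simp: admissible_def)
    also have "\<dots> = A * wt p x * (1 * ?q)" by (simp add: m)
    also have "\<dots> \<le> A * wt p x * kernel_majorant x h"
      using A q by (intro mult_left_mono) (auto simp: kernel_majorant_def intro!: add_increasing2)
    finally show ?thesis .
  next
    case False
    then have m: "min 1 ((norm h)\<^sup>2) = 1" by (simp add: one_le_power)
    have k: "?k \<le> 2 powr p * wt p h"
    proof -
      have "(1 + norm h) powr p \<le> (2 * norm h) powr p" using False by (intro powr_mono2) auto
      also have "\<dots> = 2 powr p * norm h powr p" by (rule powr_mult)
      finally show ?thesis using False powr_gt_zero[of "norm h" p] powr_gt_zero[of "1 + norm h" p]
        by (simp add: wt_def powr_minus divide_simps mult_ac del: powr_gt_zero)
    qed
    have f1: "\<bar>f y\<bar> \<le> A * wt p y" for y using f by (simp add: admissible_def)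
    have "\<bar>second_diff f x h\<bar> \<le> A * wt p (x+h) + A * wt p (x-h) + 2 * (A * wt p x)"
      using f1[of "x+h"] f1[of "x-h"] f1[of x] unfolding second_diff_def by linarith
    then have "\<bar>second_diff f x h\<bar> * ?k \<le> (A * wt p (x+h) + A * wt p (x-h) + 2 * (A * wt p x)) * ?k"
      by (intro mult_right_mono) auto
    also have "\<dots> = A * (wt p (x+h) * ?k + wt p (x-h) * ?k) + A * wt p x * (2 * ?q)"
      by (simp add: m algebra_simps)
    also have "\<dots> \<le> A * (wt p x * (4 powr p * (wt p (x + h) + wt p (x - h) + 2 * wt p h))) + A * wt p x * (2 * ?q)"
    proof (intro add_right_mono mult_left_mono A)
      \<comment> \<open>One factor \<open>2 powr p\<close> comes from replacing the kernel by the
        weight, the other from \<open>wt_mult\<close>.\<close>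
      have e: "4 powr p = 2 powr p * 2 powr p" using powr_mult[of 2 2 p] by simp
      have t: "wt p a * ?k \<le> wt p x * (4 powr p * (wt p a + wt p h))" if "norm x \<le> norm a + norm h" for a
      proof -
        have "wt p a * ?k \<le> 2 powr p * (wt p a * wt p h)"
          using mult_left_mono[OF k, of "wt p a"] by (simp add: mult_ac)
        also have "\<dots> \<le> 2 powr p * (2 powr p * wt p x * (wt p a + wt p h))"
          by (intro mult_left_mono wt_mult that) auto
        finally show ?thesis by (simp add: e mult_ac)
      qed
      have "norm x \<le> norm (x+h) + norm h" using norm_triangle_ineq4[of "x+h" h] by simp
      moreover have "norm x \<le> norm (x-h) + norm h" using norm_triangle_ineq[of "x-h" h] by simp
      ultimately have "wt p (x+h) * ?k + wt p (x-h) * ?k \<le> wt p x * (4 powr p * (wt p (x+h) + wt p h)) + wt p x * (4 powr p * (wt p (x-h) + wt p h))"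
        by (intro add_mono t)
      then show "wt p (x+h) * ?k + wt p (x-h) * ?k \<le> wt p x * (4 powr p * (wt p (x + h) + wt p (x - h) + 2 * wt p h))"
        by (simp add: algebra_simps)
    qed
    also have "\<dots> = A * wt p x * kernel_majorant x h" by (simp add: kernel_majorant_def algebra_simps)
    finally show ?thesis .
  qed
qed

lemma admissible_integrable:
  assumes f: "admissible A f"
  shows "integrable lborel (\<lambda>h. second_diff f x h * norm h powr -p)"
    and "(\<integral>h. \<bar>second_diff f x h\<bar> * norm h powr -p \<partial>lborel) \<le> A * majorant_mass * wt p x"
    and "\<bar>flap f x\<bar> \<le> A * majorant_mass * wt p x"
proof -
  note [measurable] = admissible_measurable[OF f]
  have kernel_majorant: "integrable lborel (\<lambda>h. A * wt p x * kernel_majorant x h)" "(\<integral>h. A * wt p x * kernel_majorant x h \<partial>lborel) = A * majorant_mass * wt p x"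
    using has_bochner_integral_kernel_majorant[of x] by (auto simp: has_bochner_integral_iff)
  show 1: "integrable lborel (\<lambda>h. second_diff f x h * norm h powr -p)"
    by (rule Bochner_Integration.integrable_bound[OF kernel_majorant(1)])
       (use admissible_second_diff[OF f, of x] admissible_nonneg[OF f] in \<open>auto simp: abs_mult kernel_majorant_nonneg intro!: AE_I2\<close>)
  then have 2: "integrable lborel (\<lambda>h. \<bar>second_diff f x h\<bar> * norm h powr -p)"
    using integrable_abs[OF 1] by (simp add: abs_mult)
  show 3: "(\<integral>h. \<bar>second_diff f x h\<bar> * norm h powr -p \<partial>lborel) \<le> A * majorant_mass * wt p x"
    unfolding kernel_majorant(2)[symmetric] by (intro integral_mono 2 kernel_majorant(1) admissible_second_diff[OF f])
  have "\<bar>flap f x\<bar> \<le> (\<integral>h. \<bar>second_diff f x h * norm h powr -p\<bar> \<partial>lborel)"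
    unfolding flap_def by (rule integral_abs_bound)
  then show "\<bar>flap f x\<bar> \<le> A * majorant_mass * wt p x" using 3 by (simp add: abs_mult)
qed

lemma flap_tendsto:
  assumes f: "\<And>k::nat. admissible A (f k)" and g: "g \<in> borel_measurable borel" and lim: "\<And>x. (\<lambda>k. f k x) \<longlonglongrightarrow> g x"
  shows "(\<lambda>k. flap (f k) x) \<longlonglongrightarrow> flap g x"
  unfolding flap_def
proof (rule integral_dominated_convergence[where w="\<lambda>h. A * wt p x * kernel_majorant x h"])
  note [measurable] = g f[THEN admissible_measurable]
  show "integrable lborel (\<lambda>h. A * wt p x * kernel_majorant x h)"
    using has_bochner_integral_kernel_majorant[of x] by (auto simp: has_bochner_integral_iff)
  show "AE h in lborel. (\<lambda>k. second_diff (f k) x h * norm h powr -p) \<longlonglongrightarrow> second_diff g x h * norm h powr -p"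
    unfolding second_diff_def by (intro AE_I2 tendsto_intros lim)
  show "AE h in lborel. norm (second_diff (f k) x h * norm h powr -p) \<le> A * wt p x * kernel_majorant x h" for k
    using admissible_second_diff[OF f, of k x] by (auto simp: abs_mult)
qed (use g f[THEN admissible_measurable] in measurable)

end

locale tail_fun = fractional_order s p ty for s p and ty :: "'a::euclidean_space itself" +
  fixes u :: "'a \<Rightarrow> real"
  assumes u_meas [measurable]: "u \<in> borel_measurable borel"
    and u_tail: "integrable lborel (\<lambda>x. \<bar>u x\<bar> * wt p x)"
begin

text \<open>Up to a nonzero constant this is the fractional Laplacian of \<open>u\<close> in the
  sense of distributions, evaluated at \<open>f\<close>. Decay of \<open>flap f\<close> at rate
  \<open>p\<close> makes it meaningful for all admissible \<open>f\<close>, beyond those of compact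
  support.\<close>

definition pairing :: "('a \<Rightarrow> real) \<Rightarrow> real" where
  "pairing f = (\<integral>x. u x * flap f x \<partial>lborel)"

lemma integrable_u_bound:
  assumes [measurable]: "g \<in> borel_measurable borel" and "\<And>x. \<bar>g x\<bar> \<le> B * wt p x"
  shows "integrable lborel (\<lambda>x. u x * g x)"
proof (rule Bochner_Integration.integrable_bound[where f="\<lambda>x. B * (\<bar>u x\<bar> * wt p x)"])
  show "integrable lborel (\<lambda>x. B * (\<bar>u x\<bar> * wt p x))" using u_tail by simp
  show "AE x in lborel. norm (u x * g x) \<le> norm (B * (\<bar>u x\<bar> * wt p x))"
  proof (rule AE_I2)
    fix x
    have "norm (u x * g x) \<le> \<bar>u x\<bar> * (B * wt p x)"
      using assms(2)[of x] by (auto simp: abs_mult intro!: mult_left_mono)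
    also have "\<dots> \<le> norm (B * (\<bar>u x\<bar> * wt p x))" by (simp add: mult_ac)
    finally show "norm (u x * g x) \<le> norm (B * (\<bar>u x\<bar> * wt p x))" .
  qed
qed measurable

lemma integrable_u_flap:
  assumes "admissible A f"
  shows "integrable lborel (\<lambda>x. u x * flap f x)"
  by (rule integrable_u_bound[where B="A * majorant_mass"])
     (use admissible_integrable(3)[OF assms] flap_measurable[OF admissible_measurable[OF assms]] in auto)

text \<open>The common constant \<open>A\<close> provides a majorant twice: in \<open>h\<close>
  inside \<open>flap\<close>, and in \<open>x\<close> against the tail of \<open>u\<close>.\<close>

lemma pairing_tendsto:
  assumes f: "\<And>k::nat. admissible A (f k)" and g: "g \<in> borel_measurable borel" and lim: "\<And>x. (\<lambda>k. f k x) \<longlonglongrightarrow> g x"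
  shows "(\<lambda>k. pairing (f k)) \<longlonglongrightarrow> pairing g"
  unfolding pairing_def
proof (rule integral_dominated_convergence[where w="\<lambda>x. A * majorant_mass * (\<bar>u x\<bar> * wt p x)"])
  note [measurable] = g f[THEN admissible_measurable]
  show "integrable lborel (\<lambda>x. A * majorant_mass * (\<bar>u x\<bar> * wt p x))"
    using u_tail by simp
  show "AE x in lborel. (\<lambda>k. u x * flap (f k) x) \<longlonglongrightarrow> u x * flap g x"
    by (intro AE_I2 tendsto_intros flap_tendsto[OF f g lim])
  show "AE x in lborel. norm (u x * flap (f k) x) \<le> A * majorant_mass * (\<bar>u x\<bar> * wt p x)" for k
  proof (rule AE_I2)
    fix x
    show "norm (u x * flap (f k) x) \<le> A * majorant_mass * (\<bar>u x\<bar> * wt p x)"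
      using mult_left_mono[OF admissible_integrable(3)[OF f, of k x], of "\<bar>u x\<bar>"] by (simp add: abs_mult mult_ac)
  qed
qed (use g f[THEN admissible_measurable] in measurable)

lemma pairing_add:
  assumes "admissible A f" "admissible B g"
  shows "pairing (\<lambda>x. f x + g x) = pairing f + pairing g"
proof -
  have "flap (\<lambda>x. f x + g x) x = flap f x + flap g x" for x
  proof -
    have "second_diff (\<lambda>x. f x + g x) x h * norm h powr -p = second_diff f x h * norm h powr -p + second_diff g x h * norm h powr -p" for h
      by (simp add: second_diff_def algebra_simps)
    then show ?thesis unfolding flap_def
      by (simp only: Bochner_Integration.integral_add[OF admissible_integrable(1)[OF assms(1)] admissible_integrable(1)[OF assms(2)]])
  qed
  then show ?thesis unfolding pairing_def
    by (simp add: algebra_simps integrable_u_flap[OF assms(1)] integrable_u_flap[OF assms(2)])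
qed

lemma pairing_cmult: "pairing (\<lambda>x. c * f x) = c * pairing f"
proof -
  have "flap (\<lambda>x. c * f x) x = c * flap f x" for x
    unfolding flap_def
    by (subst integral_mult_right_zero[symmetric]) (auto intro!: Bochner_Integration.integral_cong simp: second_diff_def algebra_simps)
  then show ?thesis unfolding pairing_def
    by (simp add: mult.left_commute)
qed

end

section \<open>From the energy to a second-difference operator\<close>

text \<open>A Tonelli argument for kernels whose mass in \<open>y\<close> is the same constant
  \<open>c\<close> at every relevant \<open>x\<close>. The mass is asked for only where
  \<open>g x \<noteq> 0\<close>, so degenerate points such as \<open>h = 0\<close> or
  \<open>r \<le> t\<close> can be excluded through \<open>g\<close>.\<close>

lemma integrable_times_kernel:
  fixes g :: "'a::euclidean_space \<Rightarrow> real" and K :: "'a \<Rightarrow> 'b::euclidean_space \<Rightarrow> real"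
  assumes g: "integrable lborel g" and K [measurable]: "(\<lambda>(x, y). K x y) \<in> borel_measurable (borel \<Otimes>\<^sub>M borel)"
    and K0: "\<And>x y. 0 \<le> K x y" and c: "\<And>x. g x \<noteq> 0 \<Longrightarrow> has_bochner_integral lborel (K x) c"
  shows "integrable (lborel \<Otimes>\<^sub>M lborel) (\<lambda>(x, y). g x * K x y)"
    and "(\<integral>z. (case z of (x, y) \<Rightarrow> g x * K x y) \<partial>(lborel \<Otimes>\<^sub>M lborel)) = c * (\<integral>x. g x \<partial>lborel)"
proof -
  have [measurable]: "g \<in> borel_measurable borel" using g by auto
  show I: "integrable (lborel \<Otimes>\<^sub>M lborel) (\<lambda>(x, y). g x * K x y)"
  proof (rule lborel_pair.Fubini_integrable)
    show "(\<lambda>(x, y). g x * K x y) \<in> borel_measurable (lborel \<Otimes>\<^sub>M lborel)" by measurable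
    have "(\<integral>y. norm (g x * K x y) \<partial>lborel) = \<bar>g x\<bar> * c" for x
      using c[of x] K0 by (cases "g x = 0") (simp_all add: abs_mult has_bochner_integral_iff)
    then show "integrable lborel (\<lambda>x. \<integral>y. norm (case (x, y) of (x, y) \<Rightarrow> g x * K x y) \<partial>lborel)"
      using g by simp
    have "integrable lborel (\<lambda>y. g x * K x y)" for x
      using c[of x] by (cases "g x = 0") (auto simp: has_bochner_integral_iff)
    then show "AE x in lborel. integrable lborel (\<lambda>y. case (x, y) of (x, y) \<Rightarrow> g x * K x y)" by simp
  qed
  have e: "(\<integral>y. g x * K x y \<partial>lborel) = c * g x" for x
    using c[of x] by (cases "g x = 0") (auto simp: has_bochner_integral_iff)
  show "(\<integral>z. (case z of (x, y) \<Rightarrow> g x * K x y) \<partial>(lborel \<Otimes>\<^sub>M lborel)) = c * (\<integral>x. g x \<partial>lborel)"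
    using lborel_pair.integral_fst[OF I] unfolding e by simp
qed

context tail_fun
begin

lemma wt_minus [simp]: "wt p (x - y) = wt p (y - x)"
  by (simp add: wt_def norm_minus_commute)

lemma integrable_u_wt:
  "integrable (lborel \<Otimes>\<^sub>M lborel) (\<lambda>(x, y). (\<bar>u x\<bar> * wt p x) * (wt p (x - y) + 2 powr p * (wt p y + wt p (x - y))))"
proof (rule integrable_times_kernel(1))
  fix x
  have [simp]: "integrable lborel (\<lambda>y::'a. wt p (x - y))"
    by (subst lborel_integral_translate(4)) (auto simp: integrable_wt_p)
  have [simp]: "(\<integral>y. wt p (x - y) \<partial>lborel) = (\<integral>y. wt p y \<partial>(lborel :: 'a measure))"
    by (rule lborel_integral_translate(2)) auto
  show "has_bochner_integral lborel (\<lambda>y. wt p (x - y) + 2 powr p * (wt p y + wt p (x - y)))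
     ((1 + 2 * 2 powr p) * (\<integral>y. wt p y \<partial>(lborel :: 'a measure)))"
    unfolding has_bochner_integral_iff by (auto simp: integrable_wt_p algebra_simps simp del: wt_minus)
qed (auto simp: u_tail)

text \<open>The mixed term \<open>wt p y * wt p (x - y)\<close> is a convolution of two weights,
  dominated by \<open>wt p x\<close> times a function of \<open>y\<close> whose mass does not depend
  on \<open>x\<close>; what remains in \<open>x\<close> is the tail integral of
  \<open>u\<close>.\<close>

lemma integrable_u_wt':
  assumes R [measurable]: "(\<lambda>(x, y). R x y) \<in> borel_measurable (borel \<Otimes>\<^sub>M borel)"
    and "\<And>x y. \<bar>R x y\<bar> \<le> B * (\<bar>u x\<bar> * (wt p x + wt p y) * wt p (x - y))"
    and "B \<ge> 0"
  shows "integrable (lborel \<Otimes>\<^sub>M lborel) (\<lambda>(x, y). R x y)"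
proof (rule Bochner_Integration.integrable_bound)
  show "integrable (lborel \<Otimes>\<^sub>M lborel) (\<lambda>z. B * (case z of (x, y) \<Rightarrow> (\<bar>u x\<bar> * wt p x) * (wt p (x - y) + 2 powr p * (wt p y + wt p (x - y)))))"
    using integrable_u_wt by (rule integrable_mult_right)
  show "AE z in lborel \<Otimes>\<^sub>M lborel. norm (case z of (x, y) \<Rightarrow> R x y) \<le>
     norm (B * (case z of (x, y) \<Rightarrow> (\<bar>u x\<bar> * wt p x) * (wt p (x - y) + 2 powr p * (wt p y + wt p (x - y)))))"
  proof (rule AE_I2, clarsimp simp del: wt_minus)
    fix x y :: 'a
    have "wt p y * wt p (x - y) \<le> 2 powr p * wt p x * (wt p y + wt p (x - y))"
      by (rule wt_mult) (use norm_triangle_ineq[of y "x - y"] in auto)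
    then have "(wt p x + wt p y) * wt p (x - y) \<le> wt p x * (wt p (x - y) + 2 powr p * (wt p y + wt p (x - y)))"
      by (simp add: algebra_simps)
    then have "B * (\<bar>u x\<bar> * ((wt p x + wt p y) * wt p (x - y))) \<le> B * (\<bar>u x\<bar> * (wt p x * (wt p (x - y) + 2 powr p * (wt p y + wt p (x - y)))))"
      using assms(3) by (intro mult_left_mono) auto
    also have "\<dots> = \<bar>B * (\<bar>u x\<bar> * wt p x * (wt p (x - y) + 2 powr p * (wt p y + wt p (x - y))))\<bar>"
      using assms(3) by (simp add: abs_mult mult_ac)
    finally show "\<bar>R x y\<bar> \<le> \<bar>B * (\<bar>u x\<bar> * wt p x * (wt p (x - y) + 2 powr p * (wt p y + wt p (x - y))))\<bar>"
      using assms(2)[of x y] by (simp add: mult_ac)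
  qed
qed measurable

lemma kernel_le_wt:
  assumes "d > 0" "norm h \<ge> d"
  shows "norm h powr -p \<le> (1 + 1/d) powr p * wt p (h::'a)"
proof -
  have "1 + norm h \<le> (1 + 1/d) * norm h" using assms by (simp add: field_simps)
  then have "(1 + norm h) powr p \<le> ((1 + 1/d) * norm h) powr p" by (intro powr_mono2) auto
  also have "\<dots> = (1 + 1/d) powr p * norm h powr p" by (rule powr_mult)
  finally show ?thesis using assms powr_gt_zero[of "norm h" p] powr_gt_zero[of "1 + norm h" p]
    by (simp add: wt_def powr_minus divide_simps mult_ac del: powr_gt_zero)
qed

text \<open>If both points lie in \<open>G\<close>, the product of differences is at most the sum of
  their squares: the \<open>u\<close> part is the Sobolev energy on \<open>G\<close>, and the
  \<open>\<phi>\<close> part is tamed by the Lipschitz bound. If one point lies outside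
  \<open>G\<close>, the integrand vanishes unless the other is in the support of
  \<open>\<phi>\<close>; then the points are at distance at least \<open>d\<close>, the kernel is
  bounded by a multiple of the weight, and the tail integral of \<open>u\<close> suffices.\<close>

lemma energy_integrable:
  assumes phi: "admissible A \<phi>" and lip: "\<And>x y. \<bar>\<phi> x - \<phi> y\<bar> \<le> L * norm (x - y)"
    and r: "0 < r1" "\<And>x. \<phi> x \<noteq> 0 \<Longrightarrow> r1 \<le> norm x \<and> norm x \<le> r2"
    and G: "G = {x. r1/2 < norm x \<and> norm x < r2 + 1}"
    and fin: "(\<integral>\<^sup>+ x. \<integral>\<^sup>+ y. indicator G x * indicator G y * ennreal ((u x - u y)\<^sup>2 * norm (x - y) powr -p) \<partial>lborel \<partial>lborel) < \<infinity>"
  shows "integrable (lborel \<Otimes>\<^sub>M lborel) (\<lambda>(x, y). (u x - u y) * (\<phi> x - \<phi> y) * norm (x - y) powr -p)"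
proof -
  note [measurable] = admissible_measurable[OF phi]
  have oG: "open G"
  proof -
    have "G = {x. r1/2 < norm x} \<inter> {x. norm x < r2 + 1}" unfolding G by auto
    then show ?thesis by (auto intro!: open_Int open_Collect_less continuous_intros)
  qed
  then have [measurable]: "G \<in> sets borel" by simp
  have A0: "A \<ge> 0" by (rule admissible_nonneg[OF phi])
  \<comment> \<open>Distance kept from the annulus \<open>r1 \<le> norm x \<le> r2\<close> to the
    complement of \<open>G\<close>: \<open>r1/2\<close> inwards and \<open>1\<close>
    outwards.\<close>
  define d where "d = min (r1/2) 1"
  have d: "d > 0" using r by (simp add: d_def)
  define M where "M = L\<^sup>2 + 4 * A\<^sup>2"
  define B where "B = A * (1 + 1/d) powr p"
  have B: "B \<ge> 0" using A0 by (simp add: B_def)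
  define B1 where "B1 x y = indicator G x * indicator G y * ((u x - u y)\<^sup>2 * norm (x - y) powr -p)" for x y
  define B2 where "B2 x y = (M * indicator G x) * (min 1 ((norm (x - y))\<^sup>2) * norm (x - y) powr -p)" for x y
  define B3 where "B3 x y = B * (\<bar>u x\<bar> * (wt p x + wt p y) * wt p (x - y))" for x y
  have i1: "integrable (lborel \<Otimes>\<^sub>M lborel) (\<lambda>(x, y). B1 x y)"
  proof (rule integrableI_bounded)
    have "(\<integral>\<^sup>+ z. norm (case z of (x, y) \<Rightarrow> B1 x y) \<partial>(lborel \<Otimes>\<^sub>M lborel)) =
      (\<integral>\<^sup>+ x. \<integral>\<^sup>+ y. ennreal (B1 x y) \<partial>lborel \<partial>lborel)"
      unfolding B1_def by (subst lborel.nn_integral_fst[symmetric]) (auto intro!: nn_integral_cong simp: abs_mult)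
    also have "\<dots> = (\<integral>\<^sup>+ x. \<integral>\<^sup>+ y. indicator G x * indicator G y * ennreal ((u x - u y)\<^sup>2 * norm (x - y) powr -p) \<partial>lborel \<partial>lborel)"
      unfolding B1_def by (intro nn_integral_cong) (auto simp: indicator_def)
    finally show "(\<integral>\<^sup>+ z. ennreal (norm (case z of (x, y) \<Rightarrow> B1 x y)) \<partial>(lborel \<Otimes>\<^sub>M lborel)) < \<infinity>" using fin by simp
  qed (unfold B1_def, measurable)
  have i2: "integrable (lborel \<Otimes>\<^sub>M lborel) (\<lambda>(x, y). B2 x y)"
    unfolding B2_def
  proof (rule integrable_times_kernel(1)[where c="\<integral>h. min 1 ((norm h)\<^sup>2) * norm h powr -p \<partial>(lborel::'a measure)"])
    have "emeasure lborel G \<le> emeasure lborel (cball (0::'a) (\<bar>r2\<bar> + 1))"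
      by (intro emeasure_mono) (auto simp: G)
    also have "\<dots> < \<infinity>" by (simp add: emeasure_cball)
    finally show "integrable lborel (\<lambda>x. M * indicator G x)" by (intro integrable_mult_right) (auto simp: integrable_indicator_iff)
    show "has_bochner_integral lborel (\<lambda>y. min 1 ((norm (x - y))\<^sup>2) * norm (x - y) powr - p) (\<integral>h. min 1 ((norm h)\<^sup>2) * norm h powr -p \<partial>(lborel::'a measure))" for x :: 'a
      unfolding has_bochner_integral_iff
      using lborel_integral_translate(2,4)[of "\<lambda>h::'a. min 1 ((norm h)\<^sup>2) * norm h powr -p" x] integrable_kernel by simp
  qed auto
  have i3: "integrable (lborel \<Otimes>\<^sub>M lborel) (\<lambda>(x, y). B3 x y)"
    by (rule integrable_u_wt'[where B=B]) (use B in \<open>auto simp: B3_def abs_mult simp del: wt_minus\<close>)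
  have i4: "integrable (lborel \<Otimes>\<^sub>M lborel) (\<lambda>(x, y). B3 y x)"
    using lborel_pair.integrable_product_swap[OF i3] by simp
  have sup: "\<phi> x = 0" if "x \<notin> G" for x using that r(2)[of x] r(1) unfolding G by fastforce
  have far: "d \<le> norm (x - y)" if "\<phi> x \<noteq> 0" "y \<notin> G" for x y
  proof -
    consider "norm y \<le> r1/2" | "norm y \<ge> r2 + 1" using \<open>y \<notin> G\<close> by (auto simp: G)
    then show ?thesis
    proof cases
      case 1
      then show ?thesis using r(2)[OF that(1)] norm_triangle_ineq2[of x y] by (auto simp: d_def)
    next
      case 2
      then show ?thesis using r(2)[OF that(1)] norm_triangle_ineq3[of x y] by (auto simp: d_def)
    qed
  qed
  have phiA: "\<bar>\<phi> x\<bar> \<le> A * wt p x" for x using phi by (simp add: admissible_def)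
  have dphi: "\<bar>\<phi> x - \<phi> y\<bar> \<le> A * (wt p x + wt p y)" for x y
    using phiA[of x] phiA[of y] by (simp add: algebra_simps)
  have dphi2: "(\<phi> x - \<phi> y)\<^sup>2 \<le> M * min 1 ((norm (x - y))\<^sup>2)" for x y
  proof -
    have "\<bar>\<phi> x - \<phi> y\<bar> \<le> 2 * A"
    proof -
      have "A * (wt p x + wt p y) \<le> A * (1 + 1)" using A0 by (intro mult_left_mono add_mono wt_le_1) auto
      then show ?thesis using dphi[of x y] by simp
    qed
    then have 1: "(\<phi> x - \<phi> y)\<^sup>2 \<le> 4 * A\<^sup>2" using power_mono[of "\<bar>\<phi> x - \<phi> y\<bar>" "2 * A" 2] by (simp add: power_mult_distrib)
    have 2: "(\<phi> x - \<phi> y)\<^sup>2 \<le> L\<^sup>2 * (norm (x - y))\<^sup>2" using power_mono[OF lip[of x y], of 2] by (simp add: power_mult_distrib)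
    have "0 \<le> 4 * A\<^sup>2 * (norm (x - y))\<^sup>2" by simp
    moreover have "0 \<le> L\<^sup>2" by simp
    ultimately have "(\<phi> x - \<phi> y)\<^sup>2 \<le> M * 1" "(\<phi> x - \<phi> y)\<^sup>2 \<le> M * (norm (x - y))\<^sup>2"
      using 1 2 unfolding M_def distrib_right by linarith+
    then show ?thesis by (simp add: min_def)
  qed
  show ?thesis
  proof (rule Bochner_Integration.integrable_bound)
    show "integrable (lborel \<Otimes>\<^sub>M lborel) (\<lambda>z. (case z of (x, y) \<Rightarrow> B1 x y) + (case z of (x, y) \<Rightarrow> B2 x y) + ((case z of (x, y) \<Rightarrow> B3 x y) + (case z of (x, y) \<Rightarrow> B3 y x)))"
      by (intro Bochner_Integration.integrable_add i1 i2 i3 i4)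
    show "(\<lambda>(x, y). (u x - u y) * (\<phi> x - \<phi> y) * norm (x - y) powr - p) \<in> borel_measurable (lborel \<Otimes>\<^sub>M lborel)"
      by measurable
    show "AE z in lborel \<Otimes>\<^sub>M lborel. norm (case z of (x, y) \<Rightarrow> (u x - u y) * (\<phi> x - \<phi> y) * norm (x - y) powr - p) \<le>
      norm ((case z of (x, y) \<Rightarrow> B1 x y) + (case z of (x, y) \<Rightarrow> B2 x y) + ((case z of (x, y) \<Rightarrow> B3 x y) + (case z of (x, y) \<Rightarrow> B3 y x)))"
    proof (rule AE_I2)
      fix z :: "'a \<times> 'a"
      obtain x y where z: "z = (x, y)" by (cases z)
      let ?k = "norm (x - y) powr - p"
      have pos: "0 \<le> B1 x y" "0 \<le> B2 x y" "0 \<le> B3 x y" "0 \<le> B3 y x"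
        using B by (auto simp: B1_def B2_def B3_def M_def simp del: wt_minus)
      have "\<bar>(u x - u y) * (\<phi> x - \<phi> y) * ?k\<bar> \<le> B1 x y + B2 x y + (B3 x y + B3 y x)"
      proof (cases "x \<in> G \<and> y \<in> G")
        case True
        have ab: "\<bar>a * b\<bar> \<le> a\<^sup>2 + b\<^sup>2" for a b :: real
        proof -
          have "0 \<le> \<bar>a\<bar> * \<bar>b\<bar>" "2 * \<bar>a\<bar> * \<bar>b\<bar> \<le> a\<^sup>2 + b\<^sup>2" using sum_squares_bound[of "\<bar>a\<bar>" "\<bar>b\<bar>"] by auto
          then show ?thesis unfolding abs_mult by linarith
        qed
        have "\<bar>(u x - u y) * (\<phi> x - \<phi> y) * ?k\<bar> = \<bar>(u x - u y) * (\<phi> x - \<phi> y)\<bar> * ?k" by (simp add: abs_mult)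
        also have "\<dots> \<le> ((u x - u y)\<^sup>2 + M * min 1 ((norm (x - y))\<^sup>2)) * ?k"
          using ab[of "u x - u y" "\<phi> x - \<phi> y"] dphi2[of x y] by (intro mult_right_mono) auto
        also have "\<dots> = B1 x y + B2 x y" using True by (simp add: B1_def B2_def algebra_simps)
        finally show ?thesis using pos by simp
      next
        case False
        show ?thesis
        proof (cases "\<phi> x = 0 \<and> \<phi> y = 0")
          case True then show ?thesis using pos by simp
        next
          case False2: False
          have "d \<le> norm (x - y)"
            using False False2 sup far[of x y] far[of y x] by (auto simp: norm_minus_commute)
          then have k: "?k \<le> (1 + 1/d) powr p * wt p (x - y)" by (rule kernel_le_wt[OF d])
          have "\<bar>(u x - u y) * (\<phi> x - \<phi> y) * ?k\<bar> = \<bar>u x - u y\<bar> * \<bar>\<phi> x - \<phi> y\<bar> * ?k" by (simp add: abs_mult)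
          also have "\<dots> \<le> (\<bar>u x\<bar> + \<bar>u y\<bar>) * (A * (wt p x + wt p y)) * ((1 + 1/d) powr p * wt p (x - y))"
            by (intro mult_mono dphi k) (use A0 in \<open>auto simp del: wt_minus\<close>)
          also have "\<dots> = B3 x y + B3 y x" unfolding B3_def B_def wt_minus[of y x] by (simp add: algebra_simps del: wt_minus)
          finally show ?thesis using pos by simp
        qed
      qed
      then show "norm (case z of (x, y) \<Rightarrow> (u x - u y) * (\<phi> x - \<phi> y) * norm (x - y) powr - p) \<le>
      norm ((case z of (x, y) \<Rightarrow> B1 x y) + (case z of (x, y) \<Rightarrow> B2 x y) + ((case z of (x, y) \<Rightarrow> B3 x y) + (case z of (x, y) \<Rightarrow> B3 y x)))"
        by (simp add: z)
    qed
  qed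
qed

text \<open>Splitting \<open>u x - u y\<close> directly would give two integrals that need not
  converge absolutely near the diagonal. The kernel is therefore set to \<open>0\<close> for
  \<open>norm h \<le> 1 / (m + 1)\<close>, the two halves are exchanged by symmetry, and
  \<open>m\<close> tends to infinity. On the operator side the second differences keep the truncated
  integrals uniformly bounded.\<close>

lemma energy_eq_pairing:
  assumes phi: "admissible A \<phi>"
    and int: "integrable (lborel \<Otimes>\<^sub>M lborel) (\<lambda>(x, y). (u x - u y) * (\<phi> x - \<phi> y) * norm (x - y) powr -p)" (is "integrable _ ?P")
  shows "(\<integral>x. \<integral>y. (u x - u y) * (\<phi> x - \<phi> y) * norm (x - y) powr -p \<partial>lborel \<partial>lborel) = - pairing \<phi>"
proof -
  note [measurable] = admissible_measurable[OF phi]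
  have A0: "A \<ge> 0" by (rule admissible_nonneg[OF phi])
  define k where "k m h = (if norm h > 1 / real (Suc m) then norm h powr -p else 0)" for m and h :: 'a
  have k_meas [measurable]: "k m \<in> borel_measurable borel" for m unfolding k_def[abs_def] by measurable
  have k0: "0 \<le> k m h" and kle: "k m h \<le> norm h powr -p" for m h by (auto simp: k_def)
  have ksym: "k m (x - y) = k m (y - x)" for m x y by (simp add: k_def norm_minus_commute)
  have klim: "(\<lambda>m. k m h) \<longlonglongrightarrow> norm h powr -p" for h
  proof (cases "h = 0")
    case True then show ?thesis by (simp add: k_def)
  next
    case False
    have "(\<lambda>m. 1 / real (Suc m)) \<longlonglongrightarrow> 0" by real_asymp
    then have "eventually (\<lambda>m. 1 / real (Suc m) < norm h) sequentially"
      using False by (auto intro: order_tendstoD)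
    then have "eventually (\<lambda>m. k m h = norm h powr -p) sequentially" by eventually_elim (simp add: k_def)
    then show ?thesis by (rule tendsto_eventually)
  qed
  have kwt: "k m h \<le> (2 + real m) powr p * wt p h" for m h
    using kernel_le_wt[of "1 / real (Suc m)" h] by (auto simp: k_def add_ac)
  define R where "R m x y = u x * (\<phi> x - \<phi> y) * k m (x - y)" for m x y
  have dphi: "\<bar>\<phi> x - \<phi> y\<bar> \<le> A * (wt p x + wt p y)" for x y
  proof -
    have "\<bar>\<phi> x\<bar> \<le> A * wt p x" "\<bar>\<phi> y\<bar> \<le> A * wt p y" using phi by (auto simp: admissible_def)
    then show ?thesis by (simp add: algebra_simps)
  qed
  have R_int: "integrable (lborel \<Otimes>\<^sub>M lborel) (\<lambda>(x, y). R m x y)" for m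
  proof (rule integrable_u_wt'[where B="A * (2 + real m) powr p"])
    fix x y
    have "\<bar>R m x y\<bar> = \<bar>u x\<bar> * \<bar>\<phi> x - \<phi> y\<bar> * k m (x - y)" using k0 by (simp add: R_def abs_mult)
    also have "\<dots> \<le> \<bar>u x\<bar> * (A * (wt p x + wt p y)) * ((2 + real m) powr p * wt p (x - y))"
      by (intro mult_mono dphi kwt) (use A0 k0 in \<open>auto simp del: wt_minus\<close>)
    finally show "\<bar>R m x y\<bar> \<le> A * (2 + real m) powr p * (\<bar>u x\<bar> * (wt p x + wt p y) * wt p (x - y))"
      by (simp add: mult_ac)
  qed (use A0 in \<open>auto simp: R_def\<close>)
  have R_int': "integrable (lborel \<Otimes>\<^sub>M lborel) (\<lambda>(x, y). R m y x)" for m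
    using lborel_pair.integrable_product_swap[OF R_int] by simp
  define J where "J m x = (\<integral>h. second_diff \<phi> x h * k m h \<partial>lborel)" for m x
  have J_meas [measurable]: "J m \<in> borel_measurable borel" for m unfolding J_def[abs_def] by measurable
  \<comment> \<open>Averaging over \<open>h\<close> and \<open>-h\<close> turns the first difference
    into half of a second difference with the opposite sign; the two symmetric halves of the energy
    then add up to one full copy.\<close>
  have inner: "(\<integral>y. R m x y \<partial>lborel) = - (1/2) * (u x * J m x)" for m x
  proof -
    have ip: "integrable lborel (\<lambda>h. (\<phi> x - \<phi> (x + h)) * k m h)"
    proof (rule Bochner_Integration.integrable_bound)
      show "integrable lborel (\<lambda>h::'a. (A * 2) * ((2 + real m) powr p * wt p h))" by (simp add: integrable_wt_p)
      show "AE h in lborel. norm ((\<phi> x - \<phi> (x + h)) * k m h) \<le> norm ((A * 2) * ((2 + real m) powr p * wt p h))"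
      proof (rule AE_I2)
        fix h
        have "A * (wt p x + wt p (x+h)) \<le> A * (1 + 1)" using A0 by (intro mult_left_mono add_mono wt_le_1) auto
        then have "\<bar>\<phi> x - \<phi> (x + h)\<bar> \<le> A * 2" using dphi[of x "x+h"] by simp
        then have "\<bar>\<phi> x - \<phi> (x + h)\<bar> * k m h \<le> (A * 2) * ((2 + real m) powr p * wt p h)"
          by (intro mult_mono kwt) (use k0 A0 in auto)
        then show "norm ((\<phi> x - \<phi> (x + h)) * k m h) \<le> norm ((A * 2) * ((2 + real m) powr p * wt p h))"
          using k0 A0 by (simp add: abs_mult)
      qed
    qed measurable
    have kn: "k m (-h) = k m h" for h by (simp add: k_def)
    have im: "integrable lborel (\<lambda>h. (\<phi> x - \<phi> (x - h)) * k m h)"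
      using lborel_integral_translate(4)[of "\<lambda>h. (\<phi> x - \<phi> (x + h)) * k m h" 0] ip by (simp add: kn)
    have e: "(\<integral>y. (\<phi> x - \<phi> y) * k m (x - y) \<partial>lborel) = (\<integral>h. (\<phi> x - \<phi> (x - h)) * k m h \<partial>lborel)"
      using lborel_integral_translate(2)[of "\<lambda>h. (\<phi> x - \<phi> (x - h)) * k m h" x] by simp
    have e2: "(\<integral>h. (\<phi> x - \<phi> (x - h)) * k m h \<partial>lborel) = (\<integral>h. (\<phi> x - \<phi> (x + h)) * k m h \<partial>lborel)"
      using lborel_integral_translate(2)[of "\<lambda>h. (\<phi> x - \<phi> (x + h)) * k m h" 0] by (simp add: kn)
    have "- J m x = (\<integral>h. (\<phi> x - \<phi> (x - h)) * k m h + (\<phi> x - \<phi> (x + h)) * k m h \<partial>lborel)"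
      unfolding J_def by (subst Bochner_Integration.integral_minus[symmetric]) (auto simp: second_diff_def algebra_simps intro!: Bochner_Integration.integral_cong)
    also have "\<dots> = 2 * (\<integral>y. (\<phi> x - \<phi> y) * k m (x - y) \<partial>lborel)"
      using ip im e e2 by simp
    finally have "(\<integral>y. (\<phi> x - \<phi> y) * k m (x - y) \<partial>lborel) = - (1/2) * J m x" by simp
    then show ?thesis unfolding R_def by (simp add: mult.assoc)
  qed
  have eqm: "(\<integral>z. (case z of (x, y) \<Rightarrow> (u x - u y) * (\<phi> x - \<phi> y) * k m (x - y)) \<partial>(lborel \<Otimes>\<^sub>M lborel)) = - (\<integral>x. u x * J m x \<partial>lborel)" for m
  proof -
    have "(\<integral>z. (case z of (x, y) \<Rightarrow> (u x - u y) * (\<phi> x - \<phi> y) * k m (x - y)) \<partial>(lborel \<Otimes>\<^sub>M lborel)) =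
       (\<integral>z. (case z of (x, y) \<Rightarrow> R m x y) + (case z of (x, y) \<Rightarrow> R m y x) \<partial>(lborel \<Otimes>\<^sub>M lborel))"
      by (intro Bochner_Integration.integral_cong refl) (auto simp: R_def ksym[of m] algebra_simps split: prod.split)
    also have "\<dots> = (\<integral>z. (case z of (x, y) \<Rightarrow> R m x y) \<partial>(lborel \<Otimes>\<^sub>M lborel)) + (\<integral>z. (case z of (x, y) \<Rightarrow> R m y x) \<partial>(lborel \<Otimes>\<^sub>M lborel))"
      by (rule Bochner_Integration.integral_add[OF R_int R_int'])
    also have "(\<integral>z. (case z of (x, y) \<Rightarrow> R m y x) \<partial>(lborel \<Otimes>\<^sub>M lborel)) = (\<integral>z. (case z of (x, y) \<Rightarrow> R m x y) \<partial>(lborel \<Otimes>\<^sub>M lborel))"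
      using lborel_pair.integral_product_swap[of "\<lambda>(x, y). R m x y"] borel_measurable_integrable[OF R_int] by simp
    also have "(\<integral>z. (case z of (x, y) \<Rightarrow> R m x y) \<partial>(lborel \<Otimes>\<^sub>M lborel)) = (\<integral>x. \<integral>y. R m x y \<partial>lborel \<partial>lborel)"
      by (rule lborel_pair.integral_fst[symmetric, OF R_int])
    finally show ?thesis unfolding inner by simp
  qed
  have lim1: "(\<lambda>m. \<integral>z. (case z of (x, y) \<Rightarrow> (u x - u y) * (\<phi> x - \<phi> y) * k m (x - y)) \<partial>(lborel \<Otimes>\<^sub>M lborel)) \<longlonglongrightarrow> (\<integral>z. ?P z \<partial>(lborel \<Otimes>\<^sub>M lborel))"
  proof (rule integral_dominated_convergence[where w="\<lambda>z. norm (?P z)"])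
    show "integrable (lborel \<Otimes>\<^sub>M lborel) (\<lambda>z. norm (?P z))" using int by (rule integrable_norm)
    show "AE z in lborel \<Otimes>\<^sub>M lborel. (\<lambda>m. case z of (x, y) \<Rightarrow> (u x - u y) * (\<phi> x - \<phi> y) * k m (x - y)) \<longlonglongrightarrow> ?P z"
      by (rule AE_I2) (auto intro!: tendsto_intros klim)
    show "AE z in lborel \<Otimes>\<^sub>M lborel. norm (case z of (x, y) \<Rightarrow> (u x - u y) * (\<phi> x - \<phi> y) * k m (x - y)) \<le> norm (?P z)" for m
      by (rule AE_I2) (use k0 kle in \<open>auto simp: abs_mult intro!: mult_left_mono\<close>)
  qed measurable
  have Jb: "\<bar>J m x\<bar> \<le> A * majorant_mass * wt p x" for m x
  proof -
    have "\<bar>J m x\<bar> \<le> (\<integral>h. \<bar>second_diff \<phi> x h * k m h\<bar> \<partial>lborel)"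
      unfolding J_def by (rule integral_abs_bound)
    also have "\<dots> \<le> (\<integral>h. \<bar>second_diff \<phi> x h * norm h powr -p\<bar> \<partial>lborel)"
      by (rule Bochner_Integration.integral_mono')
         (use k0 kle integrable_abs[OF admissible_integrable(1)[OF phi]] in \<open>auto simp: abs_mult intro!: mult_left_mono\<close>)
    also have "\<dots> \<le> A * majorant_mass * wt p x" using admissible_integrable(2)[OF phi, of x] by (simp add: abs_mult)
    finally show ?thesis .
  qed
  have Jlim: "(\<lambda>m. J m x) \<longlonglongrightarrow> flap \<phi> x" for x
    unfolding J_def flap_def
  proof (rule integral_dominated_convergence[where w="\<lambda>h. \<bar>second_diff \<phi> x h * norm h powr -p\<bar>"])
    show "integrable lborel (\<lambda>h. \<bar>second_diff \<phi> x h * norm h powr -p\<bar>)" by (intro integrable_abs admissible_integrable(1)[OF phi])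
    show "AE h in lborel. (\<lambda>m. second_diff \<phi> x h * k m h) \<longlonglongrightarrow> second_diff \<phi> x h * norm h powr - p"
      by (intro AE_I2 tendsto_intros klim)
    show "AE h in lborel. norm (second_diff \<phi> x h * k m h) \<le> \<bar>second_diff \<phi> x h * norm h powr -p\<bar>" for m
      by (rule AE_I2) (use k0 kle in \<open>auto simp: abs_mult intro!: mult_left_mono\<close>)
  qed measurable
  have lim2: "(\<lambda>m. \<integral>x. u x * J m x \<partial>lborel) \<longlonglongrightarrow> pairing \<phi>"
    unfolding pairing_def
  proof (rule integral_dominated_convergence[where w="\<lambda>x. A * majorant_mass * (\<bar>u x\<bar> * wt p x)"])
    show "integrable lborel (\<lambda>x. A * majorant_mass * (\<bar>u x\<bar> * wt p x))" using u_tail by simp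
    show "AE x in lborel. (\<lambda>m. u x * J m x) \<longlonglongrightarrow> u x * flap \<phi> x"
      by (intro AE_I2 tendsto_intros Jlim)
    show "AE x in lborel. norm (u x * J m x) \<le> A * majorant_mass * (\<bar>u x\<bar> * wt p x)" for m
    proof (rule AE_I2)
      fix x
      show "norm (u x * J m x) \<le> A * majorant_mass * (\<bar>u x\<bar> * wt p x)"
        using mult_left_mono[OF Jb[of m x], of "\<bar>u x\<bar>"] by (simp add: abs_mult mult_ac)
    qed
  qed measurable
  have "(\<integral>z. ?P z \<partial>(lborel \<Otimes>\<^sub>M lborel)) = - pairing \<phi>"
    using LIMSEQ_unique[OF lim1[unfolded eqm] tendsto_minus[OF lim2]] by simp
  then show ?thesis using lborel_pair.integral_fst[OF int] by simp
qed

end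

section \<open>Smooth functions and cut-offs\<close>

lemma Ck_SucI: "(\<And>x. (f has_derivative f' x) (at x)) \<Longrightarrow> (\<And>v. Ck k (\<lambda>x. f' x v)) \<Longrightarrow> Ck (Suc k) f"
  by auto

lemma Ck_Suc_imp: "Ck (Suc k) f \<Longrightarrow> Ck k f"
proof (induction k arbitrary: f)
  case 0
  then obtain f' where "\<forall>x. (f has_derivative f' x) (at x)" by auto
  then have "isCont f x" for x using has_derivative_continuous[of f "f' x" x UNIV] by simp
  then show ?case by (auto intro!: continuous_at_imp_continuous_on)
next
  case (Suc k)
  from Suc.prems obtain f' where "\<forall>x. (f has_derivative f' x) (at x)" "\<forall>v. Ck (Suc k) (\<lambda>x. f' x v)"
    by (subst (asm) Ck.simps) blast
  with Suc.IH show ?case by auto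
qed

lemma Ck_const: "Ck k (\<lambda>x. c)"
proof (induction k arbitrary: c)
  case (Suc k)
  show ?case unfolding Ck.simps
    by (rule exI[of _ "\<lambda>x v. 0"]) (auto intro: Suc.IH)
qed simp

lemma Ck_add: "Ck k f \<Longrightarrow> Ck k g \<Longrightarrow> Ck k (\<lambda>x. f x + g x)"
proof (induction k arbitrary: f g)
  case (Suc k)
  from Suc.prems obtain f' g' where "\<forall>x. (f has_derivative f' x) (at x)" "\<forall>v. Ck k (\<lambda>x. f' x v)"
    "\<forall>x. (g has_derivative g' x) (at x)" "\<forall>v. Ck k (\<lambda>x. g' x v)"
    by auto
  then show ?case unfolding Ck.simps
    by (intro exI[of _ "\<lambda>x v. f' x v + g' x v"]) (auto intro!: Suc.IH derivative_intros)
qed (auto intro: continuous_intros)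

lemma Ck_mult: "Ck k f \<Longrightarrow> Ck k g \<Longrightarrow> Ck k (\<lambda>x. f x * g x)"
proof (induction k arbitrary: f g)
  case (Suc k)
  note p = Suc.prems[THEN Ck_Suc_imp]
  from Suc.prems obtain f' g' where "\<forall>x. (f has_derivative f' x) (at x)" "\<forall>v. Ck k (\<lambda>x. f' x v)"
    "\<forall>x. (g has_derivative g' x) (at x)" "\<forall>v. Ck k (\<lambda>x. g' x v)"
    by auto
  with p show ?case unfolding Ck.simps
    by (intro exI[of _ "\<lambda>x v. f x * g' x v + f' x v * g x"]) (auto intro!: Suc.IH Ck_add derivative_intros)
qed (auto intro: continuous_intros)

lemma Ck_linear: "bounded_linear f \<Longrightarrow> Ck k f"
proof (cases k)
  case 0
  assume "bounded_linear f" with 0 show ?thesis by (auto simp: linear_continuous_on)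
next
  case (Suc j)
  assume "bounded_linear f"
  then show ?thesis unfolding Suc Ck.simps
    by (intro exI[of _ "\<lambda>_. f"]) (auto simp: Ck_const bounded_linear_imp_has_derivative)
qed

lemma Ck_inner_self: "Ck k (\<lambda>x::'a::euclidean_space. x \<bullet> x)"
proof (cases k)
  case (Suc j)
  have "((\<lambda>x. x \<bullet> x) has_derivative (\<lambda>v. 2 * (v \<bullet> x))) (at x)" for x :: 'a
    by (auto intro!: derivative_eq_intros simp: inner_commute)
  moreover have "Ck j (\<lambda>x::'a. 2 * (v \<bullet> x))" for v
    by (intro Ck_mult Ck_const Ck_linear bounded_linear_inner_right)
  ultimately show ?thesis unfolding Suc by (rule Ck_SucI)
qed (auto intro: continuous_intros)

text \<open>\<open>Ck\<close> provides a derivative separately for each \<open>k\<close>. Uniqueness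
  of derivatives identifies these witnesses, so a single \<open>f1\<close> is smooth.\<close>

lemma smooth_fun_deriv:
  fixes f :: "real \<Rightarrow> real"
  assumes "smooth_fun f"
  obtains f1 where "\<And>x. DERIV f x :> f1 x" "smooth_fun f1"
proof -
  have *: "\<exists>f1. (\<forall>x. DERIV f x :> f1 x) \<and> Ck k f1" for k
  proof -
    have "Ck (Suc k) f" using assms by (simp only: smooth_fun_def)
    then obtain D where D: "\<And>x. (f has_derivative D x) (at x)" "\<And>v. Ck k (\<lambda>x. D x v)" by auto
    have "D x = (*) (D x 1)" for x
    proof
      fix v
      interpret bounded_linear "D x" using D(1) by (rule has_derivative_bounded_linear)
      show "D x v = D x 1 * v" using scaleR[of v 1] by (simp add: mult.commute)
    qed
    then have "DERIV f x :> D x 1" for x using D(1)[of x] by (simp add: has_field_derivative_def)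
    with D(2) show ?thesis by (intro exI[of _ "\<lambda>x. D x 1"]) auto
  qed
  obtain f1 where f1: "\<And>x. DERIV f x :> f1 x" using *[of 0] by auto
  have "Ck k f1" for k
  proof -
    obtain g where g: "\<And>x. DERIV f x :> g x" "Ck k g" using *[of k] by auto
    have "f1 = g" using DERIV_unique[OF f1 g(1)] by auto
    with g show ?thesis by simp
  qed
  then have "smooth_fun f1" by (simp add: smooth_fun_def)
  with f1 show thesis by (rule that)
qed

lemma Ck_compose: "smooth_fun \<phi> \<Longrightarrow> Ck k f \<Longrightarrow> Ck k (\<lambda>x. \<phi> (f x))" for \<phi> :: "real \<Rightarrow> real"
proof (induction k arbitrary: \<phi> f)
  case 0
  have "Ck 0 \<phi>" using 0 by (simp only: smooth_fun_def)
  then have "continuous_on UNIV \<phi>" by simp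
  then show ?case using 0(2) by (auto intro: continuous_on_compose2)
next
  case (Suc k)
  obtain \<phi>1 where p: "\<And>x. DERIV \<phi> x :> \<phi>1 x" "smooth_fun \<phi>1" using smooth_fun_deriv[OF Suc.prems(1)] by metis
  from Suc.prems obtain f' where f: "\<forall>x. (f has_derivative f' x) (at x)" "\<forall>v. Ck k (\<lambda>x. f' x v)" by auto
  have "((\<lambda>x. \<phi> (f x)) has_derivative (\<lambda>v. \<phi>1 (f x) * f' x v)) (at x)" for x
    using has_derivative_compose[OF f(1)[rule_format, of x] p(1)[of "f x", unfolded has_field_derivative_def]] .
  moreover have "Ck k (\<lambda>x. \<phi>1 (f x) * f' x v)" for v
    by (rule Ck_mult[OF Suc.IH[OF p(2) Ck_Suc_imp[OF Suc.prems(2)]] f(2)[rule_format]])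
  ultimately show ?case by (rule Ck_SucI)
qed

lemma smooth_fun_const: "smooth_fun (\<lambda>x. c)" by (simp add: smooth_fun_def Ck_const)
lemma smooth_fun_add: "smooth_fun f \<Longrightarrow> smooth_fun g \<Longrightarrow> smooth_fun (\<lambda>x. f x + g x)" by (simp add: smooth_fun_def Ck_add)
lemma smooth_fun_mult: "smooth_fun f \<Longrightarrow> smooth_fun g \<Longrightarrow> smooth_fun (\<lambda>x. f x * g x)" by (simp add: smooth_fun_def Ck_mult)
lemma smooth_fun_linear: "bounded_linear f \<Longrightarrow> smooth_fun f" by (simp add: smooth_fun_def Ck_linear)
lemma smooth_fun_inner_self: "smooth_fun (\<lambda>x. x \<bullet> x)" by (simp add: smooth_fun_def Ck_inner_self)
lemma smooth_fun_compose: "smooth_fun \<phi> \<Longrightarrow> smooth_fun f \<Longrightarrow> smooth_fun (\<lambda>x. \<phi> (f x))" for \<phi> :: "real \<Rightarrow> real"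
  unfolding smooth_fun_def[of f] smooth_fun_def[of "\<lambda>x. \<phi> (f x)"]
  by (rule allI, rule Ck_compose[of \<phi> _ f]) (assumption, erule spec)

lemma smooth_fun_exp: "smooth_fun (exp :: real \<Rightarrow> real)"
proof -
  have "Ck k (exp :: real \<Rightarrow> real)" for k
  proof (induction k)
    case 0 show ?case by (auto intro: continuous_intros)
  next
    case (Suc k)
    have "((exp :: real \<Rightarrow> real) has_derivative (\<lambda>v. exp x * v)) (at x)" for x
      using DERIV_exp[of x] by (simp add: has_field_derivative_def)
    moreover have "Ck k (\<lambda>x::real. exp x * v)" for v using Suc by (intro Ck_mult Ck_const) auto
    ultimately show ?case by (rule Ck_SucI)
  qed
  then show ?thesis by (simp add: smooth_fun_def)
qed

text \<open>The case \<open>m = 0\<close> is the classical flat function \<open>exp (-1/x)\<close>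
  continued by \<open>0\<close>. The extra power makes the family closed under differentiation up to
  linear combinations, so smoothness is one induction for all \<open>m\<close> at once.\<close>

definition exp_flat :: "nat \<Rightarrow> real \<Rightarrow> real" where
  "exp_flat m x = (if x > 0 then inverse x ^ m / exp (inverse x) else 0)"

lemma exp_flat_tendsto: "(exp_flat m \<longlongrightarrow> 0) (at 0)"
proof (rule filterlim_split_at)
  have "eventually (\<lambda>x. exp_flat m x = 0) (at_left 0)"
    by (auto simp: eventually_at_filter exp_flat_def)
  then show "(exp_flat m \<longlongrightarrow> 0) (at_left 0)" by (rule tendsto_eventually)
  have "((\<lambda>x. inverse x ^ m / exp (inverse x)) \<longlongrightarrow> 0) (at_right (0::real))"
    by (rule filterlim_compose[OF tendsto_power_div_exp_0 filterlim_inverse_at_top_right])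
  then show "(exp_flat m \<longlongrightarrow> 0) (at_right 0)"
    by (rule Lim_transform_eventually) (auto simp: eventually_at_filter exp_flat_def)
qed

lemma exp_flat_deriv: "DERIV (exp_flat m) x :> - real m * exp_flat (m + 1) x + exp_flat (m + 2) x"
proof -
  consider "x > 0" | "x < 0" | "x = 0" by linarith
  then show ?thesis
  proof cases
    case 1
    have "DERIV (\<lambda>x. inverse x ^ m / exp (inverse x)) x :> - real m * exp_flat (m + 1) x + exp_flat (m + 2) x"
    proof (cases m)
      case 0
      then show ?thesis using 1 by (auto intro!: derivative_eq_intros simp: exp_flat_def field_simps power2_eq_square)
    next
      case (Suc k)
      have i: "DERIV inverse x :> - (inverse x ^ Suc (Suc 0))" using 1 by (intro DERIV_inverse) auto
      have e: "DERIV (\<lambda>x. exp (inverse x)) x :> exp (inverse x) * - (inverse x ^ Suc (Suc 0))"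
        by (rule DERIV_chain2[OF DERIV_exp i])
      show ?thesis unfolding Suc
        by (rule DERIV_cong[OF DERIV_divide[OF DERIV_power_Suc[OF i, of k] e]]) (use 1 in \<open>simp_all add: exp_flat_def field_simps\<close>)
    qed
    then show ?thesis
      by (rule has_field_derivative_transform_within_open[where S="{0<..}"]) (use 1 in \<open>auto simp: exp_flat_def\<close>)
  next
    case 2
    have "DERIV (\<lambda>x. 0) x :> - real m * exp_flat (m + 1) x + exp_flat (m + 2) x" using 2 by (simp add: exp_flat_def)
    then show ?thesis
      by (rule has_field_derivative_transform_within_open[where S="{..<0}"]) (use 2 in \<open>auto simp: exp_flat_def\<close>)
  next
    case 3
    have "((\<lambda>h. (exp_flat m (0 + h) - exp_flat m 0) / h) \<longlongrightarrow> 0) (at 0)"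
      by (rule Lim_transform_eventually[OF exp_flat_tendsto[of "m+1"]]) (auto simp: eventually_at_filter exp_flat_def field_simps)
    then show ?thesis using 3 by (simp add: DERIV_def exp_flat_def)
  qed
qed

lemma smooth_fun_exp_flat: "smooth_fun (exp_flat m)"
proof -
  have "Ck k (exp_flat m)" for k m
  proof (induction k arbitrary: m)
    case 0
    show ?case by (auto intro!: continuous_at_imp_continuous_on DERIV_isCont[OF exp_flat_deriv])
  next
    case (Suc k)
    have "(exp_flat m has_derivative (\<lambda>v. (- real m * exp_flat (m + 1) x + exp_flat (m + 2) x) * v)) (at x)" for x
      using exp_flat_deriv[of m x] by (simp add: has_field_derivative_def)
    moreover have "Ck k (\<lambda>x. (- real m * exp_flat (m + 1) x + exp_flat (m + 2) x) * v)" for v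
      by (intro Ck_mult Ck_add Ck_const Suc)
    ultimately show ?case by (rule Ck_SucI)
  qed
  then show ?thesis by (simp add: smooth_fun_def)
qed

lemma smooth_step_exists:
  obtains \<rho> :: "real \<Rightarrow> real" where "smooth_fun \<rho>" "\<And>q. q \<le> 1 \<Longrightarrow> \<rho> q = 0" "\<And>q. q \<ge> 3 \<Longrightarrow> \<rho> q = 1"
proof
  define c where "c = exp_flat 0 (1/2)"
  have c: "c \<noteq> 0" by (simp add: c_def exp_flat_def)
  \<comment> \<open>Nesting the flat function avoids a quotient. For \<open>q \<le> 1\<close> the
    inner value is \<open>0\<close> and the outer one is \<open>c\<close>, giving \<open>0\<close>;
    for \<open>q \<ge> 3\<close> the inner value is at least \<open>1/2\<close>, so the outer
    argument is not positive and the result is \<open>1\<close>.\<close>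
  let ?\<rho> = "\<lambda>q. 1 + (- 1 / c) * exp_flat 0 (1/2 + (-1) * exp_flat 0 (q + (-1)))"
  show "smooth_fun ?\<rho>"
    by (intro smooth_fun_add smooth_fun_mult smooth_fun_const smooth_fun_compose[OF smooth_fun_exp_flat])
       (intro smooth_fun_linear bounded_linear_ident)
  show "?\<rho> q = 0" if "q \<le> 1" for q using that c by (simp add: exp_flat_def c_def)
  show "?\<rho> q = 1" if "q \<ge> 3" for q
  proof -
    have "inverse (q - 1) \<le> 1 / 2" using that by (simp add: field_simps)
    then have "exp (- inverse (q - 1)) \<ge> 1 + - inverse (q - 1)" "1 + - inverse (q - 1) \<ge> 1/2"
      using exp_ge_add_one_self[of "- inverse (q - 1)"] by auto
    moreover have "exp_flat 0 (q - 1) = exp (- inverse (q - 1))" using that by (simp add: exp_flat_def exp_minus divide_inverse)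
    ultimately have "exp_flat 0 (q - 1) \<ge> 1/2" by linarith
    then have "exp_flat 0 (1/2 + (-1) * exp_flat 0 (q + (-1))) = 0"
      by (subst exp_flat_def) simp
    then show ?thesis by simp
  qed
qed

text \<open>The bounds are invariant under the scaling \<open>q \<mapsto> l * q\<close>, so they control \<open>\<rho> (l * (x \<bullet> x))\<close> uniformly in \<open>l > 0\<close>.\<close>

definition cutoff :: "real \<Rightarrow> (real \<Rightarrow> real) \<Rightarrow> (real \<Rightarrow> real) \<Rightarrow> (real \<Rightarrow> real) \<Rightarrow> bool" where
  "cutoff M \<rho> \<rho>1 \<rho>2 \<longleftrightarrow> (\<forall>q. DERIV \<rho> q :> \<rho>1 q) \<and> (\<forall>q. DERIV \<rho>1 q :> \<rho>2 q) \<and>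
     (\<forall>q. \<bar>\<rho> q\<bar> \<le> M \<and> \<bar>\<rho>1 q * q\<bar> \<le> M \<and> \<bar>\<rho>2 q * q\<^sup>2\<bar> \<le> M)"

lemma deriv_zero_outside:
  fixes f :: "real \<Rightarrow> real"
  assumes f: "\<And>x. DERIV f x :> f1 x" and c: "\<And>x. x \<le> a \<Longrightarrow> f x = c" "\<And>x. x \<ge> b \<Longrightarrow> f x = d"
  shows "x < a \<Longrightarrow> f1 x = 0" "x > b \<Longrightarrow> f1 x = 0"
proof -
  assume x: "x < a"
  have "DERIV f x :> 0"
    by (rule has_field_derivative_transform_within_open[of "\<lambda>_. c" 0 x "{..<a}"]) (use x c in auto)
  then show "f1 x = 0" using f DERIV_unique by blast
next
  assume x: "x > b"
  have "DERIV f x :> 0"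
    by (rule has_field_derivative_transform_within_open[of "\<lambda>_. d" 0 x "{b<..}"]) (use x c in auto)
  then show "f1 x = 0" using f DERIV_unique by blast
qed

lemma bounded_outside:
  fixes f :: "real \<Rightarrow> real"
  assumes "continuous_on UNIV f" "\<And>x. x < a \<Longrightarrow> f x = c" "\<And>x. x > b \<Longrightarrow> f x = d"
  obtains M where "\<And>x. \<bar>f x\<bar> \<le> M"
proof -
  have "compact (f ` {a..b})" using assms(1) by (intro compact_continuous_image) (auto intro: continuous_on_subset)
  then obtain B where B: "\<And>y. y \<in> f ` {a..b} \<Longrightarrow> \<bar>y\<bar> \<le> B" using compact_imp_bounded bounded_real by metis
  have "\<bar>f x\<bar> \<le> max B (max \<bar>c\<bar> \<bar>d\<bar>)" for x
    using assms(2,3)[of x] B[of "f x"] by (cases "x < a"; cases "x > b") auto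
  then show thesis by (rule that)
qed

lemma cutoff_exists:
  obtains \<rho> \<rho>1 \<rho>2 :: "real \<Rightarrow> real" and M where "smooth_fun \<rho>" "\<And>q. q \<le> 1 \<Longrightarrow> \<rho> q = 0" "\<And>q. q \<ge> 3 \<Longrightarrow> \<rho> q = 1"
    "cutoff M \<rho> \<rho>1 \<rho>2"
proof -
  obtain \<rho> :: "real \<Rightarrow> real" where r: "smooth_fun \<rho>" "\<And>q. q \<le> 1 \<Longrightarrow> \<rho> q = 0" "\<And>q. q \<ge> 3 \<Longrightarrow> \<rho> q = 1"
    by (rule smooth_step_exists) blast
  obtain \<rho>1 where r1: "\<And>q. DERIV \<rho> q :> \<rho>1 q" "smooth_fun \<rho>1" using smooth_fun_deriv[OF r(1)] by metis
  obtain \<rho>2 where r2: "\<And>q. DERIV \<rho>1 q :> \<rho>2 q" "smooth_fun \<rho>2" using smooth_fun_deriv[OF r1(2)] by metis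
  note z1 = deriv_zero_outside[of \<rho> \<rho>1 1 0 3 1, OF r1(1) r(2) r(3)]
  \<comment> \<open>So far \<open>\<rho>1\<close> is known to vanish strictly below \<open>1\<close>
    and strictly above \<open>3\<close>, while \<open>deriv_zero_outside\<close> wants closed
    half-lines; hence the margins \<open>1/2\<close> and \<open>4\<close>.\<close>
  have z2: "\<rho>2 q = 0" if "q < 1/2" for q by (rule deriv_zero_outside(1)[of \<rho>1 \<rho>2 "1/2" 0 4 0]) (use z1 r2 that in auto)
  have z2': "\<rho>2 q = 0" if "q > 4" for q by (rule deriv_zero_outside(2)[of \<rho>1 \<rho>2 "1/2" 0 4 0]) (use z1 r2 that in auto)
  have cont: "continuous_on UNIV f" if "smooth_fun f" for f :: "real \<Rightarrow> real"
    using that[unfolded smooth_fun_def, rule_format, of 0] by simp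
  obtain M0 where M0: "\<And>q. \<bar>\<rho> q\<bar> \<le> M0"
    using bounded_outside[of \<rho> 1 0 3 1] cont[OF r(1)] r by (metis less_eq_real_def)
  obtain M1 where M1: "\<And>q. \<bar>\<rho>1 q * q\<bar> \<le> M1"
    by (rule bounded_outside[of "\<lambda>q. \<rho>1 q * q" 1 0 3 0]) (use cont[OF r1(2)] z1 in \<open>auto intro!: continuous_intros\<close>)
  obtain M2 where M2: "\<And>q. \<bar>\<rho>2 q * q\<^sup>2\<bar> \<le> M2"
    by (rule bounded_outside[of "\<lambda>q. \<rho>2 q * q\<^sup>2" "1/2" 0 4 0]) (use cont[OF r2(2)] z2 z2' in \<open>auto intro!: continuous_intros\<close>)
  have "cutoff (max M0 (max M1 M2)) \<rho> \<rho>1 \<rho>2"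
    unfolding cutoff_def using r1 r2 M0 M1 M2 by (auto simp: le_max_iff_disj)
  with r that show thesis by blast
qed

lemma cutoff_one_minus:
  assumes "cutoff M \<rho> \<rho>1 \<rho>2"
  shows "cutoff (1 + M) (\<lambda>q. 1 - \<rho> q) (\<lambda>q. - \<rho>1 q) (\<lambda>q. - \<rho>2 q)"
  unfolding cutoff_def
proof (intro conjI allI)
  fix q
  have *: "\<bar>\<rho> q\<bar> \<le> M" "\<bar>\<rho>1 q * q\<bar> \<le> M" "\<bar>\<rho>2 q * q\<^sup>2\<bar> \<le> M" using assms by (auto simp: cutoff_def)
  show "\<bar>1 - \<rho> q\<bar> \<le> 1 + M" using * by linarith
  show "\<bar>- \<rho>1 q * q\<bar> \<le> 1 + M" "\<bar>- \<rho>2 q * q\<^sup>2\<bar> \<le> 1 + M" using * by (simp_all add: abs_mult)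
qed (use assms in \<open>auto simp: cutoff_def intro!: derivative_eq_intros\<close>)

section \<open>Testing with functions that vanish to second order at the origin\<close>

context fractional_order
begin

text \<open>The second derivative is that of the scalar functions \<open>g' x v\<close> of
  \<open>x\<close> for fixed \<open>v\<close>, in the direction \<open>k\<close>; this avoids
  derivatives with values in a space of linear maps.\<close>

definition twice_diff :: "('a \<Rightarrow> real) \<Rightarrow> ('a \<Rightarrow> 'a \<Rightarrow> real) \<Rightarrow> ('a \<Rightarrow> 'a \<Rightarrow> 'a \<Rightarrow> real) \<Rightarrow> bool" where
  "twice_diff g g' g'' \<longleftrightarrow> (\<forall>x. (g has_derivative g' x) (at x)) \<and> (\<forall>x v. ((\<lambda>x. g' x v) has_derivative g'' x v) (at x))"

lemma mvt_line:
  fixes g :: "'a \<Rightarrow> real"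
  assumes "\<And>x. (g has_derivative g' x) (at x)"
  obtains t where "0 < t" "t < 1" "g (x + h) - g x = g' (x + t *\<^sub>R h) h"
proof -
  have d: "((\<lambda>t. g (x + t *\<^sub>R h)) has_derivative (\<lambda>r. g' (x + t *\<^sub>R h) (r *\<^sub>R h))) (at t)" for t
    by (rule has_derivative_compose[OF _ assms]) (auto intro!: derivative_eq_intros)
  have D: "DERIV (\<lambda>t. g (x + t *\<^sub>R h)) t :> g' (x + t *\<^sub>R h) h" for t
  proof -
    interpret bounded_linear "g' (x + t *\<^sub>R h)" using assms by (rule has_derivative_bounded_linear)
    have "(\<lambda>r. g' (x + t *\<^sub>R h) (r *\<^sub>R h)) = (*) (g' (x + t *\<^sub>R h) h)" by (auto simp: scaleR mult.commute)
    with d[of t] show ?thesis by (simp add: has_field_derivative_def)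
  qed
  obtain z where "0 < z" "z < 1" "g (x + 1 *\<^sub>R h) - g (x + 0 *\<^sub>R h) = (1 - 0) * g' (x + z *\<^sub>R h) h"
    using MVT2[of 0 1 "\<lambda>t. g (x + t *\<^sub>R h)" "\<lambda>t. g' (x + t *\<^sub>R h) h"] D by auto
  then show thesis by (intro that[of z]) auto
qed

text \<open>The mean value theorem applied to \<open>g y + g (2 x - y)\<close> turns the second
  difference into a difference of first derivatives at \<open>x + t h\<close> and
  \<open>x - t h\<close>; a second application reaches a second derivative at distance at most
  \<open>1\<close> from \<open>x\<close>. There the weight costs \<open>2 powr p\<close>, and the
  other factor \<open>2\<close> comes from the increment \<open>2 t h\<close>.\<close>

lemma admissible_of_second_deriv:
  assumes d: "twice_diff g g' g''" and g: "\<And>x. \<bar>g x\<bar> \<le> A * wt p x"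
    and g'': "\<And>x v k. \<bar>g'' x v k\<bar> \<le> A * norm v * norm k * wt p x" and A: "A \<ge> 0"
  shows "admissible (2 * 2 powr p * A) g"
  unfolding admissible_def
proof (intro conjI allI impI)
  have "continuous_on UNIV g"
    using d unfolding twice_diff_def by (meson continuous_at_imp_continuous_on has_derivative_continuous)
  then show "g \<in> borel_measurable borel" by (rule borel_measurable_continuous_onI)
  have c: "1 \<le> 2 * 2 powr p" using ge_one_powr_ge_zero[of 2 p] by simp
  show "\<bar>g x\<bar> \<le> 2 * 2 powr p * A * wt p x" for x
  proof -
    have "1 * (A * wt p x) \<le> (2 * 2 powr p) * (A * wt p x)" using c A by (intro mult_right_mono) auto
    then show ?thesis using g[of x] by (simp add: mult_ac)
  qed
  fix x h :: 'a assume h: "norm h \<le> 1"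
  define k where "k t = g (x + t *\<^sub>R h) + g (x - t *\<^sub>R h)" for t :: real
  have d1: "((\<lambda>y. g y + g (2 *\<^sub>R x - y)) has_derivative (\<lambda>v. g' y v + g' (2 *\<^sub>R x - y) (- v))) (at y)" for y
  proof (rule has_derivative_add)
    show "(g has_derivative g' y) (at y)" using d by (simp add: twice_diff_def)
    show "((\<lambda>y. g (2 *\<^sub>R x - y)) has_derivative (\<lambda>v. g' (2 *\<^sub>R x - y) (- v))) (at y)"
      by (rule has_derivative_compose[where f="\<lambda>y. 2 *\<^sub>R x - y" and g=g])
        (use d in \<open>auto simp: twice_diff_def intro!: derivative_eq_intros\<close>)
  qed
  obtain t where t: "0 < t" "t < 1" "(g (x + h) + g (2 *\<^sub>R x - (x + h))) - (g x + g (2 *\<^sub>R x - x)) =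
      g' (x + t *\<^sub>R h) h + g' (2 *\<^sub>R x - (x + t *\<^sub>R h)) (- h)"
    by (rule mvt_line[of "\<lambda>y. g y + g (2 *\<^sub>R x - y)" "\<lambda>y v. g' y v + g' (2 *\<^sub>R x - y) (- v)" x h, OF d1])
  have lin: "g' y (- h) = - g' y h" for y
    using d by (intro linear_neg bounded_linear.linear has_derivative_bounded_linear[of g _ "at y"]) (simp add: twice_diff_def)
  have S: "second_diff g x h = g' (x + t *\<^sub>R h) h - g' (x - t *\<^sub>R h) h"
    using t(3) by (simp add: lin second_diff_def algebra_simps scaleR_2)
  obtain t' where t': "0 < t'" "t' < 1" "g' ((x - t *\<^sub>R h) + (2 * t) *\<^sub>R h) h - g' (x - t *\<^sub>R h) h = g'' ((x - t *\<^sub>R h) + t' *\<^sub>R ((2 * t) *\<^sub>R h)) h ((2 * t) *\<^sub>R h)"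
    by (rule mvt_line[of "\<lambda>y. g' y h" "\<lambda>y. g'' y h" "x - t *\<^sub>R h" "(2 * t) *\<^sub>R h"]) (use d in \<open>auto simp: twice_diff_def\<close>)
  define e where "e = (t' * (2 * t) - t) *\<^sub>R h"
  have e: "(x - t *\<^sub>R h) + t' *\<^sub>R ((2 * t) *\<^sub>R h) = x + e" by (simp add: e_def algebra_simps)
  have S2: "second_diff g x h = g'' (x + e) h ((2 * t) *\<^sub>R h)"
  proof -
    have "(2 * t) *\<^sub>R h = t *\<^sub>R h + t *\<^sub>R h" by (simp flip: scaleR_add_left)
    then have z: "(x - t *\<^sub>R h) + (2 * t) *\<^sub>R h = x + t *\<^sub>R h" by simp
    show ?thesis using t'(3) unfolding S z e .
  qed
  have ne: "norm e \<le> 1"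
  proof -
    have "0 \<le> t' * (2 * t)" "t' * (2 * t) \<le> 1 * (2 * t)" using t t' by (auto intro!: mult_right_mono)
    then have "\<bar>t' * (2 * t) - t\<bar> \<le> 1" using t by linarith
    then have "\<bar>t' * (2 * t) - t\<bar> * norm h \<le> 1 * 1" using h by (intro mult_mono) auto
    then show ?thesis by (simp add: e_def)
  qed
  have "\<bar>second_diff g x h\<bar> \<le> A * norm h * norm ((2 * t) *\<^sub>R h) * wt p (x + e)" unfolding S2 by (rule g'')
  also have "\<dots> \<le> A * norm h * (2 * norm h) * (2 powr p * wt p x)"
    using A t by (intro mult_mono wt_shift ne) (auto simp: mult_left_le_one_le)
  finally show "\<bar>second_diff g x h\<bar> \<le> 2 * 2 powr p * A * (norm h)\<^sup>2 * wt p x" by (simp add: power2_eq_square mult_ac)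
qed

text \<open>The bounds with \<open>(norm x)\<^sup>2\<close> and \<open>norm x\<close> are what a
  cut-off with derivatives of order \<open>1 / norm x\<close> and
  \<open>1 / (norm x)\<^sup>2\<close> consumes. The plain decay bound is kept beside them because
  the quadratic one is weaker at infinity.\<close>

definition flat_at_0 :: "real \<Rightarrow> ('a \<Rightarrow> real) \<Rightarrow> ('a \<Rightarrow> 'a \<Rightarrow> real) \<Rightarrow> ('a \<Rightarrow> 'a \<Rightarrow> 'a \<Rightarrow> real) \<Rightarrow> bool" where
  "flat_at_0 A g g' g'' \<longleftrightarrow> 0 \<le> A \<and> twice_diff g g' g'' \<and> (\<forall>x. \<bar>g x\<bar> \<le> A * wt p x) \<and> (\<forall>x. \<bar>g x\<bar> \<le> A * (norm x)\<^sup>2 * wt p x)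
     \<and> (\<forall>x v. \<bar>g' x v\<bar> \<le> A * norm x * norm v * wt p x) \<and> (\<forall>x v k. \<bar>g'' x v k\<bar> \<le> A * norm v * norm k * wt p x)"

lemma flat_admissible: "flat_at_0 A g g' g'' \<Longrightarrow> admissible (2 * 2 powr p * A) g"
  by (rule admissible_of_second_deriv) (auto simp: flat_at_0_def)

text \<open>Since \<open>p \<ge> 1\<close>, the product \<open>norm z * wt p z\<close> is at most
  \<open>1\<close>, so the gradient bound is globally at most \<open>A\<close>.\<close>

lemma flat_at_0_lipschitz:
  assumes "flat_at_0 A g g' g''"
  shows "\<bar>g x - g y\<bar> \<le> A * norm (x - y)"
proof -
  obtain t where t: "g (y + (x - y)) - g y = g' (y + t *\<^sub>R (x - y)) (x - y)"
    by (rule mvt_line[of g g' y "x - y"]) (use assms in \<open>auto simp: flat_at_0_def twice_diff_def\<close>)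
  let ?z = "y + t *\<^sub>R (x - y)"
  have A: "A \<ge> 0" using assms by (simp add: flat_at_0_def)
  have "norm ?z * wt p ?z \<le> 1"
  proof -
    have "1 \<le> p" using p_gt DIM_positive[where 'a='a] by linarith
    then have "wt p ?z \<le> (1 + norm ?z) powr -1" unfolding wt_def by (intro powr_mono) auto
    then have "norm ?z * wt p ?z \<le> norm ?z * (1 + norm ?z) powr -1" by (intro mult_left_mono) auto
    also have "\<dots> \<le> 1" by (simp add: powr_minus divide_simps add_pos_nonneg)
    finally show ?thesis .
  qed
  then have "A * norm (x - y) * (norm ?z * wt p ?z) \<le> A * norm (x - y) * 1" using A by (intro mult_left_mono) auto
  moreover have "\<bar>g' ?z (x - y)\<bar> \<le> A * norm ?z * norm (x - y) * wt p ?z" using assms by (auto simp: flat_at_0_def)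
  ultimately show ?thesis using t by (simp add: mult_ac)
qed

text \<open>In the unit ball the extra powers of \<open>norm x\<close> come from the mean value
  theorem starting at \<open>0\<close>, at the price of \<open>2 powr p\<close> for reinstating the
  weight; outside it those powers are at least \<open>1\<close>.\<close>

lemma flat_at_0_of_vanishing:
  assumes d: "twice_diff g g' g''" and A: "0 \<le> A" and g: "\<And>x. \<bar>g x\<bar> \<le> A * wt p x" "\<And>x v. \<bar>g' x v\<bar> \<le> A * norm v * wt p x"
    "\<And>x v k. \<bar>g'' x v k\<bar> \<le> A * norm v * norm k * wt p x"
    and z: "g 0 = 0" "\<And>v. g' 0 v = 0"
  shows "flat_at_0 (2 powr p * A) g g' g''"
proof -
  let ?c = "2 powr p"
  have c: "1 \<le> ?c" using ge_one_powr_ge_zero[of 2 p] by simp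
  have up: "a \<le> ?c * A * b" if "a \<le> A * b" "0 \<le> b" for a b
  proof -
    have "1 * (A * b) \<le> ?c * (A * b)" using c A that by (intro mult_right_mono) auto
    then show ?thesis using that by (simp add: mult_ac)
  qed
  have w1: "1 \<le> ?c * wt p x" if "norm x \<le> 1" for x :: 'a
    using wt_shift[of p "-x" x] that by (simp add: wt_def)
  have b1': "\<bar>g' x v\<bar> \<le> A * norm x * norm v" for x v
  proof -
    obtain t where t: "0 < t" "t < 1" "g' (0 + x) v - g' 0 v = g'' (0 + t *\<^sub>R x) v x"
      by (rule mvt_line[of "\<lambda>y. g' y v" "\<lambda>y. g'' y v" 0 x]) (use d in \<open>auto simp: twice_diff_def\<close>)
    have "\<bar>g'' (t *\<^sub>R x) v x\<bar> \<le> A * norm v * norm x * wt p (t *\<^sub>R x)" by (rule g(3))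
    also have "\<dots> \<le> A * norm v * norm x * 1" using A by (intro mult_left_mono wt_le_1) auto
    finally show ?thesis using t z by (simp add: mult_ac)
  qed
  have b1: "\<bar>g' x v\<bar> \<le> ?c * A * norm x * norm v * wt p x" for x v
  proof (cases "norm x \<le> 1")
    case True
    have "A * norm x * norm v * 1 \<le> A * norm x * norm v * (?c * wt p x)" using A w1[OF True] by (intro mult_left_mono) auto
    then show ?thesis using b1'[of x v] by (simp add: mult_ac)
  next
    case False
    have "A * norm v * wt p x * 1 \<le> A * norm v * wt p x * norm x" using A False by (intro mult_left_mono) auto
    then have "\<bar>g' x v\<bar> \<le> A * (norm x * norm v * wt p x)" using g(2)[of x v] by (simp add: mult_ac)
    then show ?thesis using up[of "\<bar>g' x v\<bar>" "norm x * norm v * wt p x"] by (simp add: mult_ac)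
  qed
  have b0: "\<bar>g x\<bar> \<le> ?c * A * (norm x)\<^sup>2 * wt p x" for x
  proof (cases "norm x \<le> 1")
    case True
    obtain t where t: "0 < t" "t < 1" "g (0 + x) - g 0 = g' (0 + t *\<^sub>R x) x"
      by (rule mvt_line[of g g' 0 x]) (use d in \<open>auto simp: twice_diff_def\<close>)
    have "\<bar>g x\<bar> \<le> A * norm (t *\<^sub>R x) * norm x" using b1'[of "t *\<^sub>R x" x] t z by simp
    also have "\<dots> \<le> A * norm x * norm x"
      using A t by (intro mult_right_mono mult_left_mono) (auto simp: mult_left_le_one_le)
    also have "\<dots> \<le> A * norm x * norm x * (?c * wt p x)" using A mult_left_mono[OF w1[OF True], of "A * norm x * norm x"] by simp
    finally show ?thesis by (simp add: mult_ac power2_eq_square)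
  next
    case False
    have "A * wt p x * 1 \<le> A * wt p x * (norm x)\<^sup>2" using A False by (intro mult_left_mono) (auto simp: one_le_power)
    then have "\<bar>g x\<bar> \<le> A * ((norm x)\<^sup>2 * wt p x)" using g(1)[of x] by (simp add: mult_ac)
    then show ?thesis using up[of "\<bar>g x\<bar>" "(norm x)\<^sup>2 * wt p x"] by (simp add: mult_ac)
  qed
  have b2: "\<bar>g'' x v k\<bar> \<le> ?c * A * (norm v * norm k * wt p x)" for x v k
    by (rule up) (use g(3)[of x v k] in \<open>simp_all add: mult.assoc\<close>)
  show ?thesis
    unfolding flat_at_0_def using A d b0 b1 up[OF g(1)] b2 by (auto simp: mult.assoc)
qed

text \<open>Each derivative that falls on the cut-off costs \<open>1 / norm x\<close>, and
  \<open>g\<close> or its gradient supplies the missing power. The four terms of \<open>f''\<close>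
  contribute \<open>1 + 2 + 2 + 6 = 11\<close> times \<open>M * A\<close>, independently of
  \<open>l\<close>.\<close>

lemma flat_at_0_cutoff:
  assumes q: "flat_at_0 A g g' g''" and c: "cutoff M \<rho> \<rho>1 \<rho>2" and l: "l > 0"
  shows "\<exists>f' f''. flat_at_0 (11 * M * A) (\<lambda>x. \<rho> (l * (x \<bullet> x)) * g x) f' f''"
proof -
  let ?q = "\<lambda>x::'a. l * (x \<bullet> x)"
  define th where "th x = \<rho> (?q x)" for x
  define th1 where "th1 x v = \<rho>1 (?q x) * (2 * l * (x \<bullet> v))" for x v
  define th2 where "th2 x v k = \<rho>2 (?q x) * (2 * l * (x \<bullet> k)) * (2 * l * (x \<bullet> v)) + \<rho>1 (?q x) * (2 * l * (k \<bullet> v))" for x v k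
  have A: "A \<ge> 0" and td: "twice_diff g g' g''" using q by (auto simp: flat_at_0_def)
  have M: "M \<ge> 0" using c unfolding cutoff_def by (meson abs_ge_zero order_trans)
  have dq: "(?q has_derivative (\<lambda>v. 2 * l * (x \<bullet> v))) (at x)" for x :: 'a
    by (auto intro!: derivative_eq_intros simp: inner_commute)
  have R: "DERIV \<rho> q :> \<rho>1 q" "DERIV \<rho>1 q :> \<rho>2 q" "\<bar>\<rho> q\<bar> \<le> M" "\<bar>\<rho>1 q * q\<bar> \<le> M" "\<bar>\<rho>2 q * q\<^sup>2\<bar> \<le> M" for q
    using c by (auto simp: cutoff_def)
  have dth: "(th has_derivative th1 x) (at x)" for x
    using has_derivative_compose[OF dq[of x] R(1)[unfolded has_field_derivative_def]] unfolding th_def[abs_def] th1_def[abs_def] .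
  have dth1: "((\<lambda>x. th1 x v) has_derivative th2 x v) (at x)" for x v
  proof -
    have "((\<lambda>x. \<rho>1 (?q x)) has_derivative (\<lambda>k. \<rho>2 (?q x) * (2 * l * (x \<bullet> k)))) (at x)"
      using has_derivative_compose[OF dq[of x] R(2)[unfolded has_field_derivative_def]] .
    moreover have "((\<lambda>x. 2 * l * (x \<bullet> v)) has_derivative (\<lambda>k. 2 * l * (k \<bullet> v))) (at x)"
      by (auto intro!: derivative_eq_intros)
    ultimately show ?thesis unfolding th1_def
      by (rule has_derivative_eq_rhs[OF has_derivative_mult]) (auto simp: th2_def algebra_simps)
  qed
  have dg: "(g has_derivative g' x) (at x)" "((\<lambda>x. g' x v) has_derivative g'' x v) (at x)" for x v
    using td by (auto simp: twice_diff_def)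
  define f' where "f' x v = th x * g' x v + th1 x v * g x" for x v
  define f'' where "f'' x v k = th x * g'' x v k + th1 x k * g' x v + (th1 x v * g' x k + th2 x v k * g x)" for x v k
  have D1: "((\<lambda>x. th x * g x) has_derivative f' x) (at x)" for x
    unfolding f'_def[abs_def] by (rule has_derivative_mult[OF dth dg(1)])
  have D2: "((\<lambda>x. f' x v) has_derivative f'' x v) (at x)" for x v
    unfolding f'_def f''_def[abs_def]
    by (intro has_derivative_add has_derivative_mult dth dth1 dg)
  have nx: "(norm x)\<^sup>2 * l = ?q x" for x by (simp add: power2_norm_eq_inner)
  have t1: "norm x * \<bar>th1 x v\<bar> \<le> 2 * M * norm v" for x v
  proof -
    have "norm x * \<bar>th1 x v\<bar> = \<bar>\<rho>1 (?q x)\<bar> * (2 * l) * (norm x * \<bar>x \<bullet> v\<bar>)" using l by (simp add: th1_def abs_mult)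
    also have "\<dots> \<le> \<bar>\<rho>1 (?q x)\<bar> * (2 * l) * (norm x * (norm x * norm v))"
      using l by (intro mult_left_mono Cauchy_Schwarz_ineq2) auto
    also have "\<dots> = 2 * \<bar>\<rho>1 (?q x) * ?q x\<bar> * norm v" using l by (simp add: abs_mult nx[symmetric] power2_eq_square)
    also have "\<dots> \<le> 2 * M * norm v" using R(4) by (intro mult_right_mono) auto
    finally show ?thesis .
  qed
  have t2: "(norm x)\<^sup>2 * \<bar>th2 x v k\<bar> \<le> 6 * M * norm v * norm k" for x v k
  proof -
    have "(norm x)\<^sup>2 * \<bar>th2 x v k\<bar> \<le> (norm x)\<^sup>2 * (\<bar>\<rho>2 (?q x)\<bar> * (2 * l * (norm x * norm k)) * (2 * l * (norm x * norm v)) + \<bar>\<rho>1 (?q x)\<bar> * (2 * l * (norm k * norm v)))"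
    proof (intro mult_left_mono)
      have "\<bar>th2 x v k\<bar> \<le> \<bar>\<rho>2 (?q x) * (2 * l * (x \<bullet> k)) * (2 * l * (x \<bullet> v))\<bar> + \<bar>\<rho>1 (?q x) * (2 * l * (k \<bullet> v))\<bar>"
        unfolding th2_def by (rule abs_triangle_ineq)
      also have "\<dots> = \<bar>\<rho>2 (?q x)\<bar> * (2 * l * \<bar>x \<bullet> k\<bar>) * (2 * l * \<bar>x \<bullet> v\<bar>) + \<bar>\<rho>1 (?q x)\<bar> * (2 * l * \<bar>k \<bullet> v\<bar>)"
        using l by (simp add: abs_mult)
      also have "\<dots> \<le> \<bar>\<rho>2 (?q x)\<bar> * (2 * l * (norm x * norm k)) * (2 * l * (norm x * norm v)) + \<bar>\<rho>1 (?q x)\<bar> * (2 * l * (norm k * norm v))"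
        using l by (intro add_mono mult_mono[of _ _ "2 * l * _"] mult_left_mono Cauchy_Schwarz_ineq2) auto
      finally show "\<bar>th2 x v k\<bar> \<le> \<bar>\<rho>2 (?q x)\<bar> * (2 * l * (norm x * norm k)) * (2 * l * (norm x * norm v)) + \<bar>\<rho>1 (?q x)\<bar> * (2 * l * (norm k * norm v))" .
    qed auto
    also have "\<dots> = (4 * \<bar>\<rho>2 (?q x) * (?q x)\<^sup>2\<bar> + 2 * \<bar>\<rho>1 (?q x) * ?q x\<bar>) * (norm v * norm k)"
      using l by (simp add: abs_mult nx[symmetric] power2_eq_square algebra_simps)
    also have "\<dots> \<le> (4 * M + 2 * M) * (norm v * norm k)"
      using R(4,5)[of "?q x"] by (intro mult_right_mono add_mono) auto
    finally show ?thesis by (simp add: algebra_simps)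
  qed
  have G: "\<bar>g x\<bar> \<le> A * wt p x" "\<bar>g x\<bar> \<le> A * (norm x)\<^sup>2 * wt p x" "\<bar>g' x v\<bar> \<le> A * norm x * norm v * wt p x"
    "\<bar>g'' x v k\<bar> \<le> A * norm v * norm k * wt p x" for x v k using q by (auto simp: flat_at_0_def)
  have MA: "a \<le> 11 * M * A * b" if "a \<le> c * (M * A * b)" "c \<le> 11" "0 \<le> b" for a b c
  proof -
    have "c * (M * A * b) \<le> 11 * (M * A * b)" using that M A by (intro mult_right_mono) auto
    then show ?thesis using that by simp
  qed
  have thM: "\<bar>th x\<bar> \<le> M" for x using R(3) by (simp add: th_def)
  have B0: "\<bar>th x * g x\<bar> \<le> 11 * M * A * wt p x" for x
  proof (rule MA[of _ 1])
    have "\<bar>th x * g x\<bar> \<le> M * (A * wt p x)" unfolding abs_mult using M by (intro mult_mono G thM) auto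
    then show "\<bar>th x * g x\<bar> \<le> 1 * (M * A * wt p x)" by (simp add: mult_ac)
  qed auto
  have B00: "\<bar>th x * g x\<bar> \<le> 11 * M * A * ((norm x)\<^sup>2 * wt p x)" for x
  proof (rule MA[of _ 1])
    have "\<bar>th x * g x\<bar> \<le> M * (A * (norm x)\<^sup>2 * wt p x)" unfolding abs_mult using M by (intro mult_mono G thM) auto
    then show "\<bar>th x * g x\<bar> \<le> 1 * (M * A * ((norm x)\<^sup>2 * wt p x))" by (simp add: mult_ac)
  qed auto
  have B1: "\<bar>f' x v\<bar> \<le> 11 * M * A * (norm x * norm v * wt p x)" for x v
  proof (rule MA[of _ 3])
    have "\<bar>f' x v\<bar> \<le> \<bar>th x\<bar> * \<bar>g' x v\<bar> + \<bar>th1 x v\<bar> * \<bar>g x\<bar>" by (simp add: f'_def abs_mult[symmetric])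
    also have "\<dots> \<le> M * (A * norm x * norm v * wt p x) + \<bar>th1 x v\<bar> * (A * (norm x)\<^sup>2 * wt p x)"
      using M by (intro add_mono mult_mono G thM) auto
    also have "\<bar>th1 x v\<bar> * (A * (norm x)\<^sup>2 * wt p x) = (norm x * \<bar>th1 x v\<bar>) * (A * norm x * wt p x)" by (simp add: power2_eq_square)
    also have "\<dots> \<le> (2 * M * norm v) * (A * norm x * wt p x)" using A by (intro mult_right_mono t1) auto
    finally show "\<bar>f' x v\<bar> \<le> 3 * (M * A * (norm x * norm v * wt p x))" by (simp add: algebra_simps)
  qed auto
  have B2: "\<bar>f'' x v k\<bar> \<le> 11 * M * A * (norm v * norm k * wt p x)" for x v k
  proof (rule MA[of _ 11])
    have "\<bar>f'' x v k\<bar> \<le> \<bar>th x * g'' x v k\<bar> + \<bar>th1 x k * g' x v\<bar> + (\<bar>th1 x v * g' x k\<bar> + \<bar>th2 x v k * g x\<bar>)"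
      unfolding f''_def by linarith
    also have "\<dots> \<le> M * (A * norm v * norm k * wt p x) + \<bar>th1 x k\<bar> * (A * norm x * norm v * wt p x) +
       (\<bar>th1 x v\<bar> * (A * norm x * norm k * wt p x) + \<bar>th2 x v k\<bar> * (A * (norm x)\<^sup>2 * wt p x))"
      unfolding abs_mult using M by (intro add_mono mult_mono G thM) auto
    also have "\<bar>th1 x k\<bar> * (A * norm x * norm v * wt p x) = (norm x * \<bar>th1 x k\<bar>) * (A * norm v * wt p x)" by simp
    also have "\<bar>th1 x v\<bar> * (A * norm x * norm k * wt p x) = (norm x * \<bar>th1 x v\<bar>) * (A * norm k * wt p x)" by simp
    also have "\<bar>th2 x v k\<bar> * (A * (norm x)\<^sup>2 * wt p x) = ((norm x)\<^sup>2 * \<bar>th2 x v k\<bar>) * (A * wt p x)" by simp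
    also have "M * (A * norm v * norm k * wt p x) + (norm x * \<bar>th1 x k\<bar>) * (A * norm v * wt p x) + ((norm x * \<bar>th1 x v\<bar>) * (A * norm k * wt p x) + ((norm x)\<^sup>2 * \<bar>th2 x v k\<bar>) * (A * wt p x))
      \<le> M * (A * norm v * norm k * wt p x) + (2 * M * norm k) * (A * norm v * wt p x) + ((2 * M * norm v) * (A * norm k * wt p x) + (6 * M * norm v * norm k) * (A * wt p x))"
      using A by (intro add_mono mult_right_mono t1 t2 order_refl) auto
    finally show "\<bar>f'' x v k\<bar> \<le> 11 * (M * A * (norm v * norm k * wt p x))" by (simp add: algebra_simps)
  qed auto
  have "flat_at_0 (11 * M * A) (\<lambda>x. th x * g x) f' f''"
    unfolding flat_at_0_def twice_diff_def using A M D1 D2 B0 B00 B1 B2 by (auto simp: mult.assoc)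
  then show ?thesis unfolding th_def by blast
qed

end

locale harmonic_off_0 = tail_fun s p ty u for s p and ty :: "'a::euclidean_space itself" and u +
  assumes weak: "weak_sol s (UNIV - {0}) u"
begin

lemma pairing_test_fun:
  assumes test: "test_fun (UNIV - {0}) \<phi>" and q: "flat_at_0 A \<phi> \<phi>' \<phi>''"
    and r: "0 < r1" "\<And>x. \<phi> x \<noteq> 0 \<Longrightarrow> r1 \<le> norm x \<and> norm x \<le> r2"
  shows "pairing \<phi> = 0"
proof -
  note admissible = flat_admissible[OF q]
  note [measurable] = admissible_measurable[OF admissible]
  define G where "G = {x::'a. r1/2 < norm x \<and> norm x < r2 + 1}"
  have "G = {x. r1/2 < norm x} \<inter> {x. norm x < r2 + 1}" unfolding G_def by auto
  then have oG: "open G" by (auto intro!: open_Int open_Collect_less continuous_intros)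
  then have [measurable]: "G \<in> sets borel" by simp
  have cG: "closure G \<subseteq> {x. r1/2 \<le> norm x \<and> norm x \<le> r2 + 1}"
  proof (rule closure_minimal)
    show "G \<subseteq> {x. r1/2 \<le> norm x \<and> norm x \<le> r2 + 1}" by (auto simp: G_def)
    have "{x::'a. r1/2 \<le> norm x \<and> norm x \<le> r2 + 1} = {x. r1/2 \<le> norm x} \<inter> {x. norm x \<le> r2 + 1}" by auto
    then show "closed {x::'a. r1/2 \<le> norm x \<and> norm x \<le> r2 + 1}"
      by (auto intro!: closed_Int closed_Collect_le continuous_intros)
  qed
  have "compact (closure G)"
    unfolding compact_closure by (rule bounded_subset[of "cball 0 (r2 + 1)"]) (auto simp: G_def)
  moreover have "closure G \<subseteq> UNIV - {0}" using cG r(1) by auto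
  ultimately have W: "Wsp s G u" using weak oG by (auto simp: weak_sol_def Wsp_loc_def)
  have fin: "(\<integral>\<^sup>+ x. \<integral>\<^sup>+ y. indicator G x * indicator G y * ennreal ((u x - u y)\<^sup>2 * norm (x - y) powr -p) \<partial>lborel \<partial>lborel) < \<infinity>"
  proof -
    have e: "norm z powr -p = inverse (norm z powr (real DIM('a) + 2 * s))" for z :: 'a by (simp only: p_eq powr_minus)
    have "(\<integral>\<^sup>+ x. \<integral>\<^sup>+ y. indicator G x * indicator G y * ennreal ((u x - u y)\<^sup>2 * norm (x - y) powr -p) \<partial>lborel \<partial>lborel) =
      (\<integral>\<^sup>+ x. \<integral>\<^sup>+ y. indicator G x * indicator G y * ennreal ((u x - u y)\<^sup>2 / norm (x - y) powr (real DIM('a) + 2 * s)) \<partial>lebesgue \<partial>lebesgue)"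
      unfolding nn_integral_completion e divide_inverse ..
    then show ?thesis using W by (simp add: Wsp_def)
  qed
  have int: "integrable (lborel \<Otimes>\<^sub>M lborel) (\<lambda>(x, y). (u x - u y) * (\<phi> x - \<phi> y) * norm (x - y) powr -p)"
    by (rule energy_integrable[OF admissible flat_at_0_lipschitz[OF q] r(1) r(2) G_def fin])
  define c where "c = 2 powr (2 * s - 1) * Gamma (real DIM('a) / 2 + s) / (pi powr (real DIM('a) / 2) * \<bar>Gamma (- s)\<bar>)"
  \<comment> \<open>At a pole \<open>Gamma\<close> takes the default value \<open>0\<close>, so
    \<open>-s\<close> has to stay off the nonpositive integers; it lies strictly between
    \<open>-1\<close> and \<open>0\<close>.\<close>
  have "c \<noteq> 0"
  proof -
    have "- s \<notin> \<int>\<^sub>\<le>\<^sub>0"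
    proof
      assume "- s \<in> \<int>\<^sub>\<le>\<^sub>0"
      then obtain n where "- s = - of_nat n" by (auto elim!: nonpos_Ints_cases')
      then show False using s by (cases n) auto
    qed
    then have "Gamma (- s) \<noteq> 0" by (simp add: Gamma_eq_zero_iff)
    moreover have "Gamma (real DIM('a) / 2 + s) > 0" using s by (intro Gamma_real_pos) (auto intro: add_nonneg_pos)
    ultimately show ?thesis by (auto simp: c_def)
  qed
  have "frac_energy s u \<phi> = (\<integral>x. (\<integral>y. (u x - u y) * (\<phi> x - \<phi> y) * frac_kernel s x y \<partial>lborel) \<partial>lborel)"
  proof -
    have [measurable]: "(\<lambda>(x, y). frac_kernel s x y) \<in> borel_measurable (borel \<Otimes>\<^sub>M (borel :: 'a measure))"
      unfolding frac_kernel_def by measurable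
    have i: "(\<integral>y. (u x - u y) * (\<phi> x - \<phi> y) * frac_kernel s x y \<partial>lebesgue) = (\<integral>y. (u x - u y) * (\<phi> x - \<phi> y) * frac_kernel s x y \<partial>lborel)" for x
      by (rule integral_completion) measurable
    show ?thesis unfolding frac_energy_def i by (rule integral_completion) measurable
  qed
  also have "\<dots> = (\<integral>x. (\<integral>y. c * ((u x - u y) * (\<phi> x - \<phi> y) * norm (x - y) powr -p) \<partial>lborel) \<partial>lborel)"
    by (intro Bochner_Integration.integral_cong refl) (simp add: frac_kernel_def c_def p_eq)
  also have "\<dots> = c * - pairing \<phi>" using energy_eq_pairing[OF admissible int] by simp
  finally have "c * - pairing \<phi> = 0" using weak test by (simp add: weak_sol_def)
  then show ?thesis using \<open>c \<noteq> 0\<close> by simp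
qed

text \<open>The double cut-off has constants independent of \<open>k\<close>, so all
  \<open>f k\<close> lie in one admissible class and \<open>pairing_tendsto\<close> applies. For a
  function that does not vanish to second order the inner cut-off would in general destroy this
  uniform bound.\<close>

lemma pairing_flat_at_0:
  assumes q: "flat_at_0 A g g' g''" and sm: "smooth_fun g"
  shows "pairing g = 0"
proof -
  obtain \<rho> \<rho>1 \<rho>2 :: "real \<Rightarrow> real" and M where r: "smooth_fun \<rho>" "\<And>q. q \<le> 1 \<Longrightarrow> \<rho> q = 0" "\<And>q. q \<ge> 3 \<Longrightarrow> \<rho> q = 1"
    "cutoff M \<rho> \<rho>1 \<rho>2" by (rule cutoff_exists) blast
  define K where "K k = (real (Suc k))\<^sup>2" for k
  have K: "K k > 0" for k by (simp add: K_def)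
  \<comment> \<open>The factor with \<open>K k\<close> removes the ball of radius
    \<open>1 / (k + 1)\<close>, the one with \<open>inverse (K k)\<close> everything beyond radius
    \<open>2 * (k + 1)\<close>; the square in \<open>K\<close> appears because the cut-off acts on
    \<open>x \<bullet> x\<close>.\<close>
  define f where "f k x = (1 - \<rho> (inverse (K k) * (x \<bullet> x))) * (\<rho> (K k * (x \<bullet> x)) * g x)" for k and x :: 'a
  define B where "B = 11 * (1 + M) * (11 * M * A)"
  have fq: "\<exists>f' f''. flat_at_0 B (f k) f' f''" for k
  proof -
    obtain h' h'' where h: "flat_at_0 (11 * M * A) (\<lambda>x. \<rho> (K k * (x \<bullet> x)) * g x) h' h''"
      using flat_at_0_cutoff[OF q r(4) K] by blast
    have "inverse (K k) > 0" using K by simp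
    from flat_at_0_cutoff[OF h cutoff_one_minus[OF r(4)] this] show ?thesis unfolding f_def B_def .
  qed
  have fs: "smooth_fun (f k)" for k
  proof -
    have "f k = (\<lambda>x. (1 + (-1) * \<rho> (inverse (K k) * (x \<bullet> x))) * (\<rho> (K k * (x \<bullet> x)) * g x))" by (auto simp: f_def)
    moreover have "smooth_fun \<dots>"
      by (intro smooth_fun_mult smooth_fun_add smooth_fun_const sm smooth_fun_compose[OF r(1)] smooth_fun_inner_self)
    ultimately show ?thesis by simp
  qed
  have fsupp: "inverse (real (Suc k)) \<le> norm x \<and> norm x \<le> 2 * real (Suc k)" if "f k x \<noteq> 0" for k x
  proof -
    have 1: "K k * (x \<bullet> x) > 1" using that r(2)[of "K k * (x \<bullet> x)"] by (force simp: f_def)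
    have 2: "inverse (K k) * (x \<bullet> x) < 3" using that r(3)[of "inverse (K k) * (x \<bullet> x)"] by (force simp: f_def)
    have "(inverse (real (Suc k)))\<^sup>2 \<le> (norm x)\<^sup>2"
      using 1 K[of k] by (simp add: power2_norm_eq_inner K_def field_simps power_divide)
    moreover have "(norm x)\<^sup>2 \<le> (2 * real (Suc k))\<^sup>2"
    proof -
      have "x \<bullet> x < 3 * K k" using 2 K[of k] by (simp add: field_simps)
      moreover have "(2 * real (Suc k))\<^sup>2 = 4 * K k" unfolding K_def by (simp only: power_mult_distrib) simp
      ultimately show ?thesis using K[of k] by (simp only: power2_norm_eq_inner)
    qed
    ultimately show ?thesis by (auto dest!: power2_le_imp_le)
  qed
  have test: "test_fun (UNIV - {0}) (f k)" for k
  proof -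
    let ?S = "{x. f k x \<noteq> 0}"
    have c: "closure ?S \<subseteq> {x. inverse (real (Suc k)) \<le> norm x}"
      by (rule closure_minimal) (use fsupp in \<open>auto intro!: closed_Collect_le continuous_intros\<close>)
    have "bounded ?S" by (rule bounded_subset[of "cball 0 (2 * real (Suc k))"]) (use fsupp in auto)
    then have "compact (closure ?S)" by (simp add: compact_closure)
    moreover have "closure ?S \<subseteq> UNIV - {0}" using c by auto
    ultimately show ?thesis using fs by (simp add: test_fun_def)
  qed
  have Tf: "pairing (f k) = 0" for k
    using fq[of k] pairing_test_fun[OF test[of k] _ _ fsupp] by (metis inverse_positive_iff_positive of_nat_0_less_iff zero_less_Suc)
  have "(\<lambda>k. pairing (f k)) \<longlonglongrightarrow> pairing g"
  proof (rule pairing_tendsto)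
    show "admissible (2 * 2 powr p * B) (f k)" for k using fq[of k] flat_admissible by blast
    show "g \<in> borel_measurable borel" using admissible_measurable[OF flat_admissible[OF q]] .
    fix x
    show "(\<lambda>k. f k x) \<longlonglongrightarrow> g x"
    proof (cases "x = 0")
      case True
      have "g 0 = 0" using q unfolding flat_at_0_def by (metis abs_le_zero_iff mult_zero_left mult_zero_right norm_zero zero_power2)
      then show ?thesis using True by (simp add: f_def)
    next
      case False
      then have xx: "x \<bullet> x > 0" by simp
      have Kt: "filterlim K at_top sequentially"
        unfolding K_def by (intro filterlim_pow_at_top filterlim_compose[OF filterlim_real_sequentially filterlim_Suc]) auto
      have "eventually (\<lambda>k. K k \<ge> max (3 / (x \<bullet> x)) (x \<bullet> x)) sequentially" using Kt unfolding filterlim_at_top by blast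
      then have "eventually (\<lambda>k. f k x = g x) sequentially"
      proof eventually_elim
        case (elim k)
        have "K k * (x \<bullet> x) \<ge> 3" "inverse (K k) * (x \<bullet> x) \<le> 1" using elim xx K[of k] by (auto simp: field_simps)
        then show ?case using r by (simp add: f_def)
      qed
      then show ?thesis by (rule tendsto_eventually)
    qed
  qed
  then show ?thesis using Tf by (simp add: LIMSEQ_const_iff)
qed

end

section \<open>Inverse-gamma densities\<close>

text \<open>The bound is the exact maximum, taken at \<open>x = a / c\<close>; the inequality
  \<open>ln y \<le> y - 1\<close> at \<open>y = c * x / a\<close> yields it without
  differentiation.\<close>

lemma powr_exp_bound:
  assumes "a \<ge> 0" "c > (0::real)"
  shows "\<exists>B\<ge>0. \<forall>x>0. x powr a * exp (- c * x) \<le> B"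
proof (cases "a = 0")
  case True
  then show ?thesis using assms by (intro exI[of _ 1]) auto
next
  case False
  then have a: "a > 0" using assms by simp
  show ?thesis
  proof (intro exI[of _ "exp (- a + a * ln (a / c))"] conjI allI impI)
    fix x :: real assume x: "x > 0"
    have "ln (c * x / a) \<le> c * x / a - 1" using a assms x by (intro ln_le_minus_one) auto
    then have "a * ln (c * x / a) \<le> a * (c * x / a - 1)" using a by (intro mult_left_mono) auto
    moreover have "ln (c * x / a) = ln x - ln (a / c)" using a assms x by (simp add: ln_div ln_mult)
    ultimately have "a * ln x - c * x \<le> - a + a * ln (a / c)" using a by (simp add: algebra_simps)
    then have "exp (a * ln x - c * x) \<le> exp (- a + a * ln (a / c))" by simp
    then show "x powr a * exp (- c * x) \<le> exp (- a + a * ln (a / c))"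
      using x by (simp add: powr_def exp_diff exp_minus divide_inverse)
  qed auto
qed

text \<open>An unnormalised inverse-gamma density in \<open>r\<close>. With
  \<open>\<alpha> = n/2\<close> and \<open>q = |x|^2\<close> it is the heat kernel at time
  \<open>r\<close> up to a constant, and division by \<open>r\<close> raises \<open>\<alpha>\<close>
  by one.\<close>

definition Theta :: "real \<Rightarrow> real \<Rightarrow> real \<Rightarrow> real" where
  "Theta \<alpha> q r = r powr -\<alpha> * exp (- (q / (4 * r)))"

lemma Theta_nonneg [simp]: "0 \<le> Theta \<alpha> q r" by (simp add: Theta_def)

lemma Theta_measurable [measurable (raw)]:
  assumes [measurable]: "q \<in> borel_measurable M" "r \<in> borel_measurable M"
  shows "(\<lambda>x. Theta \<alpha> (q x) (r x)) \<in> borel_measurable M"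
  unfolding Theta_def by measurable

lemma Theta_le: "q \<ge> 0 \<Longrightarrow> r > 0 \<Longrightarrow> Theta \<alpha> q r \<le> r powr -\<alpha>"
  by (simp add: Theta_def mult_left_le)

lemma Theta_bounded:
  assumes "\<alpha> \<ge> 0" "q > 0"
  shows "\<exists>B\<ge>0. \<forall>r>0. Theta \<alpha> q r \<le> B"
proof -
  have "\<exists>B\<ge>0. \<forall>x>0. x powr \<alpha> * exp (- (q/4) * x) \<le> B"
    by (rule powr_exp_bound) (use assms in auto)
  then obtain B where B: "B \<ge> 0" "\<And>x. x > 0 \<Longrightarrow> x powr \<alpha> * exp (- (q/4) * x) \<le> B" by blast
  show ?thesis
  proof (intro exI[of _ B] conjI allI impI B(1))
    fix r :: real assume "r > 0"
    have 1: "r powr -\<alpha> = inverse r powr \<alpha>" unfolding powr_minus inverse_powr ..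
    have 2: "- (q / (4 * r)) = - (q/4) * inverse r" using \<open>r > 0\<close> by (simp add: field_simps)
    have "inverse r > 0" using \<open>r > 0\<close> by simp
    from B(2)[OF this] show "Theta \<alpha> q r \<le> B" unfolding Theta_def 1 2 .
  qed
qed

lemma Theta_isCont: "r > 0 \<Longrightarrow> isCont (Theta \<alpha> q) r"
  unfolding Theta_def[abs_def] by (intro continuous_intros) auto

lemma Theta_deriv:
  assumes "r > 0"
  shows "DERIV (Theta \<alpha> q) r :> - (\<alpha> * Theta (\<alpha> + 1) q r - q / 4 * Theta (\<alpha> + 2) q r)"
proof -
  have 1: "DERIV (\<lambda>r. r powr -\<alpha>) r :> - \<alpha> * r powr (- \<alpha> - 1)"
    using assms by (rule has_real_derivative_powr)
  have 2: "DERIV (\<lambda>r. exp (- (q / (4 * r)))) r :> exp (- (q / (4 * r))) * (q / (4 * r\<^sup>2))"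
    using assms by (auto intro!: derivative_eq_intros simp: field_simps power2_eq_square)
  have e1: "r powr - (\<alpha> + 1) = r powr (- \<alpha> - 1)" by (rule arg_cong[of _ _ "(powr) r"]) simp
  have "r powr - (\<alpha> + 2) = r powr (- \<alpha> - 2)" by (rule arg_cong[of _ _ "(powr) r"]) simp
  then have e2: "r powr - (\<alpha> + 2) = r powr - \<alpha> / r\<^sup>2" using assms by (simp add: powr_diff powr_numeral)
  show ?thesis unfolding Theta_def[abs_def]
    by (rule DERIV_cong[OF DERIV_mult[OF 1 2]])
       (simp only: e1 e2, simp add: algebra_simps)
qed

lemma integrable_Ioi_bound:
  fixes f :: "real \<Rightarrow> real"
  assumes [measurable]: "f \<in> borel_measurable borel" and a: "a > -1" and b: "b > 1"
    and f1: "\<And>r. 0 < r \<Longrightarrow> r \<le> 1 \<Longrightarrow> \<bar>f r\<bar> \<le> B * r powr a" and f2: "\<And>r. 1 \<le> r \<Longrightarrow> \<bar>f r\<bar> \<le> C * r powr -b"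
  shows "integrable lborel (\<lambda>r. indicator {0<..} r * f r)"
proof (rule Bochner_Integration.integrable_bound)
  show "integrable lborel (\<lambda>r. \<bar>B\<bar> * (indicator {0<..1} r * r powr a) + \<bar>C\<bar> * (indicator {1..} r * r powr -b))"
    using a b by (intro Bochner_Integration.integrable_add integrable_mult_right integrable_powr_Ioc integrable_powr_Ici) auto
  show "AE r in lborel. norm (indicator {0<..} r * f r) \<le> norm (\<bar>B\<bar> * (indicator {0<..1} r * r powr a) + \<bar>C\<bar> * (indicator {1..} r * r powr -b))"
  proof (rule AE_I2)
    fix r :: real
    have B: "B * r powr a \<le> \<bar>B\<bar> * r powr a" by (intro mult_right_mono) auto
    have C: "C * r powr -b \<le> \<bar>C\<bar> * r powr -b" by (intro mult_right_mono) auto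
    let ?R = "\<bar>B\<bar> * (indicator {0<..1} r * r powr a) + \<bar>C\<bar> * (indicator {1..} r * r powr -b)"
    have "norm (indicator {0<..} r * f r) \<le> ?R"
    proof -
      consider "r \<le> 0" | "0 < r" "r < 1" | "1 \<le> r" by linarith
      then show ?thesis
      proof cases
        case 2
        then have "\<bar>f r\<bar> \<le> \<bar>B\<bar> * r powr a" using f1[of r] B by linarith
        then show ?thesis using 2 by simp
      next
        case 3
        then have "\<bar>f r\<bar> \<le> \<bar>C\<bar> * r powr -b" using f2[of r] C by linarith
        moreover have "0 \<le> \<bar>B\<bar> * (indicator {0<..1} r * r powr a)" by simp
        ultimately show ?thesis using 3 by (simp del: mult_nonneg_nonneg)
      qed simp
    qed
    also have "?R \<le> norm ?R" unfolding real_norm_def by (rule abs_ge_self)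
    finally show "norm (indicator {0<..} r * f r) \<le> norm ?R" .
  qed
qed measurable

text \<open>For \<open>\<alpha> > 1\<close> the value is
  \<open>4 powr (\<alpha> - 1) * Gamma (\<alpha> - 1)\<close>; the argument carries it as a
  symbol.\<close>

definition ThetaInt :: "real \<Rightarrow> real" where
  "ThetaInt \<alpha> = (\<integral>\<tau>. indicator {0<..} \<tau> * Theta \<alpha> 1 \<tau> \<partial>lborel)"

lemma integrable_Theta:
  assumes "\<alpha> > 1" "q > 0"
  shows "integrable lborel (\<lambda>\<tau>. indicator {0<..} \<tau> * Theta \<alpha> q \<tau>)"
proof -
  obtain B where B: "B \<ge> 0" "\<And>r. r > 0 \<Longrightarrow> Theta \<alpha> q r \<le> B" using Theta_bounded[of \<alpha> q] assms by auto
  show ?thesis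
    by (rule integrable_Ioi_bound[where a=0 and b=\<alpha> and B=B and C=1])
       (use assms B Theta_le[of q] in \<open>auto\<close>)
qed

lemma integral_Theta:
  assumes "\<alpha> > 1" "q > 0"
  shows "(\<integral>\<tau>. indicator {0<..} \<tau> * Theta \<alpha> q \<tau> \<partial>lborel) = q powr (1 - \<alpha>) * ThetaInt \<alpha>"
proof -
  have "(\<integral>\<tau>. indicator {0<..} \<tau> * Theta \<alpha> q \<tau> \<partial>lborel) = \<bar>q\<bar> *\<^sub>R (\<integral>x. indicator {0<..} (0 + q * x) * Theta \<alpha> q (0 + q * x) \<partial>lborel)"
    using assms by (intro lborel_integral_real_affine) auto
  also have "(\<integral>x. indicator {0<..} (0 + q * x) * Theta \<alpha> q (0 + q * x) \<partial>lborel) = (\<integral>x. q powr -\<alpha> * (indicator {0<..} x * Theta \<alpha> 1 x) \<partial>lborel)"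
    using assms by (intro Bochner_Integration.integral_cong refl) (auto simp: indicator_def Theta_def powr_mult zero_less_mult_iff)
  also have "\<bar>q\<bar> *\<^sub>R \<dots> = q powr (1 - \<alpha>) * ThetaInt \<alpha>"
    using assms by (simp add: ThetaInt_def powr_diff powr_minus divide_inverse)
  finally show ?thesis .
qed

lemma ThetaInt_pos:
  assumes "\<alpha> > 1"
  shows "ThetaInt \<alpha> > 0"
proof -
  define m where "m = 2 powr -\<alpha> * exp (- (1/4::real))"
  have "m > 0" by (simp add: m_def)
  moreover have "(\<integral>(\<tau>::real). m * indicator {1..2} \<tau> \<partial>lborel) \<le> ThetaInt \<alpha>"
    unfolding ThetaInt_def
  proof (rule integral_mono)
    fix \<tau> :: real
    show "m * indicator {1..2} \<tau> \<le> indicator {0<..} \<tau> * Theta \<alpha> 1 \<tau>"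
      using assms by (auto simp: indicator_def m_def Theta_def intro!: mult_mono powr_mono2')
  qed (use integrable_Theta[OF assms] in auto)
  ultimately show ?thesis by simp
qed

section \<open>Abel integrals and the Marchaud derivative\<close>

text \<open>The exponents \<open>s - 1\<close> and \<open>-s\<close> add up to \<open>-1\<close>, so
  the substitution \<open>\<tau> = L * t\<close> cancels every power of \<open>L\<close>.\<close>

lemma nn_integral_Beta_scaled:
  assumes "0 < s" "s < 1" "L > 0"
  shows "(\<integral>\<^sup>+ \<tau>. ennreal (indicator {0<..<L} \<tau> * (\<tau> powr (s - 1) * (L - \<tau>) powr -s)) \<partial>lborel) = ennreal (Beta s (1 - s))"
proof -
  let ?f = "\<lambda>t::real. indicator {0<..<1} t * (t powr (s - 1) * (1 - t) powr -s)"
  have "((\<lambda>t. t powr (s - 1) * (1 - t) powr ((1 - s) - 1)) has_integral Beta s (1 - s)) {0..1}"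
    by (rule has_integral_Beta_real) (use assms in auto)
  then have "((\<lambda>t. t powr (s - 1) * (1 - t) powr -s) has_integral Beta s (1 - s)) {0<..<1}"
    by (simp add: has_integral_Icc_iff_Ioo)
  then have "((\<lambda>t. if t \<in> {0<..<1} then t powr (s - 1) * (1 - t) powr -s else 0) has_integral Beta s (1 - s)) UNIV"
    by (simp only: has_integral_restrict_UNIV)
  moreover have "(\<lambda>t. if t \<in> {0<..<1} then t powr (s - 1) * (1 - t) powr -s else 0) = ?f"
    by (auto simp: indicator_def)
  ultimately have B: "(?f has_integral Beta s (1 - s)) UNIV" by simp
  have "(\<integral>\<^sup>+ \<tau>. ennreal (indicator {0<..<L} \<tau> * (\<tau> powr (s - 1) * (L - \<tau>) powr -s)) \<partial>lborel) =
     \<bar>L\<bar> * (\<integral>\<^sup>+ t. ennreal (indicator {0<..<L} (0 + L * t) * ((0 + L * t) powr (s - 1) * (L - (0 + L * t)) powr -s)) \<partial>lborel)"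
    using assms by (intro nn_integral_real_affine) auto
  also have "\<dots> = (\<integral>\<^sup>+ t. ennreal L * ennreal (indicator {0<..<L} (0 + L * t) * ((0 + L * t) powr (s - 1) * (L - (0 + L * t)) powr -s)) \<partial>lborel)"
    using assms by (subst nn_integral_cmult) auto
  also have "\<dots> = (\<integral>\<^sup>+ t. ennreal (?f t) \<partial>lborel)"
  proof (intro nn_integral_cong)
    fix t :: real
    have "L * (indicator {0<..<L} (0 + L * t) * ((0 + L * t) powr (s - 1) * (L - (0 + L * t)) powr -s)) = ?f t"
    proof (cases "0 < t \<and> t < 1")
      case True
      have "L - L * t = L * (1 - t)" by (simp add: algebra_simps)
      moreover have "L * (L powr (s - 1) * L powr -s) = 1"
      proof -
        have "L * (L powr (s - 1) * L powr -s) = L powr 1 * (L powr (s - 1) * L powr -s)" using assms by simp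
        also have "\<dots> = L powr (1 + (s - 1 + -s))" unfolding powr_add ..
        finally show ?thesis using assms by simp
      qed
      ultimately show ?thesis using True assms by (simp add: powr_mult mult_ac)
    next
      case False
      then show ?thesis using assms by (auto simp: indicator_def zero_less_mult_iff)
    qed
    then show "ennreal L * ennreal (indicator {0<..<L} (0 + L * t) * ((0 + L * t) powr (s - 1) * (L - (0 + L * t)) powr -s)) = ennreal (?f t)"
      using assms by (simp add: ennreal_mult[symmetric])
  qed
  also have "\<dots> = ennreal (Beta s (1 - s))"
    by (rule nn_integral_has_integral_lborel[OF _ _ B]) auto
  finally show ?thesis .
qed

lemma Beta_pos: "0 < s \<Longrightarrow> s < 1 \<Longrightarrow> Beta s (1 - s) > (0::real)"
  by (simp add: Beta_def)

text \<open>The mass of this weight over \<open>(\<sigma>, \<tau>)\<close> is a Beta integral that does not depend on \<open>r > t\<close>; this is what inverts the Abel integral.\<close>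

definition abel_weight :: "real \<Rightarrow> real \<Rightarrow> real \<Rightarrow> real \<times> real \<Rightarrow> real" where
  "abel_weight s t r = (\<lambda>(\<sigma>, \<tau>). indicator {0<..} \<sigma> * (indicator {0<..} \<tau> * (indicator {t + \<tau><..<t + \<tau> + \<sigma>} r * (\<sigma> powr (- 1 - s) * \<tau> powr (s - 1)))))"

text \<open>For fixed \<open>\<tau>\<close> the constraint on \<open>r\<close> reads
  \<open>\<sigma> > r - t - \<tau>\<close>, and the tail integral in \<open>\<sigma>\<close> is
  \<open>(r - t - \<tau>) powr -s / s\<close>. What is left in \<open>\<tau>\<close> is the scaled
  Beta integral of length \<open>r - t\<close>.\<close>

lemma abel_weight_integral:
  assumes s: "0 < s" "s < 1" and r: "t < r"
  shows "has_bochner_integral lborel (abel_weight s t r) (Beta s (1 - s) / s)"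
proof (rule has_bochner_integral_nn_integral)
  have [measurable]: "(\<lambda>z. abel_weight s t r z) \<in> borel_measurable (borel \<Otimes>\<^sub>M borel)"
    unfolding abel_weight_def greaterThanLessThan_iff indicator_def by measurable
  then show m: "abel_weight s t r \<in> borel_measurable lborel" by (simp add: borel_prod)
  have m': "(\<lambda>z. ennreal (abel_weight s t r z)) \<in> borel_measurable (lborel \<Otimes>\<^sub>M lborel)" by measurable
  show "AE z in lborel. 0 \<le> abel_weight s t r z" by (auto simp: abel_weight_def)
  show "0 \<le> Beta s (1 - s) / s" using Beta_pos[of s] s by simp
  have inner: "(\<integral>\<^sup>+ \<sigma>. ennreal (abel_weight s t r (\<sigma>, \<tau>)) \<partial>lborel) =
     ennreal (1/s) * ennreal (indicator {0<..<r - t} \<tau> * (\<tau> powr (s - 1) * ((r - t) - \<tau>) powr -s))" for \<tau>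
  proof (cases "0 < \<tau> \<and> \<tau> < r - t")
    case True
    have "(\<integral>\<^sup>+ \<sigma>. ennreal (abel_weight s t r (\<sigma>, \<tau>)) \<partial>lborel) =
      (\<integral>\<^sup>+ \<sigma>. ennreal (\<tau> powr (s - 1)) * ennreal (indicator {r - t - \<tau><..} \<sigma> * \<sigma> powr - (1 + s)) \<partial>lborel)"
      using True by (intro nn_integral_cong) (auto simp: abel_weight_def indicator_def ennreal_mult[symmetric] mult_ac)
    also have "\<dots> = ennreal (\<tau> powr (s - 1)) * ennreal ((r - t - \<tau>) powr (1 - (1 + s)) / (1 + s - 1))"
    proof (subst nn_integral_cmult)
      show "ennreal (\<tau> powr (s - 1)) * (\<integral>\<^sup>+ \<sigma>. ennreal (indicator {r - t - \<tau><..} \<sigma> * \<sigma> powr - (1 + s)) \<partial>lborel) =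
        ennreal (\<tau> powr (s - 1)) * ennreal ((r - t - \<tau>) powr (1 - (1 + s)) / (1 + s - 1))"
        using True s by (subst nn_integral_powr_Ioi) auto
    qed measurable
    finally show ?thesis using True s by (simp add: ennreal_mult[symmetric] mult_ac)
  next
    case False
    have "(\<integral>\<^sup>+ \<sigma>. ennreal (abel_weight s t r (\<sigma>, \<tau>)) \<partial>lborel) = (\<integral>\<^sup>+ (\<sigma>::real). 0 \<partial>lborel)"
      by (intro nn_integral_cong) (use False in \<open>auto simp: abel_weight_def indicator_def\<close>)
    then show ?thesis using False by (auto simp: indicator_def)
  qed
  have "(\<integral>\<^sup>+ z. ennreal (abel_weight s t r z) \<partial>lborel) = (\<integral>\<^sup>+ \<tau>. \<integral>\<^sup>+ \<sigma>. ennreal (abel_weight s t r (\<sigma>, \<tau>)) \<partial>lborel \<partial>lborel)"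
    using lborel_pair.nn_integral_snd[OF m'] unfolding lborel_prod by simp
  also have "\<dots> = ennreal (1/s) * ennreal (Beta s (1 - s))"
    unfolding inner using nn_integral_Beta_scaled[OF s, of "r - t"] r by (subst nn_integral_cmult) auto
  finally show "(\<integral>\<^sup>+ z. ennreal (abel_weight s t r z) \<partial>lborel) = ennreal (Beta s (1 - s) / s)"
    using s Beta_pos[of s] by (simp add: ennreal_mult[symmetric])
qed

lemma FTC_Ioo:
  fixes F f :: "real \<Rightarrow> real"
  assumes ab: "a \<le> b" and F: "\<And>r. a \<le> r \<Longrightarrow> DERIV F r :> - f r" and f: "\<And>r. a \<le> r \<Longrightarrow> isCont f r"
  shows "(\<integral>r. indicator {a<..<b} r * f r \<partial>lborel) = F a - F b"
    and "integrable lborel (\<lambda>r. indicator {a<..<b} r * f r)"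
proof -
  have "has_bochner_integral lborel (\<lambda>x. - f x * indicator {a .. b} x) (F b - F a)"
    by (rule has_bochner_integral_FTC_Icc_real) (use assms in \<open>auto intro!: continuous_intros\<close>)
  then have 1: "has_bochner_integral lborel (\<lambda>x. f x * indicator {a .. b} x) (F a - F b)"
    using has_bochner_integral_minus by fastforce
  have AE: "AE x in lborel. f x * indicator {a .. b} x = indicator {a<..<b} x * f x"
  proof -
    have "AE r in lborel. r \<noteq> a" "AE r in lborel. r \<noteq> b" by (rule AE_lborel_singleton)+
    then show ?thesis by eventually_elim (auto simp: indicator_def)
  qed
  have m: "(\<lambda>x. indicator {a<..<b} x * f x) \<in> borel_measurable lborel"
  proof -
    have "continuous_on {a<..<b} f" using f by (auto intro!: continuous_at_imp_continuous_on)
    then have "(\<lambda>x. indicator {a<..<b} x *\<^sub>R f x) \<in> borel_measurable borel"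
      by (rule borel_measurable_continuous_on_indicator[rotated]) auto
    then show ?thesis by simp
  qed
  have "has_bochner_integral lborel (\<lambda>r. indicator {a<..<b} r * f r) (F a - F b)"
    by (rule has_bochner_integral_cong_AE[THEN iffD1, OF _ m AE 1]) (use 1 in \<open>auto simp: has_bochner_integral_iff\<close>)
  then show "(\<integral>r. indicator {a<..<b} r * f r \<partial>lborel) = F a - F b" "integrable lborel (\<lambda>r. indicator {a<..<b} r * f r)"
    by (auto simp: has_bochner_integral_iff)
qed

text \<open>Up to the factor \<open>1 / Gamma s\<close> this is the Weyl fractional integral of
  order \<open>s\<close>, taken over the future of \<open>t\<close>.\<close>

definition AbelInt :: "real \<Rightarrow> (real \<Rightarrow> real) \<Rightarrow> real \<Rightarrow> real" where
  "AbelInt s F t = (\<integral>\<tau>. indicator {0<..} \<tau> * (\<tau> powr (s - 1) * F (t + \<tau>)) \<partial>lborel)"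

text \<open>The increment \<open>F (t + \<tau>) - F (t + \<tau> + \<sigma>)\<close> is the integral
  of \<open>f\<close> over the interval in between. Inserting this and integrating over
  \<open>\<sigma>\<close> and \<open>\<tau>\<close> first leaves \<open>f\<close> against the
  constant mass of \<open>abel_weight\<close>; integrability of \<open>f\<close> beyond
  \<open>t\<close> justifies the exchange.\<close>

lemma abel_inversion:
  fixes F f :: "real \<Rightarrow> real"
  assumes s: "0 < s" "s < 1"
    and F: "\<And>r. t \<le> r \<Longrightarrow> DERIV F r :> - f r" and f: "\<And>r. t \<le> r \<Longrightarrow> isCont f r" and [measurable]: "f \<in> borel_measurable borel"
    and fint: "integrable lborel (\<lambda>r. indicator {t<..} r * f r)" and lim: "(F \<longlongrightarrow> 0) at_top"
    and K: "\<And>t'. t \<le> t' \<Longrightarrow> integrable lborel (\<lambda>\<tau>. indicator {0<..} \<tau> * (\<tau> powr (s - 1) * F (t' + \<tau>)))"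
  shows "has_bochner_integral lborel (\<lambda>\<sigma>. indicator {0<..} \<sigma> * (\<sigma> powr (- 1 - s) * (AbelInt s F t - AbelInt s F (t + \<sigma>)))) (Beta s (1 - s) / s * F t)"
proof -
  let ?g = "\<lambda>r. indicator {t<..} r * f r" and ?c = "Beta s (1 - s) / s"
  have F_t: "(\<integral>r. ?g r \<partial>lborel) = F t"
  proof -
    have "(\<lambda>n. \<integral>r. indicator {t<..<t + real n} r * f r \<partial>lborel) \<longlonglongrightarrow> (\<integral>r. ?g r \<partial>lborel)"
    proof (rule integral_dominated_convergence[where w="\<lambda>r. norm (?g r)"])
      show "integrable lborel (\<lambda>r. norm (?g r))" using fint by (rule integrable_norm)
      show "AE r in lborel. (\<lambda>n. indicator {t<..<t + real n} r * f r) \<longlonglongrightarrow> ?g r"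
      proof (rule AE_I2)
        fix r
        have "eventually (\<lambda>n. r < t + real n) sequentially"
          using reals_Archimedean2[of "r - t"] by (auto simp: eventually_sequentially) (metis add.commute diff_less_eq le_less_trans not_le of_nat_le_iff)
        then have "eventually (\<lambda>n. indicator {t<..<t + real n} r * f r = ?g r) sequentially"
          by eventually_elim (auto simp: indicator_def)
        then show "(\<lambda>n. indicator {t<..<t + real n} r * f r) \<longlonglongrightarrow> ?g r" by (rule tendsto_eventually)
      qed
    qed (auto simp: indicator_def)
    moreover have "(\<integral>r. indicator {t<..<t + real n} r * f r \<partial>lborel) = F t - F (t + real n)" for n
      by (rule FTC_Ioo(1)) (use F f in auto)
    moreover have "(\<lambda>n. F t - F (t + real n)) \<longlonglongrightarrow> F t - 0"
      by (intro tendsto_intros filterlim_compose[OF lim] filterlim_tendsto_add_at_top[OF tendsto_const] filterlim_real_sequentially)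
    ultimately show ?thesis using LIMSEQ_unique by fastforce
  qed
  have Wm [measurable]: "(\<lambda>(r, z). abel_weight s t r z) \<in> borel_measurable (borel \<Otimes>\<^sub>M borel)"
  proof -
    have "(\<lambda>(r, z). abel_weight s t r z) \<in> borel_measurable (borel \<Otimes>\<^sub>M (borel \<Otimes>\<^sub>M borel))"
      unfolding abel_weight_def indicator_def greaterThanLessThan_iff greaterThan_iff by measurable
    then show ?thesis by (simp add: borel_prod)
  qed
  have W0: "0 \<le> abel_weight s t r z" for r z by (auto simp: abel_weight_def split: prod.split)
  have c: "has_bochner_integral lborel (abel_weight s t r) ?c" if "?g r \<noteq> 0" for r
    using that by (intro abel_weight_integral s) (auto simp: indicator_def split: if_splits)
  note I = integrable_times_kernel[OF fint Wm W0 c]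
  define H where "H z = (\<integral>r. ?g r * abel_weight s t r z \<partial>lborel)" for z
  have H_int: "integrable lborel H" and H_eq: "(\<integral>z. H z \<partial>lborel) = ?c * F t"
    unfolding H_def using lborel_pair.integrable_snd[OF I(1)] lborel_pair.integral_snd[OF I(1)] I(2) F_t by auto
  have H: "H (\<sigma>, \<tau>) = indicator {0<..} \<sigma> * (\<sigma> powr (- 1 - s) * (indicator {0<..} \<tau> * (\<tau> powr (s - 1) * F (t + \<tau>)) - indicator {0<..} \<tau> * (\<tau> powr (s - 1) * F ((t + \<sigma>) + \<tau>))))" for \<sigma> \<tau>
  proof (cases "0 < \<sigma> \<and> 0 < \<tau>")
    case True
    have "H (\<sigma>, \<tau>) = (\<integral>r. (\<sigma> powr (- 1 - s) * \<tau> powr (s - 1)) * (indicator {t + \<tau><..<t + \<tau> + \<sigma>} r * f r) \<partial>lborel)"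
      unfolding H_def by (intro Bochner_Integration.integral_cong refl) (use True in \<open>auto simp: abel_weight_def indicator_def\<close>)
    also have "\<dots> = (\<sigma> powr (- 1 - s) * \<tau> powr (s - 1)) * (F (t + \<tau>) - F (t + \<tau> + \<sigma>))"
      using FTC_Ioo(1)[of "t + \<tau>" "t + \<tau> + \<sigma>" F f] True F f by simp
    finally show ?thesis using True by (simp add: algebra_simps)
  next
    case False
    then show ?thesis unfolding H_def abel_weight_def by (auto simp: indicator_def)
  qed
  have H_int': "integrable (lborel \<Otimes>\<^sub>M lborel) (\<lambda>(\<sigma>, \<tau>). H (\<sigma>, \<tau>))" using H_int by (simp add: lborel_prod)
  have e: "(\<integral>\<tau>. H (\<sigma>, \<tau>) \<partial>lborel) = indicator {0<..} \<sigma> * (\<sigma> powr (- 1 - s) * (AbelInt s F t - AbelInt s F (t + \<sigma>)))" for \<sigma>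
  proof (cases "\<sigma> > 0")
    case True
    then show ?thesis unfolding H AbelInt_def using K[of t] K[of "t + \<sigma>"] by simp
  qed (simp add: H)
  show ?thesis
    unfolding has_bochner_integral_iff using lborel_pair.integrable_fst[OF H_int'] lborel_pair.integral_fst[OF H_int'] H_eq
    by (simp add: e lborel_prod)
qed

text \<open>A positive value would give a positive maximum over all later times, attained because
  \<open>V\<close> decays. At a maximum point the integrand is nonnegative with integral zero, so
  \<open>V\<close> would equal its maximum at almost every later time, against the decay.\<close>

lemma marchaud_max_principle:
  fixes V :: "real \<Rightarrow> real"
  assumes cont: "continuous_on {0<..} V" and lim: "(V \<longlongrightarrow> 0) at_top"
    and D: "\<And>t. t > 0 \<Longrightarrow> has_bochner_integral lborel (\<lambda>\<sigma>. indicator {0<..} \<sigma> * (\<sigma> powr (- 1 - s) * (V t - V (t + \<sigma>)))) 0"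
    and t: "t > 0"
  shows "V t \<le> 0"
proof (rule ccontr)
  assume "\<not> V t \<le> 0"
  then have Vt: "V t > 0" by simp
  have "eventually (\<lambda>x. V x < V t) at_top" using lim Vt by (rule order_tendstoD)
  then obtain N0 where N0: "\<And>x. x \<ge> N0 \<Longrightarrow> V x < V t" unfolding eventually_at_top_linorder by blast
  define N where "N = max N0 t"
  have N: "\<And>x. x \<ge> N \<Longrightarrow> V x < V t" "N \<ge> t" using N0 by (auto simp: N_def)
  have "\<exists>m\<in>{t..N}. \<forall>y\<in>{t..N}. V y \<le> V m"
    using N t by (intro continuous_attains_sup continuous_on_subset[OF cont]) auto
  then obtain m where m: "t \<le> m" "m \<le> N" "\<And>y. t \<le> y \<Longrightarrow> y \<le> N \<Longrightarrow> V y \<le> V m" by auto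
  have m': "V y \<le> V m" if "t \<le> y" for y
    using m(3)[of y] N(1)[of y] m(3)[of t] N(2) that by (cases "y \<le> N") auto
  let ?I = "\<lambda>\<sigma>. indicator {0<..} \<sigma> * (\<sigma> powr (- 1 - s) * (V m - V (m + \<sigma>)))"
  have nn: "0 \<le> ?I \<sigma>" for \<sigma> using m'[of "m + \<sigma>"] m(1) by (auto simp: indicator_def)
  have "integrable lborel ?I" "(\<integral>\<sigma>. ?I \<sigma> \<partial>lborel) = 0" using D[of m] t m by (auto simp: has_bochner_integral_iff)
  then have AE: "AE \<sigma> in lborel. ?I \<sigma> = 0" using nn by (subst (asm) integral_nonneg_eq_0_iff_AE) auto
  have "AE \<sigma> in lborel. \<sigma> \<notin> {N<..<N + 1}"
    using AE
  proof eventually_elim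
    case (elim \<sigma>)
    show ?case
    proof
      assume s: "\<sigma> \<in> {N<..<N + 1}"
      then have "\<sigma> > 0" using N t by auto
      then have "V m = V (m + \<sigma>)" using elim by simp
      moreover have "V (m + \<sigma>) < V t" using s m t by (intro N(1)) auto
      ultimately show False using m'[of t] by simp
    qed
  qed
  then have "{N<..<N + 1} \<in> null_sets lborel" by (subst AE_iff_null_sets) auto
  then have "emeasure lborel {N<..<N + 1} = 0" by auto
  then show False by simp
qed

section \<open>Gaussians and subordination\<close>

lemma lborel_integral_scale:
  fixes f :: "'a::euclidean_space \<Rightarrow> real"
  assumes [measurable]: "f \<in> borel_measurable borel" and c: "c > 0"
  shows "(\<integral>x. f x \<partial>lborel) = c ^ DIM('a) * (\<integral>x. f (c *\<^sub>R x) \<partial>lborel)"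
    and "integrable lborel f \<longleftrightarrow> integrable lborel (\<lambda>x. f (c *\<^sub>R x))"
proof -
  have e: "(lborel :: 'a measure) = density (distr lborel borel (\<lambda>x. c *\<^sub>R x)) (\<lambda>_. ennreal (c ^ DIM('a)))"
    using lborel_affine[of c "0::'a"] c by (simp add: ennreal_power)
  have "(\<integral>x. f x \<partial>lborel) = (\<integral>x. f x \<partial>density (distr lborel borel (\<lambda>x. c *\<^sub>R x)) (\<lambda>_. ennreal (c ^ DIM('a))))"
    using e by simp
  also have "\<dots> = c ^ DIM('a) * (\<integral>x. f (c *\<^sub>R x) \<partial>lborel)"
    using c by (subst integral_density) (auto simp: integral_distr)
  finally show "(\<integral>x. f x \<partial>lborel) = c ^ DIM('a) * (\<integral>x. f (c *\<^sub>R x) \<partial>lborel)" .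
  have "integrable lborel f \<longleftrightarrow> integrable (density (distr lborel borel (\<lambda>x. c *\<^sub>R x)) (\<lambda>_. ennreal (c ^ DIM('a)))) f"
    using e by simp
  also have "\<dots> \<longleftrightarrow> integrable lborel (\<lambda>x. f (c *\<^sub>R x))"
    using c by (subst integrable_density) (auto simp: integrable_distr_eq)
  finally show "integrable lborel f \<longleftrightarrow> integrable lborel (\<lambda>x. f (c *\<^sub>R x))" .
qed

text \<open>The heat kernel without its normalising constant: the total mass is \<open>gauss_mass\<close> below.\<close>

definition heat :: "real \<Rightarrow> 'a::euclidean_space \<Rightarrow> real" where
  "heat t x = Theta (real DIM('a) / 2) ((norm x)\<^sup>2) t"

lemma heat_nonneg [simp]: "0 \<le> heat t x" by (simp add: heat_def)
lemma heat_minus [simp]: "heat t (- x) = heat t x" by (simp add: heat_def)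

lemma heat_measurable [measurable (raw)]:
  assumes [measurable]: "t \<in> borel_measurable M" "f \<in> borel_measurable M"
  shows "(\<lambda>x. heat (t x) (f x)) \<in> borel_measurable M"
  unfolding heat_def by measurable

lemma heat_eq: "heat t x = t powr -(real DIM('a)/2) * exp (- (1/(4*t)) * (norm x)\<^sup>2)" for x :: "'a::euclidean_space"
  by (simp add: heat_def Theta_def)

context fractional_order
begin

text \<open>The cubic factor is the highest degree that occurs in second derivatives of an affine
  function times a Gaussian.\<close>

lemma gauss_wt:
  assumes "a > 0"
  shows "\<exists>C\<ge>0. \<forall>x::'a. (1 + norm x) ^ 3 * exp (- a * (norm x)\<^sup>2) \<le> C * wt p x"
proof -
  have "\<exists>B\<ge>0. \<forall>x>0. x powr (3 + p) * exp (- a * x) \<le> B" by (rule powr_exp_bound) (use assms p_pos in auto)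
  then obtain B where B: "B \<ge> 0" "\<And>x. x > 0 \<Longrightarrow> x powr (3 + p) * exp (- a * x) \<le> B" by blast
  show ?thesis
  proof (intro exI[of _ "exp (2 * a) * B"] conjI allI)
    show "0 \<le> exp (2 * a) * B" using B by simp
    fix x :: 'a
    let ?r = "1 + norm x"
    have r: "?r > 0" by (simp add: add_pos_nonneg)
    \<comment> \<open>Gives \<open>1 + norm x \<le> (norm x)\<^sup>2 + 2\<close>, which trades the
      Gaussian for an exponential in \<open>1 + norm x\<close>.\<close>
    have "0 \<le> (norm x - 1/2)\<^sup>2" by simp
    then have "?r \<le> (norm x)\<^sup>2 + 2" by (simp add: power2_eq_square algebra_simps)
    then have "a * ?r \<le> a * ((norm x)\<^sup>2 + 2)" using assms by (intro mult_left_mono) auto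
    then have "exp (- a * (norm x)\<^sup>2) \<le> exp (2 * a + - a * ?r)" by (simp add: algebra_simps)
    then have e: "exp (- a * (norm x)\<^sup>2) \<le> exp (2 * a) * exp (- a * ?r)" by (simp only: exp_add)
    have "?r ^ 3 * exp (- a * (norm x)\<^sup>2) \<le> ?r ^ 3 * (exp (2 * a) * exp (- a * ?r))"
      using e by (intro mult_left_mono) auto
    also have "\<dots> = exp (2 * a) * ((?r powr (3 + p) * exp (- a * ?r)) * ?r powr -p)"
    proof -
      have "?r powr (3 + p) * ?r powr -p = ?r ^ 3" using r powr_realpow[of ?r 3] by (simp add: powr_add[symmetric])
      then show ?thesis by (simp add: mult_ac)
    qed
    also have "\<dots> \<le> exp (2 * a) * (B * ?r powr -p)"
      using B(2)[OF r] by (intro mult_left_mono mult_right_mono) auto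
    finally show "?r ^ 3 * exp (- a * (norm x)\<^sup>2) \<le> exp (2 * a) * B * wt p x" by (simp add: wt_def mult.assoc)
  qed
qed

lemma norm_shift_le: "1 + norm x \<le> (1 + norm z) * (1 + norm (x - z))" for x z :: 'a
proof -
  have "(1 + norm z) * (1 + norm (x - z)) = 1 + norm z + norm (x - z) + norm z * norm (x - z)" by (simp add: algebra_simps)
  moreover have "0 \<le> norm z * norm (x - z)" by simp
  moreover have "norm x \<le> norm (x - z) + norm z" using norm_triangle_ineq[of "x - z" z] by simp
  ultimately show ?thesis by linarith
qed

lemma wt_translate: "wt p (x - z) \<le> (1 + norm z) powr p * wt p x" for x z :: 'a
  by (rule wt_le) (use norm_shift_le[of x z] in \<open>auto simp: add_pos_nonneg\<close>)

lemma gauss_wt_shift: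
  assumes "a > 0"
  shows "\<exists>C\<ge>0. \<forall>x::'a. (1 + norm x) ^ 3 * exp (- a * (norm (x - z))\<^sup>2) \<le> C * wt p x"
proof -
  obtain C where C: "C \<ge> 0" "\<And>x::'a. (1 + norm x) ^ 3 * exp (- a * (norm x)\<^sup>2) \<le> C * wt p x" using gauss_wt[OF assms] by blast
  let ?Z = "1 + norm z"
  show ?thesis
  proof (intro exI[of _ "?Z ^ 3 * (C * ?Z powr p)"] conjI allI)
    show "0 \<le> ?Z ^ 3 * (C * ?Z powr p)" using C by simp
    fix x :: 'a
    have "(1 + norm x) ^ 3 * exp (- a * (norm (x - z))\<^sup>2) \<le> (?Z * (1 + norm (x - z))) ^ 3 * exp (- a * (norm (x - z))\<^sup>2)"
      using norm_shift_le[of x z] by (intro mult_right_mono power_mono) auto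
    also have "\<dots> = ?Z ^ 3 * ((1 + norm (x - z)) ^ 3 * exp (- a * (norm (x - z))\<^sup>2))" by (simp only: power_mult_distrib mult.assoc)
    also have "\<dots> \<le> ?Z ^ 3 * (C * (?Z powr p * wt p x))"
      using C(1) by (intro mult_left_mono order_trans[OF C(2)] wt_translate) auto
    finally show "(1 + norm x) ^ 3 * exp (- a * (norm (x - z))\<^sup>2) \<le> ?Z ^ 3 * (C * ?Z powr p) * wt p x" by (simp add: mult.assoc)
  qed
qed

lemma gauss_le_wt:
  assumes "a > 0"
  shows "\<exists>C\<ge>0. \<forall>x::'a. exp (- a * (norm (x - z))\<^sup>2) \<le> C * wt p x"
proof -
  obtain C where C: "C \<ge> 0" "\<And>x::'a. (1 + norm x) ^ 3 * exp (- a * (norm (x - z))\<^sup>2) \<le> C * wt p x"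
    using gauss_wt_shift[OF assms, of z] by blast
  have "exp (- a * (norm (x - z))\<^sup>2) \<le> C * wt p x" for x
  proof -
    have "1 * exp (- a * (norm (x - z))\<^sup>2) \<le> (1 + norm x) ^ 3 * exp (- a * (norm (x - z))\<^sup>2)"
      by (intro mult_right_mono one_le_power) auto
    also note C(2)[of x]
    finally show ?thesis by (simp only: mult_1)
  qed
  then show ?thesis using C(1) by blast
qed

text \<open>The value is \<open>(4 * pi) powr (n/2)\<close>; the argument carries it as a
  symbol.\<close>

definition gauss_mass :: real where "gauss_mass = (\<integral>x. heat 1 x \<partial>(lborel :: 'a measure))"

lemma heat_integrable_1: "integrable lborel (heat 1 :: 'a \<Rightarrow> real)"
proof -
  obtain C where C: "C \<ge> 0" "\<And>x::'a. exp (- (1/4) * (norm (x - 0))\<^sup>2) \<le> C * wt p x"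
    using gauss_le_wt[of "1/4" 0] by auto
  show ?thesis
    by (rule Bochner_Integration.integrable_bound[where f="\<lambda>x::'a. C * wt p x"])
       (use C in \<open>auto simp: heat_eq integrable_wt_p abs_mult intro!: AE_I2\<close>)
qed

lemma heat_has_integral:
  assumes t: "t > 0"
  shows "has_bochner_integral lborel (heat t :: 'a \<Rightarrow> real) gauss_mass"
proof -
  have e: "heat t (sqrt t *\<^sub>R x) = t powr - (real DIM('a)/2) * heat 1 x" for x :: 'a
    using t by (simp add: heat_eq power_mult_distrib)
  have "sqrt t ^ DIM('a) * t powr - (real DIM('a)/2) = 1"
  proof -
    have "sqrt t ^ DIM('a) = t powr (real DIM('a)/2)"
      using t by (simp add: powr_half_sqrt[symmetric] powr_realpow[symmetric] powr_powr)
    then show ?thesis using t by (simp add: powr_add[symmetric])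
  qed
  then show ?thesis
    unfolding has_bochner_integral_iff using lborel_integral_scale[of "heat t :: 'a \<Rightarrow> real" "sqrt t"] t heat_integrable_1
    by (simp add: e gauss_mass_def mult.assoc[symmetric])
qed

lemma gauss_mass_pos: "gauss_mass > 0"
proof -
  define m where "m = exp (- (1/4::real))"
  have m: "m > 0" by (simp add: m_def)
  have "(\<integral>x. m * indicator (cball 0 1) x \<partial>(lborel :: 'a measure)) \<le> gauss_mass"
    unfolding gauss_mass_def
  proof (rule integral_mono)
    show "integrable lborel (\<lambda>x::'a. m * indicator (cball 0 1) x)"
      by (intro integrable_mult_right) (auto simp: integrable_indicator_iff emeasure_cball)
    fix x :: 'a
    show "m * indicator (cball 0 1) x \<le> heat 1 x"
      by (auto simp: indicator_def m_def heat_eq power_le_one)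
  qed (rule heat_integrable_1)
  moreover have "(\<integral>x. m * indicator (cball 0 1) x \<partial>(lborel :: 'a measure)) = m * unit_ball_vol DIM('a)"
    by (simp add: content_cball)
  moreover have "m * unit_ball_vol DIM('a) > 0" using m by simp
  ultimately show ?thesis by linarith
qed

text \<open>Completing the square in \<open>h\<close>: the product is a Gaussian in \<open>h\<close>
  of time \<open>t * r / (t + r)\<close>, centred at a multiple of \<open>x\<close>, times a factor
  free of \<open>h\<close>. Integration yields the semigroup law up to
  \<open>gauss_mass\<close>.\<close>

lemma heat_semigroup_pointwise:
  fixes x h :: 'a
  assumes t: "t > 0" and r: "r > 0"
  shows "heat t (x - h) * heat r h = heat (t + r) x * heat (t * r / (t + r)) ((r / (t + r)) *\<^sub>R x - h)"
proof -
  have "t powr a * r powr a = (t + r) powr a * (t * r / (t + r)) powr a" for a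
    using t r by (simp add: powr_mult[symmetric])
  moreover have "(norm (x - h))\<^sup>2 / (4*t) + (norm h)\<^sup>2 / (4*r) = (norm x)\<^sup>2 / (4 * (t + r)) + (norm ((r / (t + r)) *\<^sub>R x - h))\<^sup>2 / (4 * (t * r / (t + r)))"
  proof -
    define X H Y where "X = x \<bullet> x" "H = h \<bullet> h" "Y = x \<bullet> h"
    have n: "(norm (x - h))\<^sup>2 = X - 2 * Y + H" "(norm h)\<^sup>2 = H" "(norm x)\<^sup>2 = X"
      "(norm ((r / (t + r)) *\<^sub>R x - h))\<^sup>2 = (r / (t + r))\<^sup>2 * X - 2 * (r / (t + r)) * Y + H"
      unfolding X_H_Y_def power2_norm_eq_inner by (simp_all add: inner_simps inner_commute algebra_simps power2_eq_square)
    show ?thesis unfolding n using t r by (simp add: divide_simps add_nonneg_eq_0_iff) (simp add: power2_eq_square algebra_simps)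
  qed
  then have "exp (- ((norm (x - h))\<^sup>2 / (4*t)) + - ((norm h)\<^sup>2 / (4*r))) = exp (- ((norm x)\<^sup>2 / (4 * (t + r))) + - ((norm ((r / (t + r)) *\<^sub>R x - h))\<^sup>2 / (4 * (t * r / (t + r)))))"
    by (simp only: minus_add_distrib[symmetric])
  ultimately show ?thesis unfolding heat_def Theta_def exp_add by (simp add: mult_ac)
qed

lemma heat_convolution:
  fixes x :: 'a
  assumes t: "t > 0" and r: "r > 0"
  shows "has_bochner_integral lborel (\<lambda>h. heat t (x - h) * heat r h) (gauss_mass * heat (t + r) x)"
    and "has_bochner_integral lborel (\<lambda>h. heat t (x + h) * heat r h) (gauss_mass * heat (t + r) x)"
proof -
  have pos: "t * r / (t + r) > 0" using t r by simp
  have "has_bochner_integral lborel (\<lambda>h. heat (t + r) x * heat (t * r / (t + r)) ((r / (t + r)) *\<^sub>R x - h)) (heat (t + r) x * gauss_mass)"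
    using lborel_integral_translate(2,4)[of "heat (t * r / (t + r)) :: 'a \<Rightarrow> real" "(r / (t + r)) *\<^sub>R x"] heat_has_integral[OF pos]
    by (intro has_bochner_integral_mult_right) (auto simp: has_bochner_integral_iff)
  then show 1: "has_bochner_integral lborel (\<lambda>h. heat t (x - h) * heat r h) (gauss_mass * heat (t + r) x)"
    unfolding heat_semigroup_pointwise[OF t r] mult.commute[of gauss_mass] .
  show "has_bochner_integral lborel (\<lambda>h. heat t (x + h) * heat r h) (gauss_mass * heat (t + r) x)"
    using 1 lborel_integral_translate(2,4)[of "\<lambda>h. heat t (x - h) * heat r h" 0] by (simp add: has_bochner_integral_iff)
qed

text \<open>Here space turns into time: averaging second differences over a Gaussian of time
  \<open>r\<close> gives the increment of the heat kernel from \<open>t\<close> to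
  \<open>t + r\<close>.\<close>

lemma second_diff_heat_integral:
  assumes t: "t > 0" and r: "r > 0"
  shows "has_bochner_integral lborel (\<lambda>h. second_diff (\<lambda>y. heat t (y - z)) x h * heat r h) (2 * gauss_mass * (heat (t + r) (x - z) - heat t (x - z)))"
proof -
  have "has_bochner_integral lborel (\<lambda>h. heat t ((x - z) + h) * heat r h + heat t ((x - z) - h) * heat r h - 2 * heat t (x - z) * heat r h)
    (gauss_mass * heat (t + r) (x - z) + gauss_mass * heat (t + r) (x - z) - 2 * heat t (x - z) * gauss_mass)"
    by (intro has_bochner_integral_diff has_bochner_integral_add heat_convolution t r has_bochner_integral_mult_right heat_has_integral)
  then show ?thesis by (simp add: second_diff_def algebra_simps)
qed

text \<open>The exponent collects \<open>\<tau> powr (-1 - s)\<close> and the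
  \<open>\<tau> powr (-n/2)\<close> of the heat kernel:
  \<open>1 + s + n/2 = 1 + p/2\<close>.\<close>

definition subordination_const :: real where "subordination_const = ThetaInt (1 + p / 2)"

lemma subordination_const_pos: "subordination_const > 0" unfolding subordination_const_def using p_pos by (intro ThetaInt_pos) auto

lemma kernel_subordination:
  fixes h :: 'a
  assumes "h \<noteq> 0"
  shows "has_bochner_integral lborel (\<lambda>\<tau>. indicator {0<..} \<tau> * (\<tau> powr (-1 - s) * heat \<tau> h)) (subordination_const * norm h powr -p)"
proof -
  have e: "indicator {0<..} \<tau> * (\<tau> powr (-1 - s) * heat \<tau> h) = indicator {0<..} \<tau> * Theta (1 + p/2) ((norm h)\<^sup>2) \<tau>" for \<tau>
  proof -
    have "\<tau> powr (-1 - s) * \<tau> powr - (real DIM('a) / 2) = \<tau> powr - (1 + p/2)"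
    proof -
      have "(-1 - s) + - (real DIM('a) / 2) = - (1 + p/2)" by (simp add: p_eq field_simps)
      then show ?thesis unfolding powr_add[symmetric] by (rule arg_cong)
    qed
    then show ?thesis by (simp add: heat_def Theta_def mult.assoc[symmetric])
  qed
  have q: "(norm h)\<^sup>2 > 0" using assms by simp
  have a: "1 + p/2 > 1" using p_pos by simp
  have "((norm h)\<^sup>2) powr (1 - (1 + p/2)) = norm h powr -p"
  proof -
    have "(norm h)\<^sup>2 = norm h powr 2" using assms by (simp add: powr_numeral)
    then show ?thesis by (simp only: powr_powr) simp
  qed
  then show ?thesis unfolding e has_bochner_integral_iff subordination_const_def
    using integrable_Theta[OF a q] integral_Theta[OF a q] by simp
qed

end

section \<open>The equation for the heat extension\<close>

context fractional_order
begin

text \<open>One family covers both sides of the later comparison: translated heat kernels are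
  instances with \<open>B = 0\<close>, and for \<open>z = 0\<close> the function has value
  \<open>A\<close> and gradient \<open>B\<close> at the origin.\<close>

definition gauss_affine :: "real \<Rightarrow> 'a \<Rightarrow> real \<Rightarrow> 'a \<Rightarrow> 'a \<Rightarrow> real" where
  "gauss_affine A B a z x = (A + B \<bullet> x) * exp (- a * ((x - z) \<bullet> (x - z)))"

definition gauss_affine_deriv :: "real \<Rightarrow> 'a \<Rightarrow> real \<Rightarrow> 'a \<Rightarrow> 'a \<Rightarrow> 'a \<Rightarrow> real" where
  "gauss_affine_deriv A B a z x v = (B \<bullet> v + (- 2 * a) * ((A + B \<bullet> x) * ((x - z) \<bullet> v))) * exp (- a * ((x - z) \<bullet> (x - z)))"

definition gauss_affine_deriv2 :: "real \<Rightarrow> 'a \<Rightarrow> real \<Rightarrow> 'a \<Rightarrow> 'a \<Rightarrow> 'a \<Rightarrow> 'a \<Rightarrow> real" where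
  "gauss_affine_deriv2 A B a z x v k = ((- 2 * a) * ((B \<bullet> k) * ((x - z) \<bullet> v)) + (- 2 * a) * ((A + B \<bullet> x) * (k \<bullet> v))
     + (B \<bullet> v + (- 2 * a) * ((A + B \<bullet> x) * ((x - z) \<bullet> v))) * ((- 2 * a) * ((x - z) \<bullet> k))) * exp (- a * ((x - z) \<bullet> (x - z)))"

lemma gauss_affine_twice_diff: "twice_diff (gauss_affine A B a z) (gauss_affine_deriv A B a z) (gauss_affine_deriv2 A B a z)"
proof -
  have q: "((\<lambda>x. - a * ((x - z) \<bullet> (x - z))) has_derivative (\<lambda>k. (- 2 * a) * ((x - z) \<bullet> k))) (at x)" for x
    by (auto intro!: derivative_eq_intros simp: inner_commute algebra_simps)
  have E: "((\<lambda>x. exp (- a * ((x - z) \<bullet> (x - z)))) has_derivative (\<lambda>k. exp (- a * ((x - z) \<bullet> (x - z))) * ((- 2 * a) * ((x - z) \<bullet> k)))) (at x)" for x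
    by (rule has_derivative_compose[OF q, of exp, OF DERIV_exp[unfolded has_field_derivative_def]])
  have P: "((\<lambda>x. A + B \<bullet> x) has_derivative (\<lambda>k. B \<bullet> k)) (at x)" for x
    by (auto intro!: derivative_eq_intros)
  have R: "((\<lambda>x. B \<bullet> v + (- 2 * a) * ((A + B \<bullet> x) * ((x - z) \<bullet> v))) has_derivative
     (\<lambda>k. (- 2 * a) * ((B \<bullet> k) * ((x - z) \<bullet> v)) + (- 2 * a) * ((A + B \<bullet> x) * (k \<bullet> v)))) (at x)" for x v
  proof -
    have L: "((\<lambda>x. (x - z) \<bullet> v) has_derivative (\<lambda>k. k \<bullet> v)) (at x)"
      by (auto intro!: derivative_eq_intros)
    show ?thesis
      by (rule has_derivative_eq_rhs[OF has_derivative_add[OF has_derivative_const has_derivative_mult_right[OF has_derivative_mult[OF P L]]]])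
         (auto simp: algebra_simps)
  qed
  show ?thesis unfolding twice_diff_def
  proof (intro conjI allI)
    show "(gauss_affine A B a z has_derivative gauss_affine_deriv A B a z x) (at x)" for x
      unfolding gauss_affine_def[abs_def] gauss_affine_deriv_def[abs_def]
      by (rule has_derivative_eq_rhs[OF has_derivative_mult[OF P E]]) (auto simp: algebra_simps)
    show "((\<lambda>x. gauss_affine_deriv A B a z x v) has_derivative gauss_affine_deriv2 A B a z x v) (at x)" for x v
      unfolding gauss_affine_deriv_def gauss_affine_deriv2_def[abs_def]
      by (rule has_derivative_eq_rhs[OF has_derivative_mult[OF R E]]) (auto simp: algebra_simps)
  qed
qed

lemma gauss_affine_bounds:
  assumes a: "a > 0"
  shows "\<exists>C\<ge>0. \<forall>x v k. \<bar>gauss_affine A B a z x\<bar> \<le> C * wt p x \<and> \<bar>gauss_affine_deriv A B a z x v\<bar> \<le> C * norm v * wt p x \<and>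
     \<bar>gauss_affine_deriv2 A B a z x v k\<bar> \<le> C * norm v * norm k * wt p x"
proof -
  obtain C where C: "C \<ge> 0" "\<And>x::'a. (1 + norm x) ^ 3 * exp (- a * (norm (x - z))\<^sup>2) \<le> C * wt p x"
    using gauss_wt_shift[OF a, of z] by blast
  define D where "D = \<bar>A\<bar> + norm B"
  define Y where "Y = 1 + norm z"
  \<comment> \<open>Sum of the coefficient bounds for the function and for its first and second
    derivatives, so that one constant serves all three.\<close>
  define K where "K = D + 2 * a * D * Y + (2 * a * D * Y + 2 * a * D + 2 * a * D * Y + 4 * a * a * D * Y * Y)"
  have D0: "D \<ge> 0" and Y0: "Y \<ge> 0" by (auto simp: D_def Y_def)
  have K0: "K \<ge> 0" "D \<le> K" "D + 2 * a * D * Y \<le> K" "2 * a * D * Y + 2 * a * D + 2 * a * D * Y + 4 * a * a * D * Y * Y \<le> K"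
    using D0 Y0 a by (auto simp: K_def)
  have main: "\<bar>gauss_affine A B a z x\<bar> \<le> (K * C) * wt p x \<and> \<bar>gauss_affine_deriv A B a z x v\<bar> \<le> (K * C) * norm v * wt p x \<and>
     \<bar>gauss_affine_deriv2 A B a z x v k\<bar> \<le> (K * C) * norm v * norm k * wt p x" for x v k
  proof -
    define P where "P = 1 + norm x"
    define E where "E = exp (- a * ((x - z) \<bullet> (x - z)))"
    have E0: "E > 0" by (simp add: E_def)
    have P1: "P \<ge> 1" by (simp add: P_def)
    then have "P ^ 0 \<le> P ^ 3" "P ^ 1 \<le> P ^ 3" "P ^ 2 \<le> P ^ 3" by (intro power_increasing; simp)+
    then have P2: "1 \<le> P ^ 3" "P \<le> P ^ 3" "P * P \<le> P ^ 3" "P * P * P = P ^ 3"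
      by (simp_all add: power2_eq_square power3_eq_cube)
    have P30: "0 \<le> P ^ 3" using P2(1) by linarith
    have PE: "P ^ 3 * E \<le> C * wt p x" using C(2)[of x] by (simp add: P_def E_def power2_norm_eq_inner)
    have fin: "m * n * E \<le> (K * C) * n * wt p x" if "m \<le> K * P ^ 3" "n \<ge> 0" for m n
    proof -
      have "m * n * E \<le> (K * P ^ 3) * n * E" using that E0 by (intro mult_right_mono) auto
      also have "\<dots> = (K * n) * (P ^ 3 * E)" by simp
      also have "\<dots> \<le> (K * n) * (C * wt p x)" using PE K0 that by (intro mult_left_mono) auto
      finally show ?thesis by (simp add: mult_ac)
    qed
    have b1: "\<bar>A + B \<bullet> x\<bar> \<le> D * P"
    proof -
      have "\<bar>A + B \<bullet> x\<bar> \<le> \<bar>A\<bar> + norm B * norm x" using Cauchy_Schwarz_ineq2[of B x] by linarith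
      also have "\<dots> \<le> D * P" by (simp add: D_def P_def algebra_simps)
      finally show ?thesis .
    qed
    have b2: "norm (x - z) \<le> Y * P"
    proof -
      have "norm (x - z) \<le> norm x + norm z" by (rule norm_triangle_ineq4)
      also have "\<dots> \<le> Y * P" by (simp add: Y_def P_def algebra_simps)
      finally show ?thesis .
    qed
    have b3: "\<bar>(x - z) \<bullet> w\<bar> \<le> Y * P * norm w" for w
      using order_trans[OF Cauchy_Schwarz_ineq2[of "x - z" w] mult_right_mono[OF b2]] by simp
    have b4: "\<bar>B \<bullet> w\<bar> \<le> D * norm w" for w
      using order_trans[OF Cauchy_Schwarz_ineq2[of B w] mult_right_mono[of "norm B" D]] by (simp add: D_def)
    have nn: "0 \<le> D * P" "0 \<le> Y * P" using D0 Y0 P1 by auto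
    have b5: "\<bar>B \<bullet> v + (- 2 * a) * ((A + B \<bullet> x) * ((x - z) \<bullet> v))\<bar> \<le> (D + 2 * a * D * Y * (P * P)) * norm v" for v
    proof -
      have "\<bar>B \<bullet> v + (- 2 * a) * ((A + B \<bullet> x) * ((x - z) \<bullet> v))\<bar> \<le> \<bar>B \<bullet> v\<bar> + 2 * a * (\<bar>A + B \<bullet> x\<bar> * \<bar>(x - z) \<bullet> v\<bar>)"
      proof -
        have "\<bar>(- 2 * a) * ((A + B \<bullet> x) * ((x - z) \<bullet> v))\<bar> = 2 * a * (\<bar>A + B \<bullet> x\<bar> * \<bar>(x - z) \<bullet> v\<bar>)"
          using a by (simp add: abs_mult)
        then show ?thesis using abs_triangle_ineq[of "B \<bullet> v" "(- 2 * a) * ((A + B \<bullet> x) * ((x - z) \<bullet> v))"] by linarith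
      qed
      also have "\<dots> \<le> D * norm v + 2 * a * ((D * P) * (Y * P * norm v))"
        using a nn by (intro add_mono mult_left_mono mult_mono b1 b3 b4) auto
      finally show ?thesis by (simp add: algebra_simps)
    qed
    have "\<bar>gauss_affine A B a z x\<bar> \<le> (D * P) * 1 * E"
      unfolding gauss_affine_def E_def[symmetric] abs_mult using b1 E0 by simp
    also have "\<dots> \<le> (K * C) * 1 * wt p x"
    proof (rule fin)
      have "0 \<le> P" using P1 by linarith
      then show "D * P \<le> K * P ^ 3" by (intro mult_mono K0 P2)
    qed simp
    finally have 1: "\<bar>gauss_affine A B a z x\<bar> \<le> (K * C) * wt p x" by simp
    have "\<bar>gauss_affine_deriv A B a z x v\<bar> \<le> (D + 2 * a * D * Y * (P * P)) * norm v * E"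
      unfolding gauss_affine_deriv_def E_def[symmetric] abs_mult using b5[of v] E0 by simp
    also have "\<dots> \<le> (K * C) * norm v * wt p x"
    proof (rule fin)
      have "D * 1 + 2 * a * D * Y * (P * P) \<le> D * P ^ 3 + 2 * a * D * Y * P ^ 3"
        using D0 Y0 a P2 by (intro add_mono mult_left_mono) auto
      also have "\<dots> = (D + 2 * a * D * Y) * P ^ 3" by (simp add: algebra_simps)
      also have "\<dots> \<le> K * P ^ 3" by (rule mult_right_mono[OF K0(3) P30])
      finally show "D + 2 * a * D * Y * (P * P) \<le> K * P ^ 3" by simp
    qed simp
    finally have 2: "\<bar>gauss_affine_deriv A B a z x v\<bar> \<le> (K * C) * norm v * wt p x" .
    let ?m = "2 * a * D * Y * P + 2 * a * D * P + (D + 2 * a * D * Y * (P * P)) * (2 * a * Y * P)"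
    have "\<bar>(- 2 * a) * ((B \<bullet> k) * ((x - z) \<bullet> v)) + (- 2 * a) * ((A + B \<bullet> x) * (k \<bullet> v))
     + (B \<bullet> v + (- 2 * a) * ((A + B \<bullet> x) * ((x - z) \<bullet> v))) * ((- 2 * a) * ((x - z) \<bullet> k))\<bar> \<le>
       2 * a * (\<bar>B \<bullet> k\<bar> * \<bar>(x - z) \<bullet> v\<bar>) + 2 * a * (\<bar>A + B \<bullet> x\<bar> * \<bar>k \<bullet> v\<bar>)
     + \<bar>B \<bullet> v + (- 2 * a) * ((A + B \<bullet> x) * ((x - z) \<bullet> v))\<bar> * (2 * a * \<bar>(x - z) \<bullet> k\<bar>)"
      by (rule order_trans[OF abs_triangle_ineq add_mono[OF order_trans[OF abs_triangle_ineq add_mono]]]) (use a in \<open>simp_all add: abs_mult\<close>)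
    also have "\<dots> \<le> 2 * a * ((D * norm k) * (Y * P * norm v)) + 2 * a * ((D * P) * (norm k * norm v))
     + ((D + 2 * a * D * Y * (P * P)) * norm v) * (2 * a * (Y * P * norm k))"
      using a nn D0 Y0 P1 by (intro add_mono mult_left_mono mult_mono b1 b3 b4 b5 Cauchy_Schwarz_ineq2) auto
    also have "\<dots> = ?m * (norm v * norm k)" by (simp add: algebra_simps)
    finally have "\<bar>gauss_affine_deriv2 A B a z x v k\<bar> \<le> ?m * (norm v * norm k) * E"
      unfolding gauss_affine_deriv2_def E_def[symmetric] abs_mult using E0 by simp
    also have "\<dots> \<le> (K * C) * (norm v * norm k) * wt p x"
    proof (rule fin)
      have "?m = 2 * a * D * Y * P + 2 * a * D * P + 2 * a * D * Y * P + 4 * a * a * D * Y * Y * (P * P * P)"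
        by (simp add: algebra_simps)
      also have "\<dots> \<le> 2 * a * D * Y * P ^ 3 + 2 * a * D * P ^ 3 + 2 * a * D * Y * P ^ 3 + 4 * a * a * D * Y * Y * P ^ 3"
        unfolding P2(4) using D0 Y0 a P2 by (intro add_mono mult_left_mono order_refl) auto
      also have "\<dots> = (2 * a * D * Y + 2 * a * D + 2 * a * D * Y + 4 * a * a * D * Y * Y) * P ^ 3" by (simp add: algebra_simps)
      also have "\<dots> \<le> K * P ^ 3" by (rule mult_right_mono[OF K0(4) P30])
      finally show "?m \<le> K * P ^ 3" .
    qed simp
    finally show ?thesis using 1 2 by (simp add: mult.assoc)
  qed
  moreover have "K * C \<ge> 0" using K0 C by simp
  ultimately show ?thesis by blast
qed

lemma gauss_affine_admissible: "a > 0 \<Longrightarrow> \<exists>C. admissible C (gauss_affine A B a z)"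
  using gauss_affine_bounds[of a A B z] admissible_of_second_deriv[OF gauss_affine_twice_diff, of A B a z] by metis

lemma smooth_fun_gauss_affine: "smooth_fun (gauss_affine A B a z)"
proof -
  have "gauss_affine A B a z = (\<lambda>x. (A + B \<bullet> x) * exp ((- a) * (x \<bullet> x) + ((2 * a) * (z \<bullet> x) + (- a * (z \<bullet> z)))))"
    by (auto simp: gauss_affine_def algebra_simps inner_commute)
  moreover have "smooth_fun \<dots>"
    by (intro smooth_fun_mult smooth_fun_add smooth_fun_const smooth_fun_compose[OF smooth_fun_exp] smooth_fun_inner_self
       smooth_fun_linear bounded_linear_inner_right)
  ultimately show ?thesis by simp
qed

lemma heat_eq_gauss_affine: "(\<lambda>x. heat t (x - z)) = gauss_affine (t powr -(real DIM('a)/2)) 0 (1/(4*t)) z"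
  by (auto simp: gauss_affine_def heat_eq power2_norm_eq_inner)

lemma heat_admissible: "t > 0 \<Longrightarrow> \<exists>C. admissible C (\<lambda>x. heat t (x - z))" for z :: 'a
  unfolding heat_eq_gauss_affine by (rule gauss_affine_admissible) simp

end

context tail_fun
begin

definition heat_ext :: "real \<Rightarrow> 'a \<Rightarrow> real" where
  "heat_ext t z = (\<integral>x. u x * heat t (x - z) \<partial>lborel)"

lemma heat_ext_integrable:
  assumes "t > 0"
  shows "integrable lborel (\<lambda>x. u x * heat t (x - z))"
proof -
  obtain C where "admissible C (\<lambda>x. heat t (x - z))" using heat_admissible[OF assms] by blast
  then show ?thesis by (intro integrable_u_bound[where B=C]) (auto simp: admissible_def)
qed

text \<open>Subordination is inserted into \<open>flap\<close>, and the order of integration is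
  changed twice: in \<open>(h, \<tau>)\<close> at fixed \<open>x\<close>, where the \<open>h\<close>
  integral is \<open>second_diff_heat_integral\<close>, and then in \<open>(x, \<tau>)\<close>. That
  formula is the source of the factor \<open>2 * gauss_mass\<close> and of the sign.\<close>

lemma heat_ext_marchaud:
  assumes t: "t > 0"
  shows "has_bochner_integral lborel (\<lambda>\<tau>. indicator {0<..} \<tau> * (\<tau> powr (-1 - s) * (heat_ext t z - heat_ext (t + \<tau>) z))) (- (subordination_const / (2 * gauss_mass)) * pairing (\<lambda>x. heat t (x - z)))"
proof -
  define f where "f x = heat t (x - z)" for x
  obtain A where admissible: "admissible A f" using heat_admissible[OF t] unfolding f_def[abs_def] by blast
  note [measurable] = admissible_measurable[OF admissible]
  define k where "k h = norm h powr -p" for h :: 'a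
  \<comment> \<open>Multiplied by \<open>norm h powr p\<close>, the subordination kernel has the
    same mass for every \<open>h \<noteq> 0\<close>, the shape that
    \<open>integrable_times_kernel\<close> requires.\<close>
  define K where "K h \<tau> = (if h = 0 then 0 else norm h powr p * (indicator {0<..} \<tau> * (\<tau> powr (-1 - s) * heat \<tau> h)))" for h :: 'a and \<tau>
  have [measurable]: "k \<in> borel_measurable borel" unfolding k_def[abs_def] by measurable
  have Km [measurable]: "(\<lambda>(h, \<tau>). K h \<tau>) \<in> borel_measurable (borel \<Otimes>\<^sub>M borel)"
    unfolding K_def by measurable
  have K0: "0 \<le> K h \<tau>" for h \<tau> by (simp add: K_def)
  have Kc: "has_bochner_integral lborel (K h) subordination_const" if "h \<noteq> 0" for h
  proof -
    have "norm h powr p * (subordination_const * norm h powr -p) = subordination_const" using that by (simp add: powr_minus)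
    with has_bochner_integral_mult_right[OF kernel_subordination[OF that], of "norm h powr p"] that
    show ?thesis by (simp add: K_def[abs_def])
  qed
  define R where "R x \<tau> = indicator {0<..} \<tau> * (\<tau> powr (-1 - s) * (2 * gauss_mass * (heat (t + \<tau>) (x - z) - heat t (x - z))))" for x \<tau>
  have R_meas [measurable]: "(\<lambda>(x, \<tau>). R x \<tau>) \<in> borel_measurable (borel \<Otimes>\<^sub>M borel)"
    unfolding R_def by measurable
  have step1: "integrable lborel (R x) \<and> (\<integral>\<tau>. R x \<tau> \<partial>lborel) = subordination_const * flap f x \<and> (\<integral>\<tau>. \<bar>R x \<tau>\<bar> \<partial>lborel) \<le> subordination_const * (A * majorant_mass * wt p x)" for x
  proof -
    let ?g = "\<lambda>h. second_diff f x h * k h"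
    have gi: "integrable lborel ?g" unfolding k_def by (rule admissible_integrable(1)[OF admissible])
    have g0: "has_bochner_integral lborel (K h) subordination_const" if "?g h \<noteq> 0" for h
      using that by (intro Kc) (auto simp: k_def)
    note I = integrable_times_kernel[OF gi Km K0 g0]
    have "?g 0 = 0" by (simp add: k_def)
    have gK: "?g h * K h \<tau> = indicator {0<..} \<tau> * (\<tau> powr (-1 - s) * (second_diff f x h * heat \<tau> h))" for h \<tau>
    proof (cases "h = 0")
      case True then show ?thesis by (simp add: second_diff_def)
    next
      case False
      then have "k h * norm h powr p = 1" by (simp add: k_def powr_minus)
      then have "second_diff f x h * (k h * norm h powr p) * (indicator {0<..} \<tau> * (\<tau> powr (-1 - s) * heat \<tau> h)) = indicator {0<..} \<tau> * (\<tau> powr (-1 - s) * (second_diff f x h * heat \<tau> h))"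
        by simp
      then show ?thesis using False by (simp add: K_def mult_ac)
    qed
    have R: "(\<integral>h. ?g h * K h \<tau> \<partial>lborel) = R x \<tau>" for \<tau>
    proof (cases "\<tau> > 0")
      case True
      have "(\<integral>h. second_diff f x h * heat \<tau> h \<partial>lborel) = 2 * gauss_mass * (heat (t + \<tau>) (x - z) - heat t (x - z))"
        using second_diff_heat_integral[OF t True, of z x] unfolding f_def[symmetric] by (simp add: has_bochner_integral_iff)
      then show ?thesis unfolding gK by (simp add: R_def)
    qed (simp add: R_def gK)
    have r1: "integrable lborel (R x)" using lborel_pair.integrable_snd[OF I(1)] unfolding R .
    have r2: "(\<integral>\<tau>. R x \<tau> \<partial>lborel) = subordination_const * flap f x"
    proof -
      have "(\<integral>\<tau>. R x \<tau> \<partial>lborel) = (\<integral>\<tau>. (\<integral>h. ?g h * K h \<tau> \<partial>lborel) \<partial>lborel)" by (simp only: R)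
      also have "\<dots> = subordination_const * (\<integral>h. ?g h \<partial>lborel)" using lborel_pair.integral_snd[OF I(1)] I(2) by simp
      finally show ?thesis by (simp add: flap_def k_def)
    qed
    have gi': "integrable lborel (\<lambda>h. \<bar>?g h\<bar>)" using gi by (rule integrable_abs)
    have g0': "has_bochner_integral lborel (K h) subordination_const" if "\<bar>?g h\<bar> \<noteq> 0" for h
      using that by (intro Kc) (auto simp: k_def)
    note J = integrable_times_kernel[OF gi' Km K0 g0']
    have "(\<integral>\<tau>. \<bar>R x \<tau>\<bar> \<partial>lborel) \<le> (\<integral>\<tau>. (\<integral>h. \<bar>?g h\<bar> * K h \<tau> \<partial>lborel) \<partial>lborel)"
    proof (rule integral_mono[OF integrable_abs[OF r1] lborel_pair.integrable_snd[OF J(1)]])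
      fix \<tau> :: real
      have "\<bar>R x \<tau>\<bar> \<le> (\<integral>h. \<bar>?g h * K h \<tau>\<bar> \<partial>lborel)" unfolding R[symmetric] by (rule integral_abs_bound)
      then show "\<bar>R x \<tau>\<bar> \<le> (\<integral>h. \<bar>?g h\<bar> * K h \<tau> \<partial>lborel)" using K0 by (simp add: abs_mult)
    qed
    also have "\<dots> = subordination_const * (\<integral>h. \<bar>?g h\<bar> \<partial>lborel)" using lborel_pair.integral_snd[OF J(1)] J(2) by simp
    also have "\<dots> \<le> subordination_const * (A * majorant_mass * wt p x)"
      using admissible_integrable(2)[OF admissible, of x] subordination_const_pos by (intro mult_left_mono) (auto simp: k_def abs_mult)
    finally show ?thesis using r1 r2 by simp
  qed
  have I2: "integrable (lborel \<Otimes>\<^sub>M lborel) (\<lambda>(x, \<tau>). u x * R x \<tau>)"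
  proof (rule lborel_pair.Fubini_integrable)
    show "(\<lambda>(x, \<tau>). u x * R x \<tau>) \<in> borel_measurable (lborel \<Otimes>\<^sub>M lborel)" by measurable
    show "AE x in lborel. integrable lborel (\<lambda>\<tau>. case (x, \<tau>) of (x, \<tau>) \<Rightarrow> u x * R x \<tau>)"
      using step1 by (auto intro!: AE_I2)
    show "integrable lborel (\<lambda>x. \<integral>\<tau>. norm (case (x, \<tau>) of (x, \<tau>) \<Rightarrow> u x * R x \<tau>) \<partial>lborel)"
    proof (rule Bochner_Integration.integrable_bound)
      show "integrable lborel (\<lambda>x. subordination_const * A * majorant_mass * (\<bar>u x\<bar> * wt p x))" using u_tail by simp
      show "AE x in lborel. norm (\<integral>\<tau>. norm (case (x, \<tau>) of (x, \<tau>) \<Rightarrow> u x * R x \<tau>) \<partial>lborel) \<le> norm (subordination_const * A * majorant_mass * (\<bar>u x\<bar> * wt p x))"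
      proof (rule AE_I2)
        fix x
        have "norm (\<integral>\<tau>. norm (case (x, \<tau>) of (x, \<tau>) \<Rightarrow> u x * R x \<tau>) \<partial>lborel) = \<bar>u x\<bar> * (\<integral>\<tau>. \<bar>R x \<tau>\<bar> \<partial>lborel)"
          by (simp add: abs_mult)
        also have "\<dots> \<le> \<bar>u x\<bar> * (subordination_const * (A * majorant_mass * wt p x))" using step1[of x] by (intro mult_left_mono) auto
        also have "\<dots> \<le> norm (subordination_const * A * majorant_mass * (\<bar>u x\<bar> * wt p x))" by (simp add: mult_ac)
        finally show "norm (\<integral>\<tau>. norm (case (x, \<tau>) of (x, \<tau>) \<Rightarrow> u x * R x \<tau>) \<partial>lborel) \<le> norm (subordination_const * A * majorant_mass * (\<bar>u x\<bar> * wt p x))" .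
      qed
    qed measurable
  qed
  have "(\<integral>x. \<integral>\<tau>. u x * R x \<tau> \<partial>lborel \<partial>lborel) = subordination_const * pairing f"
    using step1 by (simp add: pairing_def mult.left_commute)
  then have tot: "(\<integral>\<tau>. \<integral>x. u x * R x \<tau> \<partial>lborel \<partial>lborel) = subordination_const * pairing f"
    using lborel_pair.integral_fst[OF I2] lborel_pair.integral_snd[OF I2] by simp
  have inner: "(\<integral>x. u x * R x \<tau> \<partial>lborel) = - (2 * gauss_mass) * (indicator {0<..} \<tau> * (\<tau> powr (-1 - s) * (heat_ext t z - heat_ext (t + \<tau>) z)))" for \<tau>
  proof (cases "\<tau> > 0")
    case True
    have "(\<integral>x. u x * R x \<tau> \<partial>lborel) = (\<integral>x. (\<tau> powr (-1 - s) * (2 * gauss_mass)) * (u x * heat (t + \<tau>) (x - z) - u x * heat t (x - z)) \<partial>lborel)"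
      using True by (intro Bochner_Integration.integral_cong refl) (simp add: R_def algebra_simps)
    also have "\<dots> = (\<tau> powr (-1 - s) * (2 * gauss_mass)) * (heat_ext (t + \<tau>) z - heat_ext t z)"
      using True t by (simp add: heat_ext_def heat_ext_integrable)
    finally show ?thesis using True by (simp add: algebra_simps)
  qed (simp add: R_def)
  have "has_bochner_integral lborel (\<lambda>\<tau>. - (2 * gauss_mass) * (indicator {0<..} \<tau> * (\<tau> powr (-1 - s) * (heat_ext t z - heat_ext (t + \<tau>) z)))) (subordination_const * pairing f)"
    unfolding has_bochner_integral_iff using lborel_pair.integrable_snd[OF I2] tot unfolding inner by simp
  from has_bochner_integral_mult_right[OF this, of "- (1 / (2 * gauss_mass))"] gauss_mass_pos
  show ?thesis unfolding f_def[abs_def] by simp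
qed

end

section \<open>Point sources at the origin\<close>

context harmonic_off_0
begin

text \<open>The reference Gaussian \<open>exp (-|x|^2)\<close>, times \<open>1\<close> or times a
  linear function, reads off the coefficients of the point mass at \<open>0\<close> and of its first
  derivatives in the distribution that \<open>pairing\<close> represents.\<close>

definition monopole :: real where "monopole = pairing (gauss_affine 1 0 1 0)"
definition dipole :: "'a \<Rightarrow> real" where "dipole z = pairing (gauss_affine 0 z 1 0)"

lemma linear_dipole: "linear dipole"
proof (rule linearI)
  fix y z :: 'a and c :: real
  have admissible: "\<exists>C. admissible C (gauss_affine 0 w 1 0)" for w by (rule gauss_affine_admissible) simp
  have "gauss_affine 0 (y + z) 1 0 = (\<lambda>x. gauss_affine 0 y 1 0 x + gauss_affine 0 z 1 0 x)" by (auto simp: gauss_affine_def algebra_simps inner_add_left)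
  then show "dipole (y + z) = dipole y + dipole z" unfolding dipole_def using admissible[of y] admissible[of z] pairing_add by metis
  have "gauss_affine 0 (c *\<^sub>R z) 1 0 = (\<lambda>x. c * gauss_affine 0 z 1 0 x)" by (auto simp: gauss_affine_def)
  then show "dipole (c *\<^sub>R z) = c *\<^sub>R dipole z" unfolding dipole_def by (simp add: pairing_cmult)
qed

lemma pairing_heat:
  assumes t: "t > 0"
  shows "pairing (\<lambda>x. heat t (x - z)) = monopole * Theta (real DIM('a)/2) ((norm z)\<^sup>2) t + dipole z / 2 * Theta (real DIM('a)/2 + 1) ((norm z)\<^sup>2) t"
proof -
  define H where "H = heat t z"
  define A1 where "A1 = t powr -(real DIM('a)/2)"
  \<comment> \<open>At \<open>x = 0\<close> the gradient of \<open>heat t (x - z)\<close> is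
    \<open>z / (2 * t)\<close> times its value there; this choice makes \<open>g\<close> vanish to
    second order.\<close>
  define B2 where "B2 = (H / (2 * t)) *\<^sub>R z"
  let ?f1 = "gauss_affine A1 0 (1/(4*t)) z" and ?f2 = "gauss_affine H B2 1 0"
  define g where "g x = ?f1 x - ?f2 x" for x
  define g1 where "g1 x v = gauss_affine_deriv A1 0 (1/(4*t)) z x v - gauss_affine_deriv H B2 1 0 x v" for x v
  define g2 where "g2 x v k = gauss_affine_deriv2 A1 0 (1/(4*t)) z x v k - gauss_affine_deriv2 H B2 1 0 x v k" for x v k
  have td: "twice_diff g g1 g2"
    using gauss_affine_twice_diff[of A1 0 "1/(4*t)" z] gauss_affine_twice_diff[of H B2 1 0]
    unfolding twice_diff_def g_def[abs_def] g1_def[abs_def] g2_def[abs_def] by (auto intro!: has_derivative_diff)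
  have "1/(4*t) > 0" using t by simp
  from gauss_affine_bounds[OF this, of A1 0 z] obtain C1 where C1: "C1 \<ge> 0" "\<And>x v k. \<bar>?f1 x\<bar> \<le> C1 * wt p x" "\<And>x v. \<bar>gauss_affine_deriv A1 0 (1/(4*t)) z x v\<bar> \<le> C1 * norm v * wt p x"
     "\<And>x v k. \<bar>gauss_affine_deriv2 A1 0 (1/(4*t)) z x v k\<bar> \<le> C1 * norm v * norm k * wt p x" by blast
  from gauss_affine_bounds[of 1 H B2 0] obtain C2 where C2: "C2 \<ge> 0" "\<And>x v k. \<bar>?f2 x\<bar> \<le> C2 * wt p x" "\<And>x v. \<bar>gauss_affine_deriv H B2 1 0 x v\<bar> \<le> C2 * norm v * wt p x"
     "\<And>x v k. \<bar>gauss_affine_deriv2 H B2 1 0 x v k\<bar> \<le> C2 * norm v * norm k * wt p x" by auto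
  have "flat_at_0 (2 powr p * (C1 + C2)) g g1 g2"
  proof (rule flat_at_0_of_vanishing[OF td])
    show "0 \<le> C1 + C2" using C1 C2 by simp
    show "\<bar>g x\<bar> \<le> (C1 + C2) * wt p x" for x using C1(2)[of x] C2(2)[of x] unfolding g_def distrib_right by linarith
    show "\<bar>g1 x v\<bar> \<le> (C1 + C2) * norm v * wt p x" for x v using C1(3)[of x v] C2(3)[of x v] unfolding g1_def distrib_right by linarith
    show "\<bar>g2 x v k\<bar> \<le> (C1 + C2) * norm v * norm k * wt p x" for x v k using C1(4)[of x v k] C2(4)[of x v k] unfolding g2_def distrib_right by linarith
    have H: "H = A1 * exp (- (1/(4*t)) * ((0 - z) \<bullet> (0 - z)))" by (simp add: H_def A1_def heat_eq power2_norm_eq_inner)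
    show "g 0 = 0" unfolding g_def gauss_affine_def using H by simp
    show "g1 0 v = 0" for v
    proof -
      have "gauss_affine_deriv A1 0 (1/(4*t)) z 0 v = (z \<bullet> v) / (2 * t) * (A1 * exp (- (1/(4*t)) * ((0 - z) \<bullet> (0 - z))))"
        using t by (simp add: gauss_affine_deriv_def)
      also have "\<dots> = (z \<bullet> v) / (2 * t) * H" unfolding H ..
      also have "\<dots> = gauss_affine_deriv H B2 1 0 0 v" by (simp add: gauss_affine_deriv_def B2_def)
      finally show ?thesis by (simp add: g1_def)
    qed
  qed
  moreover have "smooth_fun g"
  proof -
    have "g = (\<lambda>x. ?f1 x + (-1) * ?f2 x)" by (auto simp: g_def)
    moreover have "smooth_fun \<dots>" by (intro smooth_fun_add smooth_fun_mult smooth_fun_const smooth_fun_gauss_affine)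
    ultimately show ?thesis by simp
  qed
  ultimately have Tg: "pairing g = 0" and gauss_affine: "\<exists>C. admissible C g" using pairing_flat_at_0 flat_admissible by blast+
  have admissible: "\<exists>C. admissible C (gauss_affine A B 1 0)" for A B by (rule gauss_affine_admissible) simp
  have "(\<lambda>x. heat t (x - z)) = (\<lambda>x. g x + ?f2 x)" unfolding heat_eq_gauss_affine g_def A1_def by simp
  then have "pairing (\<lambda>x. heat t (x - z)) = pairing g + pairing ?f2" using gauss_affine admissible pairing_add by metis
  also have "?f2 = (\<lambda>x. gauss_affine H 0 1 0 x + gauss_affine 0 B2 1 0 x)" by (auto simp: gauss_affine_def algebra_simps)
  also have "pairing (\<lambda>x. gauss_affine H 0 1 0 x + gauss_affine 0 B2 1 0 x) = pairing (gauss_affine H 0 1 0) + pairing (gauss_affine 0 B2 1 0)" using admissible pairing_add by metis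
  also have "gauss_affine H 0 1 0 = (\<lambda>x. H * gauss_affine 1 0 1 0 x)" by (auto simp: gauss_affine_def)
  also have "pairing (\<lambda>x. H * gauss_affine 1 0 1 0 x) = H * monopole" unfolding monopole_def by (rule pairing_cmult)
  also have "pairing (gauss_affine 0 B2 1 0) = H / (2 * t) * dipole z"
    using linear_scale[OF linear_dipole, of "H / (2 * t)" z] by (simp add: dipole_def[symmetric] B2_def)
  finally have "pairing (\<lambda>x. heat t (x - z)) = H * monopole + H / (2 * t) * dipole z" using Tg by simp
  then have TH: "pairing (\<lambda>x. heat t (x - z)) = monopole * H + dipole z / 2 * (H / t)" by simp
  have H1: "H = Theta (real DIM('a)/2) ((norm z)\<^sup>2) t" by (simp add: H_def heat_def)
  have H2: "H / t = Theta (real DIM('a)/2 + 1) ((norm z)\<^sup>2) t"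
  proof -
    have "- (real DIM('a)/2 + 1) = - (real DIM('a)/2) + - 1" by simp
    then have e: "t powr - (real DIM('a)/2 + 1) = t powr - (real DIM('a)/2) * t powr - 1" by (simp only: powr_add)
    have "t powr - 1 = 1 / t" using t by (simp add: powr_minus field_simps)
    then show ?thesis unfolding H_def heat_def Theta_def e by simp
  qed
  show ?thesis unfolding TH H2 unfolding H1 ..
qed

end

section \<open>Abel integrals of inverse-gamma densities\<close>

text \<open>The right-hand side is free of \<open>t\<close>: up to \<open>1\<close> it uses a
  uniform bound \<open>B\<close> for \<open>Theta\<close>, beyond \<open>1\<close> the decay in
  \<open>r\<close>. \<open>B\<close> is left open because it has two sources, a positive lower bound
  on time or \<open>q > 0\<close>.\<close>

lemma Theta_abel_bound:
  assumes \<alpha>: "\<alpha> \<ge> 0" and q: "q \<ge> 0" and t: "0 \<le> t" and B: "\<And>r. r > 0 \<Longrightarrow> t \<le> r \<Longrightarrow> Theta \<alpha> q r \<le> B" and \<tau>: "\<tau> > 0"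
  shows "\<tau> powr (s - 1) * Theta \<alpha> q (t + \<tau>) \<le> (if \<tau> \<le> 1 then B * \<tau> powr (s - 1) else \<tau> powr - (1 + \<alpha> - s))"
proof (cases "\<tau> \<le> 1")
  case True
  have "\<tau> powr (s - 1) * Theta \<alpha> q (t + \<tau>) \<le> \<tau> powr (s - 1) * B"
    using t \<tau> by (intro mult_left_mono B) auto
  then show ?thesis using True by (simp add: mult.commute)
next
  case False
  have "Theta \<alpha> q (t + \<tau>) \<le> (t + \<tau>) powr - \<alpha>" using q t \<tau> by (intro Theta_le) auto
  also have "\<dots> \<le> \<tau> powr - \<alpha>" using \<alpha> t \<tau> by (intro powr_mono2') auto
  finally have "\<tau> powr (s - 1) * Theta \<alpha> q (t + \<tau>) \<le> \<tau> powr (s - 1) * \<tau> powr - \<alpha>" by (intro mult_left_mono) auto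
  also have "\<dots> = \<tau> powr - (1 + \<alpha> - s)"
  proof -
    have "(s - 1) + - \<alpha> = - (1 + \<alpha> - s)" by simp
    then show ?thesis unfolding powr_add[symmetric] by (rule arg_cong)
  qed
  finally show ?thesis using False by simp
qed

text \<open>At infinity the exponent \<open>1 + \<alpha> - s\<close> exceeds \<open>1\<close>
  because \<open>\<alpha> \<ge> 1 > s\<close>. In the application \<open>\<alpha>\<close> is
  \<open>n/2\<close> or \<open>n/2 + 1\<close>, so this is where the dimension enters the Abel
  integrals.\<close>

lemma integrable_abel_dom:
  fixes s :: real
  assumes "0 < s" "s < 1" "\<alpha> \<ge> 1"
  shows "integrable lborel (\<lambda>\<tau>. indicator {0<..} \<tau> * (if \<tau> \<le> 1 then B * \<tau> powr (s - 1) else \<tau> powr - (1 + \<alpha> - s)))"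
proof (rule integrable_Ioi_bound[where a="s-1" and b="1 + \<alpha> - s" and B="\<bar>B\<bar>" and C="1 + \<bar>B\<bar>"])
  fix r :: real
  show "\<bar>if r \<le> 1 then B * r powr (s - 1) else r powr - (1 + \<alpha> - s)\<bar> \<le> \<bar>B\<bar> * r powr (s - 1)" if "0 < r" "r \<le> 1"
    using that by (simp add: abs_mult)
  show "\<bar>if r \<le> 1 then B * r powr (s - 1) else r powr - (1 + \<alpha> - s)\<bar> \<le> (1 + \<bar>B\<bar>) * r powr - (1 + \<alpha> - s)" if "1 \<le> r"
  proof (cases "r = 1")
    case False
    have "0 \<le> \<bar>B\<bar> * r powr - (1 + \<alpha> - s)" by simp
    then show ?thesis using that False unfolding distrib_right by simp
  qed simp
qed (use assms in auto)

lemma AbelInt_Theta_integrable: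
  assumes s: "0 < s" "s < 1" and \<alpha>: "\<alpha> \<ge> 1" and q: "q \<ge> 0" and t: "0 \<le> t" and B: "\<And>r. r > 0 \<Longrightarrow> t \<le> r \<Longrightarrow> Theta \<alpha> q r \<le> B"
  shows "integrable lborel (\<lambda>\<tau>. indicator {0<..} \<tau> * (\<tau> powr (s - 1) * Theta \<alpha> q (t + \<tau>)))"
proof (rule Bochner_Integration.integrable_bound[OF integrable_abel_dom[OF s \<alpha>, of B]])
  show "AE \<tau> in lborel. norm (indicator {0<..} \<tau> * (\<tau> powr (s - 1) * Theta \<alpha> q (t + \<tau>))) \<le>
     norm (indicator {0<..} \<tau> * (if \<tau> \<le> 1 then B * \<tau> powr (s - 1) else \<tau> powr - (1 + \<alpha> - s)))"
  proof (rule AE_I2)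
    fix \<tau> :: real
    show "norm (indicator {0<..} \<tau> * (\<tau> powr (s - 1) * Theta \<alpha> q (t + \<tau>))) \<le>
     norm (indicator {0<..} \<tau> * (if \<tau> \<le> 1 then B * \<tau> powr (s - 1) else \<tau> powr - (1 + \<alpha> - s)))"
      using order_trans[OF Theta_abel_bound[of \<alpha> q t B \<tau> s] abs_ge_self] \<alpha> q t B
      by (cases "\<tau> > 0") (auto simp: abs_mult)
  qed
qed measurable

text \<open>One dominated convergence statement behind three limits: continuity at positive times,
  decay at large times, and the limit at time zero.\<close>

lemma AbelInt_Theta_tendsto:
  assumes s: "0 < s" "s < 1" and \<alpha>: "\<alpha> \<ge> 1" and q: "q \<ge> 0" and t0: "0 \<le> t0" and B: "\<And>r. r > 0 \<Longrightarrow> t0 \<le> r \<Longrightarrow> Theta \<alpha> q r \<le> B"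
    and X: "\<And>n. t0 \<le> X n" and lim: "\<And>\<tau>. \<tau> > 0 \<Longrightarrow> (\<lambda>n. Theta \<alpha> q (X n + \<tau>)) \<longlonglongrightarrow> F \<tau>" and [measurable]: "F \<in> borel_measurable borel"
  shows "(\<lambda>n. AbelInt s (Theta \<alpha> q) (X n)) \<longlonglongrightarrow> (\<integral>\<tau>. indicator {0<..} \<tau> * (\<tau> powr (s - 1) * F \<tau>) \<partial>lborel)"
  unfolding AbelInt_def
proof (rule integral_dominated_convergence[OF _ _ integrable_abel_dom[OF s \<alpha>, of B]])
  show "AE \<tau> in lborel. (\<lambda>n. indicator {0<..} \<tau> * (\<tau> powr (s - 1) * Theta \<alpha> q (X n + \<tau>))) \<longlonglongrightarrow> indicator {0<..} \<tau> * (\<tau> powr (s - 1) * F \<tau>)"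
  proof (rule AE_I2)
    fix \<tau> :: real
    show "(\<lambda>n. indicator {0<..} \<tau> * (\<tau> powr (s - 1) * Theta \<alpha> q (X n + \<tau>))) \<longlonglongrightarrow> indicator {0<..} \<tau> * (\<tau> powr (s - 1) * F \<tau>)"
      by (cases "\<tau> > 0") (auto intro!: tendsto_intros lim)
  qed
  show "AE \<tau> in lborel. norm (indicator {0<..} \<tau> * (\<tau> powr (s - 1) * Theta \<alpha> q (X n + \<tau>))) \<le>
     indicator {0<..} \<tau> * (if \<tau> \<le> 1 then B * \<tau> powr (s - 1) else \<tau> powr - (1 + \<alpha> - s))" for n
  proof (rule AE_I2)
    fix \<tau> :: real
    have "\<tau> powr (s - 1) * Theta \<alpha> q (X n + \<tau>) \<le> (if \<tau> \<le> 1 then B * \<tau> powr (s - 1) else \<tau> powr - (1 + \<alpha> - s))" if "\<tau> > 0"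
      by (rule Theta_abel_bound) (use \<alpha> q t0 X[of n] B that in auto)
    then show "norm (indicator {0<..} \<tau> * (\<tau> powr (s - 1) * Theta \<alpha> q (X n + \<tau>))) \<le>
     indicator {0<..} \<tau> * (if \<tau> \<le> 1 then B * \<tau> powr (s - 1) else \<tau> powr - (1 + \<alpha> - s))"
      by (cases "\<tau> > 0") (auto simp: abs_mult)
  qed
qed measurable

lemma Theta_le_powr: "\<alpha> \<ge> 0 \<Longrightarrow> q \<ge> 0 \<Longrightarrow> 0 < t \<Longrightarrow> t \<le> r \<Longrightarrow> Theta \<alpha> q r \<le> t powr -\<alpha>"
  by (rule order_trans[OF Theta_le powr_mono2']) auto

lemma Theta_at_top:
  assumes "\<alpha> > 0" "q \<ge> 0"
  shows "(Theta \<alpha> q \<longlongrightarrow> 0) at_top"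
proof (rule tendsto_sandwich[OF _ _ tendsto_const])
  show "((\<lambda>r. r powr -\<alpha>) \<longlongrightarrow> 0) at_top" using assms by (intro tendsto_neg_powr filterlim_ident) auto
  show "eventually (\<lambda>r. Theta \<alpha> q r \<le> r powr -\<alpha>) at_top"
    using eventually_gt_at_top[of 0] by eventually_elim (use assms Theta_le in auto)
qed simp

lemma AbelInt_Theta_cont:
  assumes s: "0 < s" "s < 1" and \<alpha>: "\<alpha> \<ge> 1" and q: "q \<ge> 0"
  shows "continuous_on {0<..} (AbelInt s (Theta \<alpha> q))"
  unfolding continuous_on_sequentially comp_def
proof (intro ballI allI impI, elim conjE)
  fix t and X :: "nat \<Rightarrow> real"
  assume t: "t \<in> {0<..}" and X: "\<forall>n. X n \<in> {0<..}" "X \<longlonglongrightarrow> t"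
  have "eventually (\<lambda>n. t / 2 < X n) sequentially" using X(2) t by (intro order_tendstoD) auto
  then obtain N where N: "\<And>n. n \<ge> N \<Longrightarrow> t / 2 < X n" by (auto simp: eventually_sequentially)
  have "(\<lambda>n. AbelInt s (Theta \<alpha> q) (X (n + N))) \<longlonglongrightarrow> (\<integral>\<tau>. indicator {0<..} \<tau> * (\<tau> powr (s - 1) * Theta \<alpha> q (t + \<tau>)) \<partial>lborel)"
  proof (rule AbelInt_Theta_tendsto[OF s \<alpha> q, of "t/2" "(t/2) powr -\<alpha>"])
    show "Theta \<alpha> q r \<le> (t/2) powr -\<alpha>" if "t / 2 \<le> r" for r by (rule Theta_le_powr) (use \<alpha> q t that in auto)
    show "t / 2 \<le> X (n + N)" for n using N[of "n + N"] by simp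
    fix \<tau> :: real assume "\<tau> > 0"
    then have "isCont (Theta \<alpha> q) (t + \<tau>)" using t by (intro Theta_isCont) auto
    moreover have "(\<lambda>n. X (n + N) + \<tau>) \<longlonglongrightarrow> t + \<tau>" by (intro tendsto_intros LIMSEQ_ignore_initial_segment X)
    ultimately show "(\<lambda>n. Theta \<alpha> q (X (n + N) + \<tau>)) \<longlonglongrightarrow> Theta \<alpha> q (t + \<tau>)" by (rule isCont_tendsto_compose)
  qed (use t in auto)
  then show "(\<lambda>n. AbelInt s (Theta \<alpha> q) (X n)) \<longlonglongrightarrow> AbelInt s (Theta \<alpha> q) t"
    unfolding AbelInt_def[of s "Theta \<alpha> q" t] by (rule LIMSEQ_offset)
qed

lemma AbelInt_Theta_at_top:
  assumes s: "0 < s" "s < 1" and \<alpha>: "\<alpha> \<ge> 1" and q: "q \<ge> 0"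
  shows "(AbelInt s (Theta \<alpha> q) \<longlongrightarrow> 0) at_top"
proof (rule tendsto_at_topI_sequentially)
  fix X :: "nat \<Rightarrow> real" assume X: "filterlim X at_top sequentially"
  then have "eventually (\<lambda>n. 1 \<le> X n) sequentially" by (simp add: filterlim_at_top)
  then obtain N where N: "\<And>n. n \<ge> N \<Longrightarrow> 1 \<le> X n" by (auto simp: eventually_sequentially)
  have "(\<lambda>n. AbelInt s (Theta \<alpha> q) (X (n + N))) \<longlonglongrightarrow> (\<integral>\<tau>. indicator {0<..} \<tau> * (\<tau> powr (s - 1) * 0) \<partial>lborel)"
  proof (rule AbelInt_Theta_tendsto[OF s \<alpha> q, of "1" "1 powr -\<alpha>"])
    show "Theta \<alpha> q r \<le> 1 powr -\<alpha>" if "1 \<le> r" for r by (rule Theta_le_powr) (use \<alpha> q that in auto)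
    show "1 \<le> X (n + N)" for n using N[of "n + N"] by simp
    fix \<tau> :: real assume "\<tau> > 0"
    have "filterlim (\<lambda>n. X (n + N)) at_top sequentially" by (rule filterlim_compose[OF X filterlim_add_const_nat_at_top])
    then have "filterlim (\<lambda>n. X (n + N) + \<tau>) at_top sequentially"
      by (rule filterlim_at_top_mono) (use \<open>\<tau> > 0\<close> in auto)
    then show "(\<lambda>n. Theta \<alpha> q (X (n + N) + \<tau>)) \<longlonglongrightarrow> 0" using \<alpha> q by (intro filterlim_compose[OF Theta_at_top]) auto
  qed auto
  then show "(\<lambda>n. AbelInt s (Theta \<alpha> q) (X n)) \<longlonglongrightarrow> 0" unfolding mult_zero_right Bochner_Integration.integral_zero by (rule LIMSEQ_offset)
qed

text \<open>In the limit \<open>\<tau> powr (s - 1)\<close> merges with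
  \<open>Theta \<alpha> q \<tau>\<close> into \<open>Theta (\<alpha> + 1 - s) q \<tau>\<close>,
  whose scaling in \<open>q\<close> produces the power. With \<open>q = |z|^2\<close> and
  \<open>\<alpha> = n/2\<close> it is \<open>|z| powr (2 * s - n)\<close>, the profile of the
  fundamental solution.\<close>

lemma AbelInt_Theta_0:
  assumes s: "0 < s" "s < 1" and \<alpha>: "\<alpha> \<ge> 1" and q: "q > 0" and X: "\<And>n. X n > 0" "X \<longlonglongrightarrow> 0"
  shows "(\<lambda>n. AbelInt s (Theta \<alpha> q) (X n)) \<longlonglongrightarrow> q powr (s - \<alpha>) * ThetaInt (\<alpha> + 1 - s)"
proof -
  obtain B where B: "\<And>r. r > 0 \<Longrightarrow> Theta \<alpha> q r \<le> B" using Theta_bounded[of \<alpha> q] \<alpha> q by auto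
  have "(\<lambda>n. AbelInt s (Theta \<alpha> q) (X n)) \<longlonglongrightarrow> (\<integral>\<tau>. indicator {0<..} \<tau> * (\<tau> powr (s - 1) * Theta \<alpha> q \<tau>) \<partial>lborel)"
  proof (rule AbelInt_Theta_tendsto[OF s \<alpha> _ _ B, where ?t0.0=0])
    show "0 \<le> X n" for n using X(1)[of n] by simp
    fix \<tau> :: real assume "\<tau> > 0"
    then have "isCont (Theta \<alpha> q) \<tau>" by (rule Theta_isCont)
    moreover have "(\<lambda>n. X n + \<tau>) \<longlonglongrightarrow> 0 + \<tau>" by (intro tendsto_intros X)
    ultimately show "(\<lambda>n. Theta \<alpha> q (X n + \<tau>)) \<longlonglongrightarrow> Theta \<alpha> q \<tau>"
      unfolding add_0_left by (rule isCont_tendsto_compose)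
  qed (use q in auto)
  also have "(\<lambda>\<tau>. indicator {0<..} \<tau> * (\<tau> powr (s - 1) * Theta \<alpha> q \<tau>)) = (\<lambda>\<tau>. indicator {0<..} \<tau> * Theta (\<alpha> + 1 - s) q \<tau>)"
  proof
    fix \<tau> :: real
    have "(s - 1) + - \<alpha> = - (\<alpha> + 1 - s)" by simp
    then have "\<tau> powr (s - 1) * \<tau> powr - \<alpha> = \<tau> powr - (\<alpha> + 1 - s)" unfolding powr_add[symmetric] by (rule arg_cong)
    then show "indicator {0<..} \<tau> * (\<tau> powr (s - 1) * Theta \<alpha> q \<tau>) = indicator {0<..} \<tau> * Theta (\<alpha> + 1 - s) q \<tau>"
      by (simp add: Theta_def mult.assoc[symmetric])
  qed
  finally show ?thesis using s \<alpha> q by (simp add: integral_Theta)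
qed

lemma Theta_abel_inversion:
  assumes s: "0 < s" "s < 1" and \<alpha>: "\<alpha> \<ge> 1" and q: "q \<ge> 0" and t: "t > 0"
  shows "has_bochner_integral lborel (\<lambda>\<sigma>. indicator {0<..} \<sigma> * (\<sigma> powr (- 1 - s) * (AbelInt s (Theta \<alpha> q) t - AbelInt s (Theta \<alpha> q) (t + \<sigma>))))
    (Beta s (1 - s) / s * Theta \<alpha> q t)"
proof (rule abel_inversion[OF s, where f="\<lambda>r. \<alpha> * Theta (\<alpha> + 1) q r - q / 4 * Theta (\<alpha> + 2) q r"])
  show "DERIV (Theta \<alpha> q) r :> - (\<alpha> * Theta (\<alpha> + 1) q r - q / 4 * Theta (\<alpha> + 2) q r)" if "t \<le> r" for r
    by (rule Theta_deriv) (use that t in auto)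
  show "isCont (\<lambda>r. \<alpha> * Theta (\<alpha> + 1) q r - q / 4 * Theta (\<alpha> + 2) q r) r" if "t \<le> r" for r
    by (intro continuous_intros Theta_isCont) (use that t in auto)
  show "(Theta \<alpha> q \<longlongrightarrow> 0) at_top" using \<alpha> q by (intro Theta_at_top) auto
  show "integrable lborel (\<lambda>\<tau>. indicator {0<..} \<tau> * (\<tau> powr (s - 1) * Theta \<alpha> q (t' + \<tau>)))" if "t \<le> t'" for t'
    by (rule AbelInt_Theta_integrable[OF s \<alpha> q, of t' "t powr -\<alpha>"]) (use that t \<alpha> q in \<open>auto intro!: Theta_le_powr\<close>)
  show "integrable lborel (\<lambda>r. indicator {t<..} r * (\<alpha> * Theta (\<alpha> + 1) q r - q / 4 * Theta (\<alpha> + 2) q r))"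
  proof (rule Bochner_Integration.integrable_bound)
    show "integrable lborel (\<lambda>r. \<alpha> * (indicator {t..} r * r powr -(\<alpha> + 1)) + q / 4 * (indicator {t..} r * r powr -(\<alpha> + 2)))"
      using t \<alpha> by (intro Bochner_Integration.integrable_add integrable_mult_right integrable_powr_Ici) auto
    show "AE r in lborel. norm (indicator {t<..} r * (\<alpha> * Theta (\<alpha> + 1) q r - q / 4 * Theta (\<alpha> + 2) q r)) \<le>
      norm (\<alpha> * (indicator {t..} r * r powr -(\<alpha> + 1)) + q / 4 * (indicator {t..} r * r powr -(\<alpha> + 2)))"
    proof (rule AE_I2)
      fix r :: real
      show "norm (indicator {t<..} r * (\<alpha> * Theta (\<alpha> + 1) q r - q / 4 * Theta (\<alpha> + 2) q r)) \<le>
      norm (\<alpha> * (indicator {t..} r * r powr -(\<alpha> + 1)) + q / 4 * (indicator {t..} r * r powr -(\<alpha> + 2)))"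
      proof (cases "t < r")
        case True
        have "\<bar>\<alpha> * Theta (\<alpha> + 1) q r - q / 4 * Theta (\<alpha> + 2) q r\<bar> \<le> \<bar>\<alpha> * Theta (\<alpha> + 1) q r\<bar> + \<bar>q / 4 * Theta (\<alpha> + 2) q r\<bar>"
          by (rule abs_triangle_ineq4)
        also have "\<dots> = \<alpha> * Theta (\<alpha> + 1) q r + q / 4 * Theta (\<alpha> + 2) q r" using \<alpha> q by (simp add: abs_mult)
        also have "\<dots> \<le> \<alpha> * r powr -(\<alpha> + 1) + q / 4 * r powr -(\<alpha> + 2)"
          using True t \<alpha> q by (intro add_mono mult_left_mono Theta_le) auto
        also have "\<dots> \<le> \<bar>\<alpha> * r powr -(\<alpha> + 1) + q / 4 * r powr -(\<alpha> + 2)\<bar>" by (rule abs_ge_self)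
        finally show ?thesis using True by simp
      qed simp
    qed
  qed measurable
qed measurable

context fractional_order
begin

text \<open>A single heat kernel is not bounded by \<open>C * wt p y\<close> uniformly in large
  \<open>t\<close>: where \<open>|y|^2\<close> is comparable to \<open>t\<close> it has size
  \<open>|y| powr -n\<close>. The second difference gains a factor \<open>(1 + q) / t\<close> with
  \<open>q = |y|^2 / t\<close>, at the expense of part of the Gaussian, and this lowers the size to
  \<open>|y| powr -(n + 2)\<close>, which is enough since \<open>p \<le> n + 2\<close>.\<close>

lemma second_diff_heat_bound:
  "\<exists>C\<ge>0. \<forall>t\<ge>1. \<forall>y. \<bar>second_diff (heat t) y h\<bar> \<le> C * wt p y"
proof -
  let ?n = "real DIM('a)"
  have "\<exists>B\<ge>0. \<forall>x>0. x powr (?n/2 + 2) * exp (- (1/8) * x) \<le> B" by (rule powr_exp_bound) auto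
  then obtain B where B: "B \<ge> 0" "\<And>x. x > 0 \<Longrightarrow> x powr (?n/2 + 2) * exp (- (1/8) * x) \<le> B" by blast
  define N where "N = (norm h)\<^sup>2 * exp ((norm h)\<^sup>2 / 2)"
  define C where "C = N * (2 powr (?n/2 + 1) * (exp (1/8) * B))"
  have N0: "N \<ge> 0" by (simp add: N_def)
  have C0: "C \<ge> 0" using N0 B by (simp add: C_def)
  have "\<bar>second_diff (heat t) y h\<bar> \<le> C * wt p y" if t: "t \<ge> 1" for t and y :: 'a
  proof -
    \<comment> \<open>Passing from \<open>y\<close> to \<open>y + h\<close> or \<open>y - h\<close>
      changes the exponent by \<open>-a - b\<close> or \<open>-a + b\<close>: \<open>a\<close> is
      the part even in \<open>h\<close>, \<open>b\<close> the odd part.\<close>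
    define a where "a = (norm h)\<^sup>2 / (4 * t)"
    define b where "b = (y \<bullet> h) / (2 * t)"
    define q where "q = (norm y)\<^sup>2 / t"
    have t0: "t > 0" using t by simp
    have q0: "q \<ge> 0" using t0 by (simp add: q_def)
    have a0: "a \<ge> 0" using t0 by (simp add: a_def)
    have hp: "heat t (y + h) = heat t y * (exp (-a) * exp (-b))" "heat t (y - h) = heat t y * (exp (-a) * exp b)"
    proof -
      have "- (1/(4*t)) * (norm (y + h))\<^sup>2 = - (1/(4*t)) * (norm y)\<^sup>2 + (-a + -b)"
        using t0 by (simp add: a_def b_def power2_norm_eq_inner inner_simps inner_commute field_simps)
      then show "heat t (y + h) = heat t y * (exp (-a) * exp (-b))" unfolding heat_eq by (simp only: exp_add mult.assoc)
      have "- (1/(4*t)) * (norm (y - h))\<^sup>2 = - (1/(4*t)) * (norm y)\<^sup>2 + (-a + b)"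
        using t0 by (simp add: a_def b_def power2_norm_eq_inner inner_simps inner_commute field_simps)
      then show "heat t (y - h) = heat t y * (exp (-a) * exp b)" unfolding heat_eq by (simp only: exp_add mult.assoc)
    qed
    define S where "S = exp b + exp (-b)"
    have second_diff: "second_diff (heat t) y h = heat t y * (exp (-a) * S - 2)" unfolding second_diff_def hp S_def by (simp add: algebra_simps)
    \<comment> \<open>This is \<open>2 cosh b - 2 = 4 (sinh (b/2))^2\<close>, of second order in
      \<open>b\<close>.\<close>
    have sq: "S - 2 = (exp (\<bar>b\<bar>/2) - exp (-\<bar>b\<bar>/2))\<^sup>2"
    proof -
      have "S = exp \<bar>b\<bar> + exp (-\<bar>b\<bar>)" by (cases "b \<ge> 0") (auto simp: S_def)
      moreover have "exp (\<bar>b\<bar>/2) * exp (\<bar>b\<bar>/2) = exp \<bar>b\<bar>" "exp (-\<bar>b\<bar>/2) * exp (-\<bar>b\<bar>/2) = exp (-\<bar>b\<bar>)" "exp (\<bar>b\<bar>/2) * exp (-\<bar>b\<bar>/2) = 1"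
        unfolding exp_add[symmetric] by simp_all
      ultimately show ?thesis unfolding power2_eq_square by (simp add: algebra_simps)
    qed
    have S2: "2 \<le> S" using sq zero_le_power2[of "exp (\<bar>b\<bar>/2) - exp (-\<bar>b\<bar>/2)"] by linarith
    have Sle: "S \<le> 2 * exp \<bar>b\<bar>"
    proof -
      have "exp b \<le> exp \<bar>b\<bar>" "exp (-b) \<le> exp \<bar>b\<bar>" by auto
      then show ?thesis unfolding S_def by linarith
    qed
    have S3: "S - 2 \<le> b\<^sup>2 * exp \<bar>b\<bar>"
    proof -
      have "0 \<le> exp (\<bar>b\<bar>/2) - exp (-\<bar>b\<bar>/2)" by simp
      moreover have "exp (\<bar>b\<bar>/2) - exp (-\<bar>b\<bar>/2) \<le> \<bar>b\<bar> * exp (\<bar>b\<bar>/2)"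
      proof -
        have "1 - exp (-\<bar>b\<bar>) \<le> \<bar>b\<bar>" using exp_ge_add_one_self[of "-\<bar>b\<bar>"] by linarith
        then have "exp (\<bar>b\<bar>/2) * (1 - exp (-\<bar>b\<bar>)) \<le> exp (\<bar>b\<bar>/2) * \<bar>b\<bar>" by (intro mult_left_mono) auto
        moreover have "exp (\<bar>b\<bar>/2) * exp (-\<bar>b\<bar>) = exp (-\<bar>b\<bar>/2)" by (simp add: exp_add[symmetric])
        ultimately show ?thesis by (simp add: algebra_simps)
      qed
      ultimately have "(exp (\<bar>b\<bar>/2) - exp (-\<bar>b\<bar>/2))\<^sup>2 \<le> (\<bar>b\<bar> * exp (\<bar>b\<bar>/2))\<^sup>2" by (intro power_mono)
      also have "\<dots> = b\<^sup>2 * exp \<bar>b\<bar>" by (simp add: power_mult_distrib power2_eq_square[of "exp _"] exp_add[symmetric])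
      finally show ?thesis using sq by simp
    qed
    have e1: "0 \<le> 1 - exp (-a)" "1 - exp (-a) \<le> a" using a0 exp_ge_add_one_self[of "-a"] by auto
    have "\<bar>exp (-a) * S - 2\<bar> \<le> (b\<^sup>2 + 2 * a) * exp \<bar>b\<bar>"
    proof -
      have "(1 - exp (-a)) * S \<le> a * (2 * exp \<bar>b\<bar>)" using e1 S2 Sle a0 by (intro mult_mono) auto
      moreover have "0 \<le> (1 - exp (-a)) * S" using e1 S2 by simp
      moreover have "exp (-a) * S - 2 = (S - 2) - (1 - exp (-a)) * S" by (simp add: algebra_simps)
      ultimately have "\<bar>exp (-a) * S - 2\<bar> \<le> b\<^sup>2 * exp \<bar>b\<bar> + a * (2 * exp \<bar>b\<bar>)" using S3 S2 by linarith
      then show ?thesis by (simp add: algebra_simps)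
    qed
    also have "\<dots> \<le> ((norm h)\<^sup>2 / t * (1 + q)) * (exp (q/8) * exp ((norm h)\<^sup>2 / 2))"
    proof (rule mult_mono)
      have "(y \<bullet> h)\<^sup>2 \<le> (norm y * norm h)\<^sup>2" using power_mono[OF Cauchy_Schwarz_ineq2[of y h], of 2] by simp
      then have "b\<^sup>2 \<le> (norm y * norm h)\<^sup>2 / (2 * t)\<^sup>2" unfolding b_def power_divide by (intro divide_right_mono) auto
      also have "\<dots> = (norm h)\<^sup>2 / t * (q / 4)" using t0 by (simp add: q_def power_mult_distrib power2_eq_square field_simps)
      finally have b2: "b\<^sup>2 \<le> (norm h)\<^sup>2 / t * (q / 4)" .
      have a2: "2 * a = (norm h)\<^sup>2 / t * (1/2)" by (simp add: a_def)
      have "b\<^sup>2 + 2 * a \<le> (norm h)\<^sup>2 / t * (q / 4 + 1/2)" using b2 unfolding a2 by (simp add: distrib_left)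
      also have "\<dots> \<le> (norm h)\<^sup>2 / t * (1 + q)" using q0 t0 by (intro mult_left_mono) auto
      finally show "b\<^sup>2 + 2 * a \<le> (norm h)\<^sup>2 / t * (1 + q)" .
      have "\<bar>b\<bar> \<le> norm y * norm h / (2 * t)" unfolding b_def abs_divide using t0 Cauchy_Schwarz_ineq2[of y h] by (simp add: divide_right_mono)
      also have "\<dots> \<le> q / 8 + (norm h)\<^sup>2 / (2 * t)"
      proof -
        \<comment> \<open>The coefficient \<open>2\<close> leaves only \<open>q / 8\<close> in the
          exponent, half of the \<open>q / 4\<close> available in the Gaussian; the other half pays
          for the powers of \<open>1 + q\<close>.\<close>
        have "0 \<le> (norm y - 2 * norm h)\<^sup>2 / (8 * t)" using t0 by simp
        also have "\<dots> = q / 8 + (norm h)\<^sup>2 / (2 * t) - norm y * norm h / (2 * t)"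
          using t0 by (simp add: q_def power2_eq_square field_simps)
        finally show ?thesis by simp
      qed
      also have "(norm h)\<^sup>2 / (2 * t) \<le> (norm h)\<^sup>2 / 2" using t by (intro divide_left_mono) auto
      finally have "\<bar>b\<bar> \<le> q / 8 + (norm h)\<^sup>2 / 2" by simp
      then have "exp \<bar>b\<bar> \<le> exp (q / 8 + (norm h)\<^sup>2 / 2)" by simp
      then show "exp \<bar>b\<bar> \<le> exp (q/8) * exp ((norm h)\<^sup>2 / 2)" by (simp only: exp_add)
    qed (use q0 t0 in auto)
    finally have m: "\<bar>exp (-a) * S - 2\<bar> \<le> ((norm h)\<^sup>2 / t * (1 + q)) * (exp (q/8) * exp ((norm h)\<^sup>2 / 2))" .
    have hq: "heat t y = t powr -(?n/2) * exp (- (q/4))" by (simp add: heat_eq q_def)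
    have "\<bar>second_diff (heat t) y h\<bar> = (t powr -(?n/2) * exp (- (q/4))) * \<bar>exp (-a) * S - 2\<bar>"
      by (simp add: second_diff hq abs_mult)
    also have "\<dots> \<le> (t powr -(?n/2) * exp (- (q/4))) * (((norm h)\<^sup>2 / t * (1 + q)) * (exp (q/8) * exp ((norm h)\<^sup>2 / 2)))"
      by (intro mult_left_mono m) auto
    also have "\<dots> = N * (t powr -(?n/2 + 1) * ((1 + q) * exp (- (1/8) * q)))"
    proof -
      have "- (?n/2 + 1) = - (?n/2) + -1" by simp
      then have 1: "t powr -(?n/2 + 1) = t powr -(?n/2) * t powr -1" by (simp only: powr_add)
      have 2: "t powr -1 = 1 / t" using t0 by (simp add: powr_minus field_simps)
      have "- (q/4) + q/8 = - (1/8) * q" by simp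
      then have 3: "exp (- (1/8) * q) = exp (- (q/4)) * exp (q/8)" by (simp only: exp_add[symmetric])
      show ?thesis unfolding 1 2 3 N_def by simp
    qed
    also have "\<dots> \<le> N * ((2 powr (?n/2 + 1) * (1 + q) powr (?n/2 + 1) * wt p y) * ((1 + q) * exp (- (1/8) * q)))"
    proof (intro mult_left_mono mult_right_mono)
      \<comment> \<open>Leads to \<open>(1 + |y|)^2 \<le> 2 t (1 + q)\<close> for
        \<open>t \<ge> 1\<close>, so the negative power of \<open>t\<close> is exchanged for the
        weight at the cost of powers of \<open>1 + q\<close>.\<close>
      have "0 \<le> (1 - norm y)\<^sup>2" by simp
      then have "(1 + norm y)\<^sup>2 \<le> 2 * (1 + (norm y)\<^sup>2)" by (simp add: power2_eq_square algebra_simps)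
      also have "\<dots> \<le> 2 * (t + (norm y)\<^sup>2)" using t by simp
      also have "\<dots> = 2 * (t * (1 + q))" using t0 by (simp add: q_def field_simps)
      finally have l: "(1 + norm y)\<^sup>2 \<le> 2 * (t * (1 + q))" .
      have y0: "1 + norm y > 0" by (simp add: add_pos_nonneg)
      have "(1 + norm y) powr p \<le> (1 + norm y) powr (?n + 2)" using s by (intro powr_mono) (auto simp: p_eq)
      also have "\<dots> = ((1 + norm y) powr 2) powr (?n/2 + 1)" unfolding powr_powr by simp
      also have "\<dots> = ((1 + norm y)\<^sup>2) powr (?n/2 + 1)" using y0 by (simp add: powr_numeral)
      also have "\<dots> \<le> (2 * (t * (1 + q))) powr (?n/2 + 1)" using l by (intro powr_mono2) auto
      also have "\<dots> = 2 powr (?n/2 + 1) * (t powr (?n/2 + 1) * (1 + q) powr (?n/2 + 1))" by (simp only: powr_mult)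
      finally have "(1 + norm y) powr p * (t powr -(?n/2 + 1) * (1 + norm y) powr -p) \<le>
        2 powr (?n/2 + 1) * (t powr (?n/2 + 1) * (1 + q) powr (?n/2 + 1)) * (t powr -(?n/2 + 1) * (1 + norm y) powr -p)"
        by (intro mult_right_mono) auto
      moreover have "(1 + norm y) powr p * (1 + norm y) powr -p = 1" "t powr (?n/2 + 1) * t powr -(?n/2 + 1) = 1"
        using y0 t0 by (simp_all add: powr_add[symmetric])
      \<comment> \<open>Stated for arbitrary reals to keep the \<open>powr\<close> terms opaque
        during the cancellation.\<close>
      moreover have "Tm \<le> K * Q * Pi" if "P * (Tm * Pi) \<le> K * (Tp * Q) * (Tm * Pi)" "P * Pi = 1" "Tp * Tm = 1" for P Pi Tm Tp K Q :: real
      proof -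
        have "P * (Tm * Pi) = Tm * (P * Pi)" "K * (Tp * Q) * (Tm * Pi) = K * Q * Pi * (Tp * Tm)" by simp_all
        with that show ?thesis by (simp only: mult_1_right)
      qed
      ultimately show "t powr -(?n/2 + 1) \<le> 2 powr (?n/2 + 1) * (1 + q) powr (?n/2 + 1) * wt p y"
        unfolding wt_def by blast
    qed (use N0 q0 in auto)
    also have "\<dots> = N * (2 powr (?n/2 + 1) * (exp (1/8) * ((1 + q) powr (?n/2 + 2) * exp (- (1/8) * (1 + q))))) * wt p y"
    proof -
      have 1: "(1 + q) powr (?n/2 + 2) = (1 + q) powr (?n/2 + 1) * (1 + q)"
      proof -
        have "?n/2 + 2 = (?n/2 + 1) + 1" by simp
        then have "(1 + q) powr (?n/2 + 2) = (1 + q) powr (?n/2 + 1) * (1 + q) powr 1" by (simp only: powr_add)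
        then show ?thesis using q0 by simp
      qed
      have "1/8 + - (1/8) * (1 + q) = - (1/8) * q" by (simp add: algebra_simps)
      then have 2: "exp (- (1/8) * q) = exp (1/8) * exp (- (1/8) * (1 + q))" by (simp only: exp_add[symmetric])
      show ?thesis unfolding 1 2 by (simp only: mult_ac)
    qed
    also have "\<dots> \<le> C * wt p y"
      unfolding C_def using B(2)[of "1 + q"] q0 N0 by (intro mult_left_mono mult_right_mono) auto
    finally show ?thesis .
  qed
  with C0 show ?thesis by blast
qed

end

section \<open>Limits of the heat extension\<close>

text \<open>One power of \<open>r\<close> is split off:
  \<open>Theta \<alpha> q r = r * Theta (\<alpha> + 1) q r\<close>, and the second factor is bounded
  because \<open>q > 0\<close>.\<close>

lemma Theta_0:
  assumes "\<alpha> \<ge> 0" "q > 0" and X: "\<And>n. X n > 0" "X \<longlonglongrightarrow> 0"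
  shows "(\<lambda>n. Theta \<alpha> q (X n)) \<longlonglongrightarrow> 0"
proof -
  obtain B where B: "\<And>r. r > 0 \<Longrightarrow> Theta (\<alpha> + 1) q r \<le> B" using Theta_bounded[of "\<alpha> + 1" q] assms by auto
  show ?thesis
  proof (rule tendsto_sandwich[OF _ _ tendsto_const])
    have "Theta \<alpha> q (X n) \<le> X n * B" for n
    proof -
      have "- \<alpha> = 1 + - (\<alpha> + 1)" by simp
      then have "X n powr - \<alpha> = X n powr 1 * X n powr - (\<alpha> + 1)" by (simp only: powr_add)
      then have "Theta \<alpha> q (X n) = X n * Theta (\<alpha> + 1) q (X n)" using X(1)[of n] by (simp add: Theta_def)
      also have "\<dots> \<le> X n * B" using X(1)[of n] B by (intro mult_left_mono) auto
      finally show ?thesis .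
    qed
    then show "eventually (\<lambda>n. Theta \<alpha> q (X n) \<le> X n * B) sequentially" by simp
    show "(\<lambda>n. X n * B) \<longlonglongrightarrow> 0" using tendsto_mult[OF X(2) tendsto_const[of B]] by simp
  qed simp
qed

context tail_fun
begin

lemma u_dominated_convergence:
  assumes f [measurable]: "\<And>n::nat. f n \<in> borel_measurable borel" and F [measurable]: "F \<in> borel_measurable borel"
    and bound: "\<And>n x. \<bar>f n x\<bar> \<le> C * wt p x" and lim: "\<And>x. (\<lambda>n. f n x) \<longlonglongrightarrow> F x"
  shows "(\<lambda>n. \<integral>x. u x * f n x \<partial>lborel) \<longlonglongrightarrow> (\<integral>x. u x * F x \<partial>lborel)"
proof (rule integral_dominated_convergence[where w="\<lambda>x. C * (\<bar>u x\<bar> * wt p x)"])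
  show "integrable lborel (\<lambda>x. C * (\<bar>u x\<bar> * wt p x))" using u_tail by simp
  show "AE x in lborel. (\<lambda>n. u x * f n x) \<longlonglongrightarrow> u x * F x"
    by (intro AE_I2 tendsto_intros lim)
  show "AE x in lborel. norm (u x * f n x) \<le> C * (\<bar>u x\<bar> * wt p x)" for n
  proof (rule AE_I2)
    fix x
    show "norm (u x * f n x) \<le> C * (\<bar>u x\<bar> * wt p x)"
      using mult_left_mono[OF bound[of n x], of "\<bar>u x\<bar>"] by (simp add: abs_mult mult_ac)
  qed
qed measurable

lemma heat_ext_continuous: "continuous_on {0<..} (\<lambda>t. heat_ext t z)"
  unfolding continuous_on_sequentially comp_def
proof (intro ballI allI impI, elim conjE)
  fix t and X :: "nat \<Rightarrow> real"
  assume t: "t \<in> {0<..}" and X: "\<forall>n. X n \<in> {0<..}" "X \<longlonglongrightarrow> t"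
  have "eventually (\<lambda>n. t / 2 < X n \<and> X n < 2 * t) sequentially"
    using X(2) t by (intro eventually_conj order_tendstoD[of X t]) auto
  then obtain N where N: "\<And>n. n \<ge> N \<Longrightarrow> t / 2 < X n \<and> X n < 2 * t" by (auto simp: eventually_sequentially)
  \<comment> \<open>For times between \<open>t / 2\<close> and \<open>2 * t\<close> the exponentials
    are all dominated by the one at time \<open>2 * t\<close>, whose rate is
    \<open>1 / (8 * t)\<close>.\<close>
  have "1 / (8 * t) > 0" using t by simp
  from gauss_le_wt[OF this, of z] obtain C where C: "C \<ge> 0" "\<And>x. exp (- (1 / (8 * t)) * (norm (x - z))\<^sup>2) \<le> C * wt p x" by blast
  have "(\<lambda>n. heat_ext (X (n + N)) z) \<longlonglongrightarrow> heat_ext t z"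
    unfolding heat_ext_def
  proof (rule u_dominated_convergence[where C="(t/2) powr -(real DIM('a)/2) * C"])
    fix n x
    let ?r = "X (n + N)"
    have r: "t / 2 < ?r" "?r < 2 * t" using N[of "n + N"] by auto
    have "?r powr -(real DIM('a)/2) \<le> (t/2) powr -(real DIM('a)/2)" using r t by (intro powr_mono2') auto
    moreover have "exp (- (1 / (4 * ?r)) * (norm (x - z))\<^sup>2) \<le> exp (- (1 / (8 * t)) * (norm (x - z))\<^sup>2)"
    proof -
      have "1 / (8 * t) \<le> 1 / (4 * ?r)" using r t by (intro divide_left_mono) auto
      then have "1 / (8 * t) * (norm (x - z))\<^sup>2 \<le> 1 / (4 * ?r) * (norm (x - z))\<^sup>2" by (intro mult_right_mono) auto
      then show ?thesis by simp
    qed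
    ultimately have "heat ?r (x - z) \<le> (t/2) powr -(real DIM('a)/2) * (C * wt p x)"
      unfolding heat_eq by (intro mult_mono order_trans[OF _ C(2)]) auto
    then show "\<bar>heat ?r (x - z)\<bar> \<le> (t/2) powr -(real DIM('a)/2) * C * wt p x" by (simp add: mult.assoc)
  next
    fix x
    have "isCont (Theta (real DIM('a)/2) ((norm (x - z))\<^sup>2)) t" using t by (intro Theta_isCont) auto
    then show "(\<lambda>n. heat (X (n + N)) (x - z)) \<longlonglongrightarrow> heat t (x - z)"
      unfolding heat_def by (rule isCont_tendsto_compose) (intro LIMSEQ_ignore_initial_segment X)
  qed auto
  then show "(\<lambda>n. heat_ext (X n) z) \<longlonglongrightarrow> heat_ext t z" by (rule LIMSEQ_offset)
qed

lemma heat_ext_second_difference_at_top: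
  "((\<lambda>t. heat_ext t (z + h) + heat_ext t (z - h) - 2 * heat_ext t z) \<longlongrightarrow> 0) at_top"
proof (rule tendsto_at_topI_sequentially)
  fix X :: "nat \<Rightarrow> real" assume X: "filterlim X at_top sequentially"
  then have "eventually (\<lambda>n. 1 \<le> X n) sequentially" by (simp add: filterlim_at_top)
  then obtain N where N: "\<And>n. n \<ge> N \<Longrightarrow> 1 \<le> X n" by (auto simp: eventually_sequentially)
  obtain C where C: "C \<ge> 0" "\<And>t y. t \<ge> 1 \<Longrightarrow> \<bar>second_diff (heat t) y h\<bar> \<le> C * wt p y" using second_diff_heat_bound[of h] by blast
  have e: "heat_ext t (z + h) + heat_ext t (z - h) - 2 * heat_ext t z = (\<integral>x. u x * second_diff (heat t) (x - z) h \<partial>lborel)" if "t \<ge> 1" for t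
  proof -
    have i: "integrable lborel (\<lambda>x. u x * heat t (x - w))" for w using heat_ext_integrable[of t w] that by simp
    have "(\<integral>x. u x * second_diff (heat t) (x - z) h \<partial>lborel) = (\<integral>x. u x * heat t (x - (z + h)) + u x * heat t (x - (z - h)) - 2 * (u x * heat t (x - z)) \<partial>lborel)"
      by (intro Bochner_Integration.integral_cong refl) (simp add: second_diff_def algebra_simps)
    also have "\<dots> = heat_ext t (z + h) + heat_ext t (z - h) - 2 * heat_ext t z" unfolding heat_ext_def by (simp add: i)
    finally show ?thesis by simp
  qed
  have "(\<lambda>n. \<integral>x. u x * second_diff (heat (X (n + N))) (x - z) h \<partial>lborel) \<longlonglongrightarrow> (\<integral>x. u x * 0 \<partial>lborel)"
  proof (rule u_dominated_convergence[where C="C * (1 + norm z) powr p"])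
    fix n x
    have "\<bar>second_diff (heat (X (n + N))) (x - z) h\<bar> \<le> C * wt p (x - z)" by (rule C(2)) (use N[of "n + N"] in simp)
    also have "\<dots> \<le> C * ((1 + norm z) powr p * wt p x)" using C(1) by (intro mult_left_mono wt_translate)
    finally show "\<bar>second_diff (heat (X (n + N))) (x - z) h\<bar> \<le> C * (1 + norm z) powr p * wt p x" by (simp add: mult.assoc)
  next
    fix x
    have 1: "filterlim (\<lambda>n. X (n + N)) at_top sequentially" by (rule filterlim_compose[OF X filterlim_add_const_nat_at_top])
    have l: "(\<lambda>n. heat (X (n + N)) y) \<longlonglongrightarrow> 0" for y :: 'a
      unfolding heat_def by (rule filterlim_compose[OF Theta_at_top 1]) auto
    have "(\<lambda>n. second_diff (heat (X (n + N))) (x - z) h) \<longlonglongrightarrow> 0 + 0 - 2 * 0"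
      unfolding second_diff_def by (intro tendsto_intros l)
    then show "(\<lambda>n. second_diff (heat (X (n + N))) (x - z) h) \<longlonglongrightarrow> 0" by simp
  qed auto
  then have "(\<lambda>n. heat_ext (X (n + N)) (z + h) + heat_ext (X (n + N)) (z - h) - 2 * heat_ext (X (n + N)) z) \<longlonglongrightarrow> 0"
    using N by (simp add: e)
  then show "(\<lambda>n. heat_ext (X n) (z + h) + heat_ext (X n) (z - h) - 2 * heat_ext (X n) z) \<longlonglongrightarrow> 0" by (rule LIMSEQ_offset)
qed

text \<open>Since \<open>u\<close> may be unbounded, the integral is split at distance
  \<open>\<delta>\<close> from \<open>z\<close>. Inside, \<open>u\<close> stays within
  \<open>1\<close> of \<open>u z\<close>, and rescaling by \<open>sqrt (X n)\<close> allows
  dominated convergence; outside, the kernel tends to \<open>0\<close> under a multiple of the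
  weight.\<close>

lemma heat_ext_at_0:
  assumes cont: "isCont u z" and X: "\<And>n. 0 < X n" "\<And>n. X n \<le> 1" "X \<longlonglongrightarrow> 0"
  shows "(\<lambda>n. heat_ext (X n) z) \<longlonglongrightarrow> gauss_mass * u z"
proof -
  obtain \<delta> where d: "\<delta> > 0" "\<And>x. norm (x - z) < \<delta> \<Longrightarrow> \<bar>u x - u z\<bar> < 1"
    using cont unfolding continuous_at_eps_delta by (metis dist_norm zero_less_one real_norm_def)
  define u1 where "u1 x = (if norm (x - z) < \<delta> then u x else 0)" for x
  define f where "f n x = (if norm (x - z) < \<delta> then 0 else heat (X n) (x - z))" for n x
  have [measurable]: "u1 \<in> borel_measurable borel" unfolding u1_def[abs_def] by measurable
  have fm [measurable]: "f n \<in> borel_measurable borel" for n unfolding f_def[abs_def] by measurable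
  have u1b: "\<bar>u1 x\<bar> \<le> \<bar>u z\<bar> + 1" for x using d(2)[of x] by (auto simp: u1_def)
  have fle: "\<bar>f n x\<bar> \<le> 1 * \<bar>heat (X n) (x - z)\<bar>" for n x by (simp add: f_def)
  have fint: "integrable lborel (\<lambda>x. u x * f n x)" for n
  proof (rule Bochner_Integration.integrable_bound[OF heat_ext_integrable[OF X(1)[of n], of z]])
    show "AE x in lborel. norm (u x * f n x) \<le> norm (u x * heat (X n) (x - z))"
      by (intro AE_I2) (auto simp: f_def abs_mult)
  qed measurable
  have split: "heat_ext (X n) z = (\<integral>x. u1 x * heat (X n) (x - z) \<partial>lborel) + (\<integral>x. u x * f n x \<partial>lborel)" for n
  proof -
    have "(\<integral>x. u1 x * heat (X n) (x - z) \<partial>lborel) = (\<integral>x. u x * heat (X n) (x - z) - u x * f n x \<partial>lborel)"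
      by (intro Bochner_Integration.integral_cong refl) (auto simp: u1_def f_def)
    also have "\<dots> = heat_ext (X n) z - (\<integral>x. u x * f n x \<partial>lborel)"
      unfolding heat_ext_def by (rule Bochner_Integration.integral_diff[OF heat_ext_integrable[OF X(1)] fint])
    finally show ?thesis by simp
  qed
  have near: "(\<lambda>n. \<integral>x. u1 x * heat (X n) (x - z) \<partial>lborel) \<longlonglongrightarrow> gauss_mass * u z"
  proof -
    have e: "(\<integral>x. u1 x * heat (X n) (x - z) \<partial>lborel) = (\<integral>w. u1 (z + sqrt (X n) *\<^sub>R w) * heat 1 w \<partial>lborel)" for n
    proof -
      have s0: "sqrt (X n) > 0" using X(1) by simp
      have "(\<integral>x. u1 x * heat (X n) (x - z) \<partial>lborel) = (\<integral>y. u1 (z + y) * heat (X n) y \<partial>lborel)"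
        using lborel_integral_translate(1)[of "\<lambda>x. u1 x * heat (X n) (x - z)" z] by simp
      also have "\<dots> = sqrt (X n) ^ DIM('a) * (\<integral>w. u1 (z + sqrt (X n) *\<^sub>R w) * heat (X n) (sqrt (X n) *\<^sub>R w) \<partial>lborel)"
        by (rule lborel_integral_scale(1)[OF _ s0]) measurable
      also have "\<dots> = (\<integral>w. sqrt (X n) ^ DIM('a) * (u1 (z + sqrt (X n) *\<^sub>R w) * heat (X n) (sqrt (X n) *\<^sub>R w)) \<partial>lborel)" by simp
      also have "\<dots> = (\<integral>w. u1 (z + sqrt (X n) *\<^sub>R w) * heat 1 w \<partial>lborel)"
      proof (intro Bochner_Integration.integral_cong refl)
        fix w :: 'a
        have "heat (X n) (sqrt (X n) *\<^sub>R w) = X n powr - (real DIM('a)/2) * heat 1 w"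
          using X(1)[of n] by (simp add: heat_eq power_mult_distrib)
        moreover have "sqrt (X n) ^ DIM('a) * X n powr - (real DIM('a)/2) = 1"
        proof -
          have "sqrt (X n) ^ DIM('a) = X n powr (real DIM('a)/2)"
            using X(1)[of n] by (simp add: powr_half_sqrt[symmetric] powr_realpow[symmetric] powr_powr)
          then show ?thesis using X(1)[of n] by (simp add: powr_add[symmetric])
        qed
        ultimately show "sqrt (X n) ^ DIM('a) * (u1 (z + sqrt (X n) *\<^sub>R w) * heat (X n) (sqrt (X n) *\<^sub>R w)) = u1 (z + sqrt (X n) *\<^sub>R w) * heat 1 w"
          by (metis (no_types, lifting) mult.assoc mult.commute mult.left_neutral)
      qed
      finally show ?thesis .
    qed
    have "(\<lambda>n. \<integral>w. u1 (z + sqrt (X n) *\<^sub>R w) * heat 1 w \<partial>lborel) \<longlonglongrightarrow> (\<integral>w. u z * heat 1 w \<partial>(lborel::'a measure))"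
    proof (rule integral_dominated_convergence[where w="\<lambda>w. (\<bar>u z\<bar> + 1) * heat 1 w"])
      show "integrable lborel (\<lambda>w::'a. (\<bar>u z\<bar> + 1) * heat 1 w)" by (intro integrable_mult_right heat_integrable_1)
      show "AE w in lborel. norm (u1 (z + sqrt (X n) *\<^sub>R w) * heat 1 w) \<le> (\<bar>u z\<bar> + 1) * heat 1 w" for n
        by (intro AE_I2) (auto simp: abs_mult intro!: mult_right_mono u1b)
      show "AE w in lborel. (\<lambda>n. u1 (z + sqrt (X n) *\<^sub>R w) * heat 1 w) \<longlonglongrightarrow> u z * heat 1 w"
      proof (intro AE_I2 tendsto_intros)
        fix w :: 'a
        have "(\<lambda>n. z + sqrt (X n) *\<^sub>R w) \<longlonglongrightarrow> z + sqrt 0 *\<^sub>R w" by (intro tendsto_intros X)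
        then have l: "(\<lambda>n. z + sqrt (X n) *\<^sub>R w) \<longlonglongrightarrow> z" by simp
        have u1z: "isCont u1 z"
        proof -
          have ev: "eventually (\<lambda>x. u1 x = u x) (nhds z)"
            unfolding eventually_nhds_metric using d(1) by (auto simp: u1_def dist_norm intro!: exI[of _ \<delta>])
          show ?thesis using cont isCont_cong[OF ev] by simp
        qed
        have "(\<lambda>n. u1 (z + sqrt (X n) *\<^sub>R w)) \<longlonglongrightarrow> u1 z" by (rule isCont_tendsto_compose[OF u1z l])
        then show "(\<lambda>n. u1 (z + sqrt (X n) *\<^sub>R w)) \<longlonglongrightarrow> u z" using d(1) by (simp add: u1_def)
      qed
    qed measurable
    then show ?thesis unfolding e by (simp add: gauss_mass_def mult.commute)
  qed
  have far: "(\<lambda>n. \<integral>x. u x * f n x \<partial>lborel) \<longlonglongrightarrow> (\<integral>x. u x * 0 \<partial>lborel)"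
  proof -
    have "\<exists>B\<ge>0. \<forall>r>0. Theta (real DIM('a)/2) (\<delta>\<^sup>2 / 2) r \<le> B" by (rule Theta_bounded) (use d(1) in auto)
    then obtain B where B: "B \<ge> 0" "\<And>r. r > 0 \<Longrightarrow> Theta (real DIM('a)/2) (\<delta>\<^sup>2 / 2) r \<le> B" by blast
    obtain C where C: "C \<ge> 0" "\<And>x. exp (- (1/8) * (norm (x - z))\<^sup>2) \<le> C * wt p x" using gauss_le_wt[of "1/8" z] by auto
    show ?thesis
    proof (rule u_dominated_convergence[OF fm, where C="B * C"])
      fix n x
      show "\<bar>f n x\<bar> \<le> B * C * wt p x"
      proof (cases "norm (x - z) < \<delta>")
        case True
        then show ?thesis using B C by (simp add: f_def)
      next
        case False
        let ?r = "X n" and ?y = "(norm (x - z))\<^sup>2"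
        have r: "?r > 0" "?r \<le> 1" using X by auto
        have y: "\<delta>\<^sup>2 \<le> ?y" using False d(1) by (intro power_mono) auto
        \<comment> \<open>Half of the exponent compensates the factor \<open>?r powr -(n/2)\<close>
          away from \<open>z\<close>; the other half, by \<open>?r \<le> 1\<close>, gives decay
          against \<open>u\<close>.\<close>
        have "- (1/(4*?r)) * ?y \<le> - (\<delta>\<^sup>2 / 2 / (4 * ?r)) + - (1/8) * ?y"
        proof -
          have "\<delta>\<^sup>2 / (8 * ?r) \<le> ?y / (8 * ?r)" using y r by (intro divide_right_mono) auto
          moreover have "?y / 8 \<le> ?y / (8 * ?r)" using r by (intro divide_left_mono) auto
          moreover have "1/(4*?r) * ?y = ?y / (8 * ?r) + ?y / (8 * ?r)" using r by (simp add: field_simps)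
          ultimately show ?thesis by simp
        qed
        then have "exp (- (1/(4*?r)) * ?y) \<le> exp (- (\<delta>\<^sup>2 / 2 / (4 * ?r))) * exp (- (1/8) * ?y)"
          unfolding exp_add[symmetric] exp_le_cancel_iff .
        then have "heat ?r (x - z) \<le> ?r powr -(real DIM('a)/2) * (exp (- (\<delta>\<^sup>2 / 2 / (4 * ?r))) * exp (- (1/8) * ?y))"
          unfolding heat_eq by (intro mult_left_mono) auto
        also have "\<dots> = Theta (real DIM('a)/2) (\<delta>\<^sup>2 / 2) ?r * exp (- (1/8) * ?y)" by (simp add: Theta_def)
        also have "\<dots> \<le> B * (C * wt p x)" using B r by (intro mult_mono C) auto
        finally show ?thesis using False by (simp add: f_def mult.assoc)
      qed
    next
      fix x
      show "(\<lambda>n. f n x) \<longlonglongrightarrow> 0"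
      proof (cases "norm (x - z) < \<delta>")
        case False
        then have "(norm (x - z))\<^sup>2 > 0" using d(1) by (cases "x = z") auto
        then have "(\<lambda>n. Theta (real DIM('a)/2) ((norm (x - z))\<^sup>2) (X n)) \<longlonglongrightarrow> 0" by (intro Theta_0 X) auto
        then show ?thesis using False by (simp add: f_def heat_def)
      qed (simp add: f_def)
    qed auto
  qed
  show ?thesis unfolding split using tendsto_add[OF near far] by simp
qed

end

section \<open>Identification of the solution\<close>

context harmonic_off_0
begin

text \<open>Multiplied by the Abel inversion constant \<open>Beta s (1 - s) / s\<close> it gives
  back the factor \<open>subordination_const / (2 * gauss_mass)\<close> of
  \<open>heat_ext_marchaud\<close>; the signs being opposite, the sources cancel in
  \<open>corrected_ext\<close>.\<close>

definition correction_const :: real where "correction_const = (subordination_const / (2 * gauss_mass)) / (Beta s (1 - s) / s)"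

definition corrected_ext :: "real \<Rightarrow> 'a \<Rightarrow> real" where
  "corrected_ext t z = heat_ext t z + correction_const * (monopole * AbelInt s (Theta (real DIM('a)/2) ((norm z)\<^sup>2)) t + dipole z / 2 * AbelInt s (Theta (real DIM('a)/2 + 1) ((norm z)\<^sup>2)) t)"

lemma corrected_ext_marchaud:
  assumes n: "DIM('a) \<ge> 2" and t: "t > 0"
  shows "has_bochner_integral lborel (\<lambda>\<tau>. indicator {0<..} \<tau> * (\<tau> powr (-1 - s) * (corrected_ext t z - corrected_ext (t + \<tau>) z))) 0"
proof -
  let ?\<alpha> = "real DIM('a)/2" and ?q = "(norm z)\<^sup>2" and ?b = "Beta s (1 - s) / s"
  have b: "?b \<noteq> 0" using Beta_pos[OF s] s by simp
  have \<alpha>: "1 \<le> ?\<alpha>" using n by simp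
  have *: "has_bochner_integral lborel (\<lambda>\<tau>. indicator {0<..} \<tau> * (\<tau> powr (-1 - s) * (heat_ext t z - heat_ext (t + \<tau>) z))
      + correction_const * (monopole * (indicator {0<..} \<tau> * (\<tau> powr (- 1 - s) * (AbelInt s (Theta ?\<alpha> ?q) t - AbelInt s (Theta ?\<alpha> ?q) (t + \<tau>))))
      + dipole z / 2 * (indicator {0<..} \<tau> * (\<tau> powr (- 1 - s) * (AbelInt s (Theta (?\<alpha> + 1) ?q) t - AbelInt s (Theta (?\<alpha> + 1) ?q) (t + \<tau>))))))
     (- (subordination_const / (2 * gauss_mass)) * pairing (\<lambda>x. heat t (x - z)) + correction_const * (monopole * (?b * Theta ?\<alpha> ?q t) + dipole z / 2 * (?b * Theta (?\<alpha> + 1) ?q t)))"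
    by (intro has_bochner_integral_add has_bochner_integral_mult_right heat_ext_marchaud Theta_abel_inversion s t) (use \<alpha> in auto)
  have cb: "correction_const * ?b = subordination_const / (2 * gauss_mass)" using b by (simp add: correction_const_def)
  have "c * (x * (b * X) + y * (b * Y)) = (c * b) * (x * X + y * Y)" for b c x y X Y :: real
    by (simp add: algebra_simps)
  then have 0: "- (subordination_const / (2 * gauss_mass)) * pairing (\<lambda>x. heat t (x - z)) + correction_const * (monopole * (?b * Theta ?\<alpha> ?q t) + dipole z / 2 * (?b * Theta (?\<alpha> + 1) ?q t)) = 0"
    unfolding pairing_heat[OF t] by (simp only: cb)
  have "i * (w * (heat_ext t z - heat_ext (t + \<tau>) z)) + correction_const * (monopole * (i * (w * (AbelInt s (Theta ?\<alpha> ?q) t - AbelInt s (Theta ?\<alpha> ?q) (t + \<tau>))))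
      + dipole z / 2 * (i * (w * (AbelInt s (Theta (?\<alpha> + 1) ?q) t - AbelInt s (Theta (?\<alpha> + 1) ?q) (t + \<tau>))))) =
      i * (w * (corrected_ext t z - corrected_ext (t + \<tau>) z))" for i w \<tau>
    unfolding corrected_ext_def by (simp add: algebra_simps)
  with * show ?thesis unfolding 0 by simp
qed

lemma corrected_ext_continuous:
  assumes n: "DIM('a) \<ge> 2"
  shows "continuous_on {0<..} (\<lambda>t. corrected_ext t z)"
proof -
  have "1 \<le> real DIM('a)/2" using n by simp
  then show ?thesis unfolding corrected_ext_def
    by (intro continuous_intros heat_ext_continuous AbelInt_Theta_cont s) auto
qed

text \<open>Taking second differences supplies the decay that the maximum principle asks for:
  \<open>heat_ext\<close> itself need not vanish at large times, as a constant \<open>u\<close>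
  shows. The principle is applied to \<open>V\<close> and to \<open>- V\<close>.\<close>

lemma corrected_ext_second_difference:
  assumes n: "DIM('a) \<ge> 2" and t: "t > 0"
  shows "corrected_ext t (z + h) + corrected_ext t (z - h) = 2 * corrected_ext t z"
proof -
  have \<alpha>: "1 \<le> real DIM('a)/2" using n by simp
  define V where "V t = corrected_ext t (z + h) + corrected_ext t (z - h) - 2 * corrected_ext t z" for t
  have cont: "continuous_on {0<..} V"
    unfolding V_def by (intro continuous_intros corrected_ext_continuous n)
  have lim: "(V \<longlongrightarrow> 0) at_top"
  proof -
    define K where "K t z = correction_const * (monopole * AbelInt s (Theta (real DIM('a)/2) ((norm z)\<^sup>2)) t + dipole z / 2 * AbelInt s (Theta (real DIM('a)/2 + 1) ((norm z)\<^sup>2)) t)" for t and z :: 'a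
    have K: "((\<lambda>t. K t z) \<longlongrightarrow> correction_const * (monopole * 0 + dipole z / 2 * 0)) at_top" for z
      unfolding K_def by (intro tendsto_intros AbelInt_Theta_at_top s) (use \<alpha> in auto)
    have "((\<lambda>t. (heat_ext t (z + h) + heat_ext t (z - h) - 2 * heat_ext t z) + K t (z + h) + K t (z - h) - 2 * K t z) \<longlongrightarrow>
       0 + correction_const * (monopole * 0 + dipole (z + h) / 2 * 0) + correction_const * (monopole * 0 + dipole (z - h) / 2 * 0) - 2 * (correction_const * (monopole * 0 + dipole z / 2 * 0))) at_top"
      by (intro tendsto_intros K heat_ext_second_difference_at_top)
    moreover have "(heat_ext t (z + h) + heat_ext t (z - h) - 2 * heat_ext t z) + K t (z + h) + K t (z - h) - 2 * K t z = V t" for t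
      by (simp add: V_def corrected_ext_def K_def)
    ultimately show ?thesis by simp
  qed
  have D: "has_bochner_integral lborel (\<lambda>\<sigma>. indicator {0<..} \<sigma> * (\<sigma> powr (- 1 - s) * (V t - V (t + \<sigma>)))) 0" if "t > 0" for t
  proof -
    let ?w = "\<lambda>z \<tau>. indicator {0<..} \<tau> * (\<tau> powr (-1 - s) * (corrected_ext t z - corrected_ext (t + \<tau>) z))"
    have "has_bochner_integral lborel (\<lambda>\<tau>. ?w (z + h) \<tau> + ?w (z - h) \<tau> - 2 * ?w z \<tau>) (0 + 0 - 2 * 0)"
      by (intro has_bochner_integral_diff has_bochner_integral_add has_bochner_integral_mult_right corrected_ext_marchaud n that)
    then show ?thesis unfolding V_def by (simp add: algebra_simps)
  qed
  have "V t \<le> 0" by (rule marchaud_max_principle[OF cont lim D t])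
  moreover have "- V t \<le> 0"
  proof (rule marchaud_max_principle[where V="\<lambda>t. - V t"])
    show "continuous_on {0<..} (\<lambda>t. - V t)" by (intro continuous_intros cont)
    show "((\<lambda>t. - V t) \<longlongrightarrow> 0) at_top" using tendsto_minus[OF lim] by simp
    show "has_bochner_integral lborel (\<lambda>\<sigma>. indicator {0<..} \<sigma> * (\<sigma> powr (- 1 - s) * (- V t - - V (t + \<sigma>)))) 0" if "t > 0" for t
      using has_bochner_integral_mult_right[OF D[OF that], of "-1"] by (simp add: algebra_simps)
  qed (rule t)
  ultimately show ?thesis by (simp add: V_def)
qed

text \<open>The limit of the correction at time zero, divided by \<open>gauss_mass\<close>. It is
  added to \<open>u\<close>, so the singular terms of \<open>u\<close> appear here with the opposite
  sign.\<close>

definition singular_part :: "'a \<Rightarrow> real" where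
  "singular_part z = correction_const / gauss_mass * (monopole * ThetaInt (real DIM('a)/2 + 1 - s) * norm z powr (2 * s - real DIM('a))
     + dipole z / 2 * ThetaInt (real DIM('a)/2 + 2 - s) * norm z powr (2 * s - real DIM('a) - 2))"

lemma corrected_ext_at_0:
  assumes n: "DIM('a) \<ge> 2" and z: "z \<noteq> 0" and cont: "isCont u z"
  shows "(\<lambda>n. corrected_ext (inverse (real (Suc n))) z) \<longlonglongrightarrow> gauss_mass * (u z + singular_part z)"
proof -
  let ?X = "\<lambda>n. inverse (real (Suc n))" and ?q = "(norm z)\<^sup>2"
  have X: "0 < ?X n" "?X n \<le> 1" "?X \<longlonglongrightarrow> 0" for n
    using LIMSEQ_inverse_real_of_nat by (auto simp: divide_simps)
  have \<alpha>: "1 \<le> real DIM('a)/2" using n by simp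
  have q: "?q > 0" using z by simp
  have qp: "?q powr a = norm z powr (2 * a)" for a
  proof -
    have "?q = norm z powr 2" using z by (simp add: powr_numeral)
    then show ?thesis by (simp only: powr_powr)
  qed
  have "(\<lambda>n. corrected_ext (?X n) z) \<longlonglongrightarrow> gauss_mass * u z + correction_const * (monopole * (?q powr (s - real DIM('a)/2) * ThetaInt (real DIM('a)/2 + 1 - s))
     + dipole z / 2 * (?q powr (s - (real DIM('a)/2 + 1)) * ThetaInt ((real DIM('a)/2 + 1) + 1 - s)))"
    unfolding corrected_ext_def by (intro tendsto_intros heat_ext_at_0 cont X AbelInt_Theta_0 s q) (use \<alpha> in auto)
  also have "gauss_mass * u z + correction_const * (monopole * (?q powr (s - real DIM('a)/2) * ThetaInt (real DIM('a)/2 + 1 - s))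
     + dipole z / 2 * (?q powr (s - (real DIM('a)/2 + 1)) * ThetaInt ((real DIM('a)/2 + 1) + 1 - s))) = gauss_mass * (u z + singular_part z)"
  proof -
    have e: "2 * (s - real DIM('a)/2) = 2 * s - real DIM('a)" "2 * (s - (real DIM('a)/2 + 1)) = 2 * s - real DIM('a) - 2"
      "(real DIM('a)/2 + 1) + 1 - s = real DIM('a)/2 + 2 - s" by auto
    show ?thesis unfolding qp e singular_part_def using gauss_mass_pos by (simp add: field_simps)
  qed
  finally show ?thesis .
qed

lemma regular_part_midpoint:
  assumes n: "DIM('a) \<ge> 2" and cont: "continuous_on (UNIV - {0}) u"
    and nz: "z \<noteq> 0" "z + h \<noteq> 0" "z - h \<noteq> 0"
  shows "(u (z + h) + singular_part (z + h)) + (u (z - h) + singular_part (z - h)) = 2 * (u z + singular_part z)"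
proof -
  have c: "isCont u x" if "x \<noteq> 0" for x
    using cont that by (auto simp: continuous_on_eq_continuous_at open_Diff)
  let ?X = "\<lambda>n. inverse (real (Suc n))"
  have "(\<lambda>n. corrected_ext (?X n) (z + h) + corrected_ext (?X n) (z - h)) \<longlonglongrightarrow> gauss_mass * (u (z + h) + singular_part (z + h)) + gauss_mass * (u (z - h) + singular_part (z - h))"
    by (intro tendsto_add corrected_ext_at_0 n nz c)
  moreover have "(\<lambda>n. 2 * corrected_ext (?X n) z) \<longlonglongrightarrow> 2 * (gauss_mass * (u z + singular_part z))"
    by (intro tendsto_intros corrected_ext_at_0 n nz c)
  moreover have "corrected_ext (?X n) (z + h) + corrected_ext (?X n) (z - h) = 2 * corrected_ext (?X n) z" for n
    by (rule corrected_ext_second_difference[OF n]) simp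
  ultimately have "gauss_mass * (u (z + h) + singular_part (z + h)) + gauss_mass * (u (z - h) + singular_part (z - h)) = 2 * (gauss_mass * (u z + singular_part z))"
    using LIMSEQ_unique by (simp only:) blast
  then have "gauss_mass * ((u (z + h) + singular_part (z + h)) + (u (z - h) + singular_part (z - h))) = gauss_mass * (2 * (u z + singular_part z))" by (simp add: algebra_simps)
  then show ?thesis using gauss_mass_pos by simp
qed

end

section \<open>Functions with the midpoint property off the origin\<close>

lemma midpoint_progression:
  fixes v :: "'a::real_vector \<Rightarrow> real"
  assumes "\<And>x. x \<noteq> 0 \<Longrightarrow> x + h \<noteq> 0 \<Longrightarrow> x - h \<noteq> 0 \<Longrightarrow> v (x + h) + v (x - h) = 2 * v x"
    and nz: "\<And>k::int. z + of_int k *\<^sub>R h \<noteq> 0"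
  shows "v (z + real k *\<^sub>R h) = v z + real k * (v (z + h) - v z)"
proof (induction k rule: less_induct)
  case (less k)
  consider "k = 0" | "k = 1" | m where "k = Suc (Suc m)" by (metis One_nat_def old.nat.exhaust)
  then show ?case
  proof cases
    case 3
    define x where "x = z + real (Suc m) *\<^sub>R h"
    have e: "x + h = z + real k *\<^sub>R h" "x - h = z + real m *\<^sub>R h" unfolding x_def 3 by (simp_all add: algebra_simps scaleR_2)
    have nz': "z + real j *\<^sub>R h \<noteq> 0" for j using nz[of "int j"] by simp
    have "v (x + h) + v (x - h) = 2 * v x" using assms(1)[of x] e nz' unfolding x_def by metis
    moreover have "v x = v z + real (Suc m) * (v (z + h) - v z)" unfolding x_def by (rule less) (simp add: 3)
    moreover have "v (x - h) = v z + real m * (v (z + h) - v z)" unfolding e by (rule less) (simp add: 3)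
    ultimately have "v (x + h) = 2 * (v z + real (Suc m) * (v (z + h) - v z)) - (v z + real m * (v (z + h) - v z))" by simp
    then show ?thesis unfolding e 3 by (simp add: algebra_simps)
  qed auto
qed

text \<open>For linearly independent points the line through them misses the origin, so
  \<open>v\<close> runs through an arithmetic progression along equally spaced points of it; the
  upper bound far out forbids growth in either direction. Dependent points are compared through a
  third point outside their common line, available in dimension at least 2.\<close>

lemma midpoint_affine_bounded_const:
  fixes v :: "'a::euclidean_space \<Rightarrow> real"
  assumes n: "DIM('a) \<ge> 2"
    and mid: "\<And>x h. x \<noteq> 0 \<Longrightarrow> x + h \<noteq> 0 \<Longrightarrow> x - h \<noteq> 0 \<Longrightarrow> v (x + h) + v (x - h) = 2 * v x"
    and bound: "\<And>x. norm x \<ge> R \<Longrightarrow> v x \<le> M"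
    and y: "y \<noteq> 0" and z: "z \<noteq> 0"
  shows "v y = v z"
proof -
  have half: "v (x + h) \<le> v x" if x: "\<And>k::int. x + of_int k *\<^sub>R h \<noteq> 0" and h: "h \<noteq> 0" for x h
  proof (rule ccontr)
    assume "\<not> v (x + h) \<le> v x"
    then have d: "v (x + h) - v x > 0" by simp
    obtain k :: nat where k: "real k > max ((R + norm x) / norm h) ((M - v x) / (v (x + h) - v x))"
      using reals_Archimedean2 by blast
    then have k1: "real k * norm h > R + norm x" and k2: "real k * (v (x + h) - v x) > M - v x"
      using h d by (auto simp: pos_divide_less_eq)
    have "norm (real k *\<^sub>R h) \<le> norm (x + real k *\<^sub>R h) + norm x"
      using norm_triangle_ineq4[of "x + real k *\<^sub>R h" x] by simp
    then have "R \<le> norm (x + real k *\<^sub>R h)" using k1 by simp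
    then have "v (x + real k *\<^sub>R h) \<le> M" by (rule bound)
    moreover have "v (x + real k *\<^sub>R h) = v x + real k * (v (x + h) - v x)"
      by (rule midpoint_progression) (use mid x in auto)
    ultimately show False using k2 by simp
  qed
  have indep: "v x = v z" if z: "z \<noteq> 0" and x: "x \<notin> span {z}" for x z
  proof -
    have nz: "z + of_int k *\<^sub>R (x - z) \<noteq> 0" for k :: int
    proof
      assume e: "z + of_int k *\<^sub>R (x - z) = 0"
      show False
      proof (cases "k = 0")
        case True
        with e z show False by simp
      next
        case False
        have "of_int k *\<^sub>R x = (of_int k - 1) *\<^sub>R z" using e by (simp add: algebra_simps)
        then have "x = ((of_int k - 1) / of_int k) *\<^sub>R z" using False
          by (metis (no_types, lifting) divide_inverse_commute of_int_eq_0_iff real_vector_affinity_eq scaleR_left_imp_eq scaleR_scaleR scale_one right_inverse mult.commute)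
        then show False using x by (auto simp: span_singleton)
      qed
    qed
    have xz: "x - z \<noteq> 0" using x span_base[of z "{z}"] by auto
    have "v (z + (x - z)) \<le> v z" by (rule half[OF nz xz])
    moreover have "v (x + (z - x)) \<le> v x"
    proof (rule half)
      fix k :: int
      \<comment> \<open>Swapping the endpoints replaces the index \<open>k\<close> by
        \<open>1 - k\<close>; the nonvanishing condition runs over all integers so that it survives
        the swap.\<close>
      show "x + of_int k *\<^sub>R (z - x) \<noteq> 0" using nz[of "1 - k"] by (simp add: algebra_simps)
    qed (use xz in auto)
    ultimately show ?thesis by simp
  qed
  show ?thesis
  proof (cases "y \<in> span {z}")
    case False
    then show ?thesis by (rule indep[OF z])
  next
    case True
    then obtain c where c: "y = c *\<^sub>R z" by (auto simp: span_singleton)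
    have "span {z} \<noteq> UNIV"
    proof
      assume "span {z} = UNIV"
      then have "dim (span {z}) = DIM('a)" by (simp add: dim_UNIV)
      moreover have "dim (span {z}) \<le> 1" using dim_le_card'[of "{z}"] by (simp add: dim_span)
      ultimately show False using n by simp
    qed
    then obtain x where x: "x \<notin> span {z}" by auto
    have "x \<notin> span {y}" using x unfolding c span_singleton by auto
    then have "v x = v y" by (rule indep[OF y])
    then show ?thesis using indep[OF z x] by simp
  qed
qed

section \<open>From the midpoint equation to the explicit form of \<open>u\<close>\<close>

context harmonic_off_0
begin

text \<open>The signs \<open>\<sigma>\<close> and \<open>\<sigma>'\<close> encode whether a bound is
  from above or from below, so that the four combinations share one proof.\<close>

lemma bocher:
  assumes n: "DIM('a) \<ge> 2" and cont: "continuous_on (UNIV - {0}) u"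
    and near: "r > 0" "\<bar>\<sigma>\<bar> = 1" "\<And>x. x \<in> ball 0 r - {0} \<Longrightarrow> \<sigma> * u x \<le> M"
    and far: "R > 0" "\<bar>\<sigma>'\<bar> = 1" "\<And>x. R \<le> norm x \<Longrightarrow> \<sigma>' * u x \<le> M'"
  shows "\<exists>a b. \<forall>x. x \<noteq> 0 \<longrightarrow> u x = a * norm x powr (2 * s - real DIM('a)) + b"
proof -
  define A where "A = correction_const / gauss_mass * monopole * ThetaInt (real DIM('a)/2 + 1 - s)"
  define E where "E = correction_const / gauss_mass * ThetaInt (real DIM('a)/2 + 2 - s) / 2"
  let ?e = "2 * s - real DIM('a)"
  \<comment> \<open>With these exponents \<open>singular_part\<close> is bounded outside the unit
    ball, and adding it preserves the one-sided bound at infinity.\<close>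
  have e0: "?e \<le> 0" "?e - 1 \<le> 0" using s n by linarith+
  have singular_part: "singular_part z = A * norm z powr ?e + E * dipole z * norm z powr (?e - 2)" for z
    by (simp add: singular_part_def A_def E_def algebra_simps)
  obtain \<Gamma> where G: "\<And>z. norm (dipole z) \<le> \<Gamma> * norm z" using linear_bounded[OF linear_dipole] by blast
  have singular_part_bound: "\<bar>singular_part z\<bar> \<le> \<bar>A\<bar> + \<bar>E\<bar> * \<bar>\<Gamma>\<bar>" if z: "norm z \<ge> 1" for z
  proof -
    have 1: "norm z powr ?e \<le> 1" "norm z powr (?e - 1) \<le> 1"
    proof -
      have "z \<noteq> 0" using z by auto
      then show "norm z powr ?e \<le> 1" "norm z powr (?e - 1) \<le> 1"
        using powr_mono[OF e0(1) z] powr_mono[OF e0(2) z] by simp_all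
    qed
    have "\<bar>dipole z\<bar> * norm z powr (?e - 2) \<le> (\<bar>\<Gamma>\<bar> * norm z) * norm z powr (?e - 2)"
    proof (rule mult_right_mono)
      have "\<Gamma> * norm z \<le> \<bar>\<Gamma>\<bar> * norm z" by (intro mult_right_mono) auto
      then show "\<bar>dipole z\<bar> \<le> \<bar>\<Gamma>\<bar> * norm z" using G[of z] by simp
    qed simp
    also have "\<dots> = \<bar>\<Gamma>\<bar> * norm z powr (?e - 1)"
    proof -
      have "?e - 1 = 1 + (?e - 2)" by simp
      then have "norm z powr (?e - 1) = norm z powr 1 * norm z powr (?e - 2)" by (simp only: powr_add)
      then show ?thesis using z by simp
    qed
    also have "\<dots> \<le> \<bar>\<Gamma>\<bar> * 1" using 1 by (intro mult_left_mono) auto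
    finally have 2: "\<bar>E\<bar> * (\<bar>dipole z\<bar> * norm z powr (?e - 2)) \<le> \<bar>E\<bar> * \<bar>\<Gamma>\<bar>" by (intro mult_left_mono) auto
    have 3: "\<bar>A\<bar> * norm z powr ?e \<le> \<bar>A\<bar> * 1" using 1 by (intro mult_left_mono) auto
    have "\<bar>singular_part z\<bar> \<le> \<bar>A * norm z powr ?e\<bar> + \<bar>E * dipole z * norm z powr (?e - 2)\<bar>" unfolding singular_part by (rule abs_triangle_ineq)
    also have "\<dots> = \<bar>A\<bar> * norm z powr ?e + \<bar>E\<bar> * (\<bar>dipole z\<bar> * norm z powr (?e - 2))" by (simp add: abs_mult)
    finally show ?thesis using 2 3 by simp
  qed
  define v where "v x = u x + singular_part x" for x
  have const: "v y = v z" if "y \<noteq> 0" "z \<noteq> 0" for y z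
  proof -
    have "\<sigma>' * v y = \<sigma>' * v z"
    proof (rule midpoint_affine_bounded_const[OF n _ _ that, where v="\<lambda>x. \<sigma>' * v x"])
      fix x h :: 'a assume nz: "x \<noteq> 0" "x + h \<noteq> 0" "x - h \<noteq> 0"
      have "v (x + h) + v (x - h) = 2 * v x" unfolding v_def by (rule regular_part_midpoint[OF n cont nz])
      then have "\<sigma>' * (v (x + h) + v (x - h)) = \<sigma>' * (2 * v x)" by simp
      then show "\<sigma>' * v (x + h) + \<sigma>' * v (x - h) = 2 * (\<sigma>' * v x)" by (simp add: algebra_simps)
    next
      fix x :: 'a assume x: "max R 1 \<le> norm x"
      have "\<sigma>' * singular_part x \<le> \<bar>\<sigma>' * singular_part x\<bar>" by (rule abs_ge_self)
      also have "\<dots> \<le> \<bar>A\<bar> + \<bar>E\<bar> * \<bar>\<Gamma>\<bar>" using singular_part_bound[of x] x far(2) by (simp add: abs_mult)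
      finally show "\<sigma>' * v x \<le> M' + (\<bar>A\<bar> + \<bar>E\<bar> * \<bar>\<Gamma>\<bar>)" using far(3)[of x] x by (simp add: v_def algebra_simps)
    qed
    then show ?thesis using far(2) by auto
  qed
  obtain e1 :: 'a where e1: "e1 \<in> Basis" using nonempty_Basis by blast
  define b where "b = v e1"
  have u_eq: "u z = b - singular_part z" if "z \<noteq> 0" for z
    using const[OF that, of e1] nonzero_Basis[OF e1] by (simp add: b_def v_def)
  have E0: "E * dipole z = 0" for z
  proof (cases "z = 0")
    case True
    then show ?thesis using linear_0[OF linear_dipole] by simp
  next
    case z: False
    let ?N1 = "norm z powr ?e" and ?N2 = "norm z powr (?e - 2)"
    \<comment> \<open>The dipole term is odd along the line through \<open>z\<close> and of order
      \<open>\<rho> powr (?e - 1)\<close>, one power more singular than the monopole. At one of the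
      points \<open>\<rho> z\<close> and \<open>-\<rho> z\<close> it pushes against the one-sided
      bound; after multiplication by \<open>\<rho> powr (1 - ?e)\<close> the limit as
      \<open>\<rho>\<close> tends to \<open>0\<close> isolates its coefficient.\<close>
    have key: "\<bar>E * dipole z\<bar> * ?N2 \<le> (M - \<sigma> * b) * \<rho> powr (1 - ?e) + \<sigma> * A * ?N1 * \<rho>" if \<rho>: "0 < \<rho>" "\<rho> < r / norm z" for \<rho>
    proof -
      have pm: "\<sigma> * (b - A * (\<rho> powr ?e * ?N1) - \<epsilon> * (E * dipole z * (\<rho> powr (?e - 1) * ?N2))) \<le> M" if \<epsilon>: "\<bar>\<epsilon>\<bar> = 1" for \<epsilon> :: real
      proof -
        let ?x = "(\<epsilon> * \<rho>) *\<^sub>R z"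
        have nx: "norm ?x = \<rho> * norm z" using \<rho> \<epsilon> by (simp add: abs_mult)
        have x: "?x \<in> ball 0 r - {0}" using nx \<rho> z \<epsilon> by (auto simp: pos_less_divide_eq)
        have "?e - 1 = 1 + (?e - 2)" by simp
        then have "\<rho> powr (?e - 1) = \<rho> powr 1 * \<rho> powr (?e - 2)" by (simp only: powr_add)
        then have r1: "\<rho> powr (?e - 1) = \<rho> * \<rho> powr (?e - 2)" using \<rho> by simp
        have "dipole ?x = \<epsilon> * \<rho> * dipole z" using linear_scale[OF linear_dipole, of "\<epsilon> * \<rho>" z] by simp
        then have "singular_part ?x = A * (\<rho> powr ?e * ?N1) + \<epsilon> * (E * dipole z * (\<rho> powr (?e - 1) * ?N2))"
          unfolding singular_part nx powr_mult r1 by simp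
        then have "u ?x = b - A * (\<rho> powr ?e * ?N1) - \<epsilon> * (E * dipole z * (\<rho> powr (?e - 1) * ?N2))"
          using u_eq[of ?x] x by simp
        then show ?thesis using near(3)[OF x] by simp
      qed
      \<comment> \<open>Picks the side of the origin on which the dipole term raises
        \<open>\<sigma> * u\<close>.\<close>
      define \<epsilon> :: real where "\<epsilon> = (if \<sigma> * (E * dipole z) \<ge> 0 then -1 else 1)"
      have "- \<sigma> * \<epsilon> * (E * dipole z) = \<bar>E * dipole z\<bar>"
      proof -
        have "\<bar>\<sigma> * (E * dipole z)\<bar> = \<bar>E * dipole z\<bar>" using near(2) by (simp only: abs_mult[of \<sigma>] mult_1_left)
        moreover have "- \<sigma> * (if \<sigma> * x \<ge> 0 then -1 else 1) * x = \<bar>\<sigma> * x\<bar>" for x by auto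
        ultimately show ?thesis unfolding \<epsilon>_def by metis
      qed
      moreover have "\<sigma> * (b - A * (\<rho> powr ?e * ?N1) - \<epsilon> * (E * dipole z * (\<rho> powr (?e - 1) * ?N2))) \<le> M"
        by (rule pm) (simp add: \<epsilon>_def)
      moreover have "\<sigma> * (b - A * (\<rho> powr ?e * ?N1) - \<epsilon> * (E * dipole z * (\<rho> powr (?e - 1) * ?N2))) =
         \<sigma> * b - \<sigma> * A * ?N1 * \<rho> powr ?e + (- \<sigma> * \<epsilon> * (E * dipole z)) * (\<rho> powr (?e - 1) * ?N2)" by (simp add: algebra_simps)
      ultimately have "\<bar>E * dipole z\<bar> * (\<rho> powr (?e - 1) * ?N2) \<le> (M - \<sigma> * b) + \<sigma> * A * ?N1 * \<rho> powr ?e" by simp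
      then have "\<bar>E * dipole z\<bar> * (\<rho> powr (?e - 1) * ?N2) * \<rho> powr (1 - ?e) \<le> ((M - \<sigma> * b) + \<sigma> * A * ?N1 * \<rho> powr ?e) * \<rho> powr (1 - ?e)"
        by (intro mult_right_mono) auto
      moreover have "\<rho> powr (?e - 1) * \<rho> powr (1 - ?e) = 1" "\<rho> powr ?e * \<rho> powr (1 - ?e) = \<rho>"
        using \<rho> by (simp_all add: powr_add[symmetric])
      moreover have "a * (x * c) * y = a * c * (x * y)" "(m + f * x) * y = m * y + f * (x * y)" for a x c y m f :: real
        by (simp_all add: algebra_simps)
      ultimately show ?thesis by (simp only: mult_1_right)
    qed
    have l: "((\<lambda>\<rho>. (M - \<sigma> * b) * \<rho> powr (1 - ?e) + \<sigma> * A * ?N1 * \<rho>) \<longlongrightarrow> (M - \<sigma> * b) * 0 powr (1 - ?e) + \<sigma> * A * ?N1 * 0) (at_right 0)"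
      using e0 by (intro tendsto_intros tendsto_powr' eventually_at_right_less) (auto simp: eventually_at_filter)
    have "\<bar>E * dipole z\<bar> * ?N2 \<le> (M - \<sigma> * b) * 0 powr (1 - ?e) + \<sigma> * A * ?N1 * 0"
    proof (rule tendsto_lowerbound[OF l])
      show "eventually (\<lambda>\<rho>. \<bar>E * dipole z\<bar> * ?N2 \<le> (M - \<sigma> * b) * \<rho> powr (1 - ?e) + \<sigma> * A * ?N1 * \<rho>) (at_right 0)"
        unfolding eventually_at_right_field using key near(1) z by (intro exI[of _ "r / norm z"]) auto
    qed simp
    then have "\<bar>E * dipole z\<bar> * ?N2 \<le> 0" by simp
    moreover have "?N2 > 0" using z by simp
    ultimately show ?thesis by (simp add: mult_le_0_iff)
  qed
  show ?thesis
  proof (intro exI allI impI)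
    fix x :: 'a assume "x \<noteq> 0"
    then show "u x = (- A) * norm x powr (2 * s - real DIM('a)) + b"
      using u_eq[of x] E0[of x] by (simp add: singular_part)
  qed
qed

end

theorem theorem1p2:
  fixes u :: "'a::euclidean_space \<Rightarrow> real" and s :: real
  assumes "DIM('a) \<ge> 2"
    and "0 < s" and "s < 1"
    and "frac_harmonic s (UNIV - {0}) u"
    and "\<exists>r>0. (\<exists>M. \<forall>x\<in>ball 0 r - {0}. u x \<le> M) \<or> (\<exists>M. \<forall>x\<in>ball 0 r - {0}. M \<le> u x)"
    and "\<exists>R>0. (\<exists>M. \<forall>x. R \<le> norm x \<longrightarrow> u x \<le> M) \<or> (\<exists>M. \<forall>x. R \<le> norm x \<longrightarrow> M \<le> u x)"
  shows "\<exists>a b::real. \<forall>x. x \<noteq> 0 \<longrightarrow> u x = a * norm x powr (2 * s - real DIM('a)) + b"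
proof -
  define p where "p = real DIM('a) + 2 * s"
  have cont: "continuous_on (UNIV - {0}) u" and weak: "weak_sol s (UNIV - {0}) u"
    using assms(4) by (auto simp: frac_harmonic_def)
  then have tail: "tail_space s u" by (simp add: weak_sol_def)
  \<comment> \<open>Continuity off a single point makes \<open>u\<close> Borel measurable whatever
    its value at \<open>0\<close>, so all integrals can be taken over \<open>lborel\<close> and its
    products.\<close>
  have meas [measurable]: "u \<in> borel_measurable borel"
  proof -
    have "(\<lambda>x. if x \<in> UNIV - {0} then u x else u x) \<in> borel_measurable borel"
    proof (rule borel_measurable_continuous_on_if)
      have "- (UNIV - {0}) = {0::'a}" by auto
      then show "continuous_on (- (UNIV - {0})) u" by simp
    qed (use cont in auto)
    then show ?thesis by simp
  qed
  have wt: "\<bar>u x\<bar> * wt p x = \<bar>u x\<bar> / (1 + norm x) powr (real DIM('a) + 2 * s)" for x :: 'a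
    unfolding wt_def p_def powr_minus divide_inverse ..
  have int: "integrable lborel (\<lambda>x. \<bar>u x\<bar> * wt p x)"
  proof (rule integrableI_bounded)
    have "(\<integral>\<^sup>+ x. ennreal (norm (\<bar>u x\<bar> * wt p x)) \<partial>lborel) = (\<integral>\<^sup>+ y. ennreal (\<bar>u y\<bar> / (1 + norm y) powr (real DIM('a) + 2 * s)) \<partial>lebesgue)"
      unfolding nn_integral_completion wt[symmetric] by simp
    also have "\<dots> < \<infinity>" using tail by (simp add: tail_space_def)
    finally show "(\<integral>\<^sup>+ x. ennreal (norm (\<bar>u x\<bar> * wt p x)) \<partial>lborel) < \<infinity>" .
  qed measurable
  interpret harmonic_off_0 s p "TYPE('a)" u
    by unfold_locales (use assms int weak meas p_def in auto)
  obtain r M1 \<sigma> where near: "r > 0" "\<bar>\<sigma>\<bar> = (1::real)" "\<And>x. x \<in> ball 0 r - {0} \<Longrightarrow> \<sigma> * u x \<le> M1"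
  proof -
    from assms(5) obtain r where r: "r > 0" and "(\<exists>M. \<forall>x\<in>ball 0 r - {0}. u x \<le> M) \<or> (\<exists>M. \<forall>x\<in>ball 0 r - {0}. M \<le> u x)" by blast
    then consider M where "\<forall>x\<in>ball 0 r - {0}. u x \<le> M" | M where "\<forall>x\<in>ball 0 r - {0}. M \<le> u x" by blast
    then show thesis
    proof cases
      case 1 then show thesis using that[of r 1 M] r by auto
    next
      case 2 then show thesis using that[of r "-1" "-M"] r by auto
    qed
  qed
  obtain R M2 \<sigma>' where far: "R > 0" "\<bar>\<sigma>'\<bar> = (1::real)" "\<And>x. R \<le> norm x \<Longrightarrow> \<sigma>' * u x \<le> M2"
  proof -
    from assms(6) obtain R where R: "R > 0" and "(\<exists>M. \<forall>x. R \<le> norm x \<longrightarrow> u x \<le> M) \<or> (\<exists>M. \<forall>x. R \<le> norm x \<longrightarrow> M \<le> u x)" by blast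
    then consider M where "\<forall>x. R \<le> norm x \<longrightarrow> u x \<le> M" | M where "\<forall>x. R \<le> norm x \<longrightarrow> M \<le> u x" by blast
    then show thesis
    proof cases
      case 1 then show thesis using that[of R 1 M] R by auto
    next
      case 2 then show thesis using that[of R "-1" "-M"] R by auto
    qed
  qed
  show ?thesis by (rule bocher[OF assms(1) cont near far])
qed

end
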